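(* Let $k$ be a commutative ring with unit and $A$ a unital associative $k$-algebra. Then $HS_*(A)\cong H_*(\Delta S_+,\,B_*^{sym_+}A)$.
   Context: Category $\Delta S$: objects are the sets $[n]=\{0,1,\dots,n\}$, $n\ge 0$; a morphism $[n]\to[m]$ is a set map $f$ together with a total order on each fibre $f^{-1}(j)$. The composite of $f:[n]\to[m]$ and $g:[m]\to[l]$ has underlying map $g\circ f$, and the fibre over $i$ is ordered by concatenating the ordered fibres $f^{-1}(j)$, with $j$ running over $g^{-1}(i)$ in its given order. $\Delta S_+$ is obtained from $\Delta S$ by adjoining the object $[-1]=\emptyset$ and a unique morphism $\iota_n:[-1]\to[n]$ for each $n\ge -1$ (there are no morphisms $[n]\to[-1]$ for $n\ge 0$). The symmetric bar construction $B_*^{sym}A:\Delta S\to k\text{-Mod}$ is the covariant functor $[n]\mapsto A^{\otimes(n+1)}$; a morphism $\alpha:[n]\to[m]$ sends $a_0\otimes\cdots\otimes a_n$ to $b_0\otimes\cdots\otimes b_m$, where $b_j$ is the product of the $a_i$, $i\in\alpha^{-1}(j)$, in the given order of the fibre ($b_j=1$ if the fibre is empty). The functor $B_*^{sym_+}A:\Delta S_+\to k\text{-Mod}$ agrees with $B_*^{sym}A$ on $\Delta S$, has value $k$ at $[-1]$, and sends $\iota_n$ to the unit map $k\to A^{\otimes(n+1)}$. For a small category $\mathscr C$ and functor $F:\mathscr C\to k\text{-Mod}$, $H_*(\mathscr C,F)=\mathrm{Tor}^{\mathscr C}_*(\underline{k},F)$, i.e. the left derived functors of $\mathrm{colim}_{\mathscr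 C}$ evaluated at $F$ ($\underline{k}$ is the constant contravariant functor with value $k$). Symmetric homology is $HS_*(A)=H_*(\Delta S,B_*^{sym}A)$. *)

theory Defs
  imports "HOL-Algebra.Module" "HOL-Algebra.AbelCoset" "HOL-Library.FuncSet"
begin

section \<open>Modules\<close>

text \<open>
  Modules are those of \<^theory>\<open>HOL-Algebra.Module\<close>.  Their records inherit the ring fields
  \<open>mult\<close> and \<open>one\<close>, which play no role for modules and are left undefined below.
\<close>

definition module_hom ::
  "('r, 'x) ring_scheme \<Rightarrow> ('r, 'a) module \<Rightarrow> ('r, 'b) module \<Rightarrow> ('a \<Rightarrow> 'b) set"
  where "module_hom R M N =
    {h \<in> carrier M \<rightarrow> carrier N.
      (\<forall>x\<in>carrier M. \<forall>y\<in>carrier M. h (x \<oplus>\<^bsub>M\<^esub> y) = h x \<oplus>\<^bsub>N\<^esub> h y) \<and>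
      (\<forall>r\<in>carrier R. \<forall>x\<in>carrier M. h (r \<odot>\<^bsub>M\<^esub> x) = r \<odot>\<^bsub>N\<^esub> h x)}"

definition module_isomorphic ::
  "('r, 'x) ring_scheme \<Rightarrow> ('r, 'a) module \<Rightarrow> ('r, 'b) module \<Rightarrow> bool"
  where "module_isomorphic R M N \<longleftrightarrow>
    (\<exists>h\<in>module_hom R M N. bij_betw h (carrier M) (carrier N))"

definition module_span :: "('r, 'x) ring_scheme \<Rightarrow> ('r, 'a) module \<Rightarrow> 'a set \<Rightarrow> 'a set"
  where "module_span R M S = \<Inter>{H. submodule H R M \<and> S \<subseteq> H}"

definition quotient_module :: "('r, 'a) module \<Rightarrow> 'a set \<Rightarrow> ('r, 'a set) module"
  where "quotient_module M H =
    \<lparr>carrier = a_rcosets\<^bsub>M\<^esub> H, mult = undefined, one = undefined,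
     zero = H, add = (\<lambda>X Y. X <+>\<^bsub>M\<^esub> Y),
     smult = (\<lambda>r X. H <+>\<^bsub>M\<^esub> ((\<lambda>x. r \<odot>\<^bsub>M\<^esub> x) ` X))\<rparr>"

text \<open>The map of quotients \<open>M/K \<rightarrow> N/H\<close> induced by a map \<open>f : M \<rightarrow> N\<close> with \<open>f(K) \<subseteq> H\<close>.\<close>

definition induced_map :: "('r, 'b) module \<Rightarrow> 'b set \<Rightarrow> ('a \<Rightarrow> 'b) \<Rightarrow> 'a set \<Rightarrow> 'b set"
  where "induced_map N H f X = (\<Union>x\<in>X. H +>\<^bsub>N\<^esub> f x)"

definition regular_module :: "('r, 'x) ring_scheme \<Rightarrow> ('r, 'r) module"
  where "regular_module R =
    \<lparr>carrier = carrier R, mult = undefined, one = undefined,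
     zero = \<zero>\<^bsub>R\<^esub>, add = (\<lambda>x y. x \<oplus>\<^bsub>R\<^esub> y), smult = (\<lambda>r x. r \<otimes>\<^bsub>R\<^esub> x)\<rparr>"

text \<open>The copy of \<open>M\<close> with carrier \<open>\<phi> ` carrier M\<close>, for \<open>\<phi>\<close> injective on \<open>carrier M\<close>.\<close>

definition transport_module :: "('a \<Rightarrow> 'b) \<Rightarrow> ('r, 'a) module \<Rightarrow> ('r, 'b) module"
  where "transport_module \<phi> M =
    (let \<psi> = inv_into (carrier M) \<phi> in
    \<lparr>carrier = \<phi> ` carrier M, mult = undefined, one = undefined,
     zero = \<phi> \<zero>\<^bsub>M\<^esub>, add = (\<lambda>x y. \<phi> (\<psi> x \<oplus>\<^bsub>M\<^esub> \<psi> y)), smult = (\<lambda>r x. \<phi> (r \<odot>\<^bsub>M\<^esub> \<psi> x))\<rparr>)"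

definition direct_sum :: "'i set \<Rightarrow> ('i \<Rightarrow> ('r, 'a) module) \<Rightarrow> ('r, 'i \<Rightarrow> 'a) module"
  where "direct_sum I M =
    \<lparr>carrier = {g \<in> \<Pi>\<^sub>E i\<in>I. carrier (M i). finite {i \<in> I. g i \<noteq> \<zero>\<^bsub>M i\<^esub>}},
     mult = undefined, one = undefined,
     zero = (\<lambda>i\<in>I. \<zero>\<^bsub>M i\<^esub>),
     add = (\<lambda>g h. \<lambda>i\<in>I. g i \<oplus>\<^bsub>M i\<^esub> h i),
     smult = (\<lambda>r g. \<lambda>i\<in>I. r \<odot>\<^bsub>M i\<^esub> g i)\<rparr>"

definition direct_sum_incl ::
  "'i set \<Rightarrow> ('i \<Rightarrow> ('r, 'a) module) \<Rightarrow> 'i \<Rightarrow> 'a \<Rightarrow> 'i \<Rightarrow> 'a"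
  where "direct_sum_incl I M i a = (\<lambda>j\<in>I. if j = i then a else \<zero>\<^bsub>M j\<^esub>)"

definition free_module :: "('r, 'x) ring_scheme \<Rightarrow> 's set \<Rightarrow> ('r, 's \<Rightarrow> 'r) module"
  where "free_module R S =
    \<lparr>carrier = {g. (\<forall>s. g s \<in> carrier R) \<and> finite {s. g s \<noteq> \<zero>\<^bsub>R\<^esub>} \<and> {s. g s \<noteq> \<zero>\<^bsub>R\<^esub>} \<subseteq> S},
     mult = undefined, one = undefined,
     zero = (\<lambda>s. \<zero>\<^bsub>R\<^esub>),
     add = (\<lambda>g h s. g s \<oplus>\<^bsub>R\<^esub> h s),
     smult = (\<lambda>r g s. r \<otimes>\<^bsub>R\<^esub> g s)\<rparr>"

definition free_gen :: "('r, 'x) ring_scheme \<Rightarrow> 's \<Rightarrow> 's \<Rightarrow> 'r"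
  where "free_gen R s = (\<lambda>t. if t = s then \<one>\<^bsub>R\<^esub> else \<zero>\<^bsub>R\<^esub>)"

text \<open>The linear map from a free module to \<open>M\<close> that sends each generator \<open>s\<close> to \<open>h s\<close>.\<close>

definition lin_ext ::
  "('r, 'x) ring_scheme \<Rightarrow> ('r, 'a) module \<Rightarrow> ('s \<Rightarrow> 'a) \<Rightarrow> ('s \<Rightarrow> 'r) \<Rightarrow> 'a"
  where "lin_ext R M h g = (\<Oplus>\<^bsub>M\<^esub>s\<in>{s. g s \<noteq> \<zero>\<^bsub>R\<^esub>}. g s \<odot>\<^bsub>M\<^esub> h s)"

section \<open>Small categories and functors to modules\<close>

record ('o, 'm) category =
  Obj :: "'o set"
  Hom :: "'o \<Rightarrow> 'o \<Rightarrow> 'm set"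
  Ident :: "'o \<Rightarrow> 'm"
  Comp :: "'o \<Rightarrow> 'o \<Rightarrow> 'o \<Rightarrow> 'm \<Rightarrow> 'm \<Rightarrow> 'm"

text \<open>
  \<open>Comp C x y z g f\<close> is the composite \<open>g \<circ> f\<close> of \<open>f : x \<rightarrow> y\<close> and \<open>g : y \<rightarrow> z\<close>.
  Hom sets are indexed by source and target and need not be disjoint.
\<close>

locale small_category =
  fixes C :: "('o, 'm) category"
  assumes Ident_Hom: "x \<in> Obj C \<Longrightarrow> Ident C x \<in> Hom C x x"
    and Comp_Hom: "\<lbrakk>x \<in> Obj C; y \<in> Obj C; z \<in> Obj C; f \<in> Hom C x y; g \<in> Hom C y z\<rbrakk>
      \<Longrightarrow> Comp C x y z g f \<in> Hom C x z"
    and Comp_Ident_right: "\<lbrakk>x \<in> Obj C; y \<in> Obj C; f \<in> Hom C x y\<rbrakk>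
      \<Longrightarrow> Comp C x x y f (Ident C x) = f"
    and Comp_Ident_left: "\<lbrakk>x \<in> Obj C; y \<in> Obj C; f \<in> Hom C x y\<rbrakk>
      \<Longrightarrow> Comp C x y y (Ident C y) f = f"
    and Comp_assoc: "\<lbrakk>w \<in> Obj C; x \<in> Obj C; y \<in> Obj C; z \<in> Obj C;
        f \<in> Hom C w x; g \<in> Hom C x y; h \<in> Hom C y z\<rbrakk>
      \<Longrightarrow> Comp C w x z (Comp C x y z h g) f = Comp C w y z h (Comp C w x y g f)"

record ('o, 'm, 'r, 'v) mod_functor =
  fobj :: "'o \<Rightarrow> ('r, 'v) module"
  fmap :: "'o \<Rightarrow> 'o \<Rightarrow> 'm \<Rightarrow> 'v \<Rightarrow> 'v"

locale module_functor =
  fixes C :: "('o, 'm) category" and R :: "('r, 'x) ring_scheme"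
    and F :: "('o, 'm, 'r, 'v) mod_functor"
  assumes fobj_module: "x \<in> Obj C \<Longrightarrow> module R (fobj F x)"
    and fmap_hom: "\<lbrakk>x \<in> Obj C; y \<in> Obj C; f \<in> Hom C x y\<rbrakk>
      \<Longrightarrow> fmap F x y f \<in> module_hom R (fobj F x) (fobj F y)"
    and fmap_Ident: "\<lbrakk>x \<in> Obj C; a \<in> carrier (fobj F x)\<rbrakk> \<Longrightarrow> fmap F x x (Ident C x) a = a"
    and fmap_Comp: "\<lbrakk>x \<in> Obj C; y \<in> Obj C; z \<in> Obj C; f \<in> Hom C x y; g \<in> Hom C y z;
        a \<in> carrier (fobj F x)\<rbrakk>
      \<Longrightarrow> fmap F x z (Comp C x y z g f) a = fmap F y z g (fmap F x y f a)"

definition nat_trans ::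
  "('o, 'm) category \<Rightarrow> ('r, 'x) ring_scheme \<Rightarrow> ('o, 'm, 'r, 'v) mod_functor \<Rightarrow>
    ('o, 'm, 'r, 'w) mod_functor \<Rightarrow> ('o \<Rightarrow> 'v \<Rightarrow> 'w) \<Rightarrow> bool"
  where "nat_trans C R F G \<eta> \<longleftrightarrow>
    (\<forall>x\<in>Obj C. \<eta> x \<in> module_hom R (fobj F x) (fobj G x)) \<and>
    (\<forall>x\<in>Obj C. \<forall>y\<in>Obj C. \<forall>f\<in>Hom C x y. \<forall>a\<in>carrier (fobj F x).
      \<eta> y (fmap F x y f a) = fmap G x y f (\<eta> x a))"

definition nat_epi ::
  "('o, 'm) category \<Rightarrow> ('r, 'x) ring_scheme \<Rightarrow> ('o, 'm, 'r, 'v) mod_functor \<Rightarrow>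
    ('o, 'm, 'r, 'w) mod_functor \<Rightarrow> ('o \<Rightarrow> 'v \<Rightarrow> 'w) \<Rightarrow> bool"
  where "nat_epi C R F G \<eta> \<longleftrightarrow>
    nat_trans C R F G \<eta> \<and> (\<forall>x\<in>Obj C. \<eta> x ` carrier (fobj F x) = carrier (fobj G x))"

section \<open>Colimits\<close>

text \<open>
  The colimit of \<open>F\<close> is the direct sum of all \<open>F(x)\<close> modulo the identifications
  of \<open>a \<in> F(x)\<close> with \<open>F(f)(a) \<in> F(y)\<close> for all \<open>f : x \<rightarrow> y\<close>.
\<close>

definition colim_relations ::
  "('o, 'm) category \<Rightarrow> ('r, 'x) ring_scheme \<Rightarrow> ('o, 'm, 'r, 'v) mod_functor \<Rightarrow> ('o \<Rightarrow> 'v) set"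
  where "colim_relations C R F =
    (let D = direct_sum (Obj C) (fobj F); \<iota> = direct_sum_incl (Obj C) (fobj F) in
     module_span R D
       {\<iota> y (fmap F x y f a) \<ominus>\<^bsub>D\<^esub> \<iota> x a | x y f a.
         x \<in> Obj C \<and> y \<in> Obj C \<and> f \<in> Hom C x y \<and> a \<in> carrier (fobj F x)})"

definition colim ::
  "('o, 'm) category \<Rightarrow> ('r, 'x) ring_scheme \<Rightarrow> ('o, 'm, 'r, 'v) mod_functor \<Rightarrow>
    ('r, ('o \<Rightarrow> 'v) set) module"
  where "colim C R F = quotient_module (direct_sum (Obj C) (fobj F)) (colim_relations C R F)"

definition colim_map ::
  "('o, 'm) category \<Rightarrow> ('r, 'x) ring_scheme \<Rightarrow> ('o, 'm, 'r, 'w) mod_functor \<Rightarrow>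
    ('o \<Rightarrow> 'v \<Rightarrow> 'w) \<Rightarrow> ('o \<Rightarrow> 'v) set \<Rightarrow> ('o \<Rightarrow> 'w) set"
  where "colim_map C R G \<eta> =
    induced_map (direct_sum (Obj C) (fobj G)) (colim_relations C R G) (\<lambda>g. \<lambda>x\<in>Obj C. \<eta> x (g x))"

section \<open>Homology of a chain complex\<close>

text \<open>A complex \<open>X 0 \<leftarrow> X 1 \<leftarrow> \<dots>\<close> has the differentials \<open>d n : X (Suc n) \<rightarrow> X n\<close>.\<close>

definition cycles :: "(nat \<Rightarrow> ('r, 'a) module) \<Rightarrow> (nat \<Rightarrow> 'a \<Rightarrow> 'a) \<Rightarrow> nat \<Rightarrow> 'a set"
  where "cycles X d n =
    (case n of 0 \<Rightarrow> carrier (X 0) | Suc m \<Rightarrow> a_kernel (X (Suc m)) (X m) (d m))"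

definition boundaries :: "(nat \<Rightarrow> ('r, 'a) module) \<Rightarrow> (nat \<Rightarrow> 'a \<Rightarrow> 'a) \<Rightarrow> nat \<Rightarrow> 'a set"
  where "boundaries X d n = d n ` carrier (X (Suc n))"

definition homology ::
  "(nat \<Rightarrow> ('r, 'a) module) \<Rightarrow> (nat \<Rightarrow> 'a \<Rightarrow> 'a) \<Rightarrow> nat \<Rightarrow> ('r, 'a set) module"
  where "homology X d n =
    quotient_module (X n\<lparr>carrier := cycles X d n\<rparr>) (boundaries X d n)"

section \<open>Left derived functors of the colimit\<close>

text \<open>
  A projective functor has the lifting property against all epimorphisms of functors.
  HOL cannot quantify over types inside a definition, so \<open>N\<close> and \<open>M\<close> take their values in the
  same type \<open>'v\<close> as \<open>P\<close>.  This is the usual notion as soon as \<open>'v\<close> is large enough to contain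
  a copy of the free functor on every functor with values in \<open>'v\<close>; the type
  \<open>universe\<close> below is.
\<close>

definition projective ::
  "('o, 'm) category \<Rightarrow> ('r, 'x) ring_scheme \<Rightarrow> ('o, 'm, 'r, 'v) mod_functor \<Rightarrow> bool"
  where "projective C R P \<longleftrightarrow> module_functor C R P \<and>
    (\<forall>(N :: ('o, 'm, 'r, 'v) mod_functor) (M :: ('o, 'm, 'r, 'v) mod_functor) \<sigma> \<phi>.
      module_functor C R N \<and> module_functor C R M \<and> nat_epi C R N M \<sigma> \<and> nat_trans C R P M \<phi> \<longrightarrow>
      (\<exists>\<psi>. nat_trans C R P N \<psi> \<and> (\<forall>x\<in>Obj C. \<forall>a\<in>carrier (fobj P x). \<sigma> x (\<psi> x a) = \<phi> x a)))"

text \<open>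
  A type that contains the values of a functor (via \<open>Val\<close>) and, for every set \<open>X\<close> of its own
  elements, all finite formal linear combinations of triples \<open>(c, v, f)\<close> with \<open>c\<close> an object,
  \<open>v \<in> X\<close> and \<open>f\<close> a morphism.
\<close>

datatype ('o, 'm, 'r, 'v) universe =
  Val 'v
| Comb "(('o \<times> ('o, 'm, 'r, 'v) universe \<times> 'm) \<times> 'r) list"

type_synonym ('o, 'm, 'r, 'v) universe_functor =
  "('o, 'm, 'r, ('o, 'm, 'r, 'v) universe) mod_functor"

definition projective_resolution ::
  "('o, 'm) category \<Rightarrow> ('r, 'x) ring_scheme \<Rightarrow> ('o, 'm, 'r, 'v) mod_functor \<Rightarrow>
    (nat \<Rightarrow> ('o, 'm, 'r, 'v) universe_functor) \<Rightarrow>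
    (nat \<Rightarrow> 'o \<Rightarrow> ('o, 'm, 'r, 'v) universe \<Rightarrow> ('o, 'm, 'r, 'v) universe) \<Rightarrow>
    ('o \<Rightarrow> ('o, 'm, 'r, 'v) universe \<Rightarrow> 'v) \<Rightarrow> bool"
  where "projective_resolution C R F P d \<epsilon> \<longleftrightarrow>
    (\<forall>n. projective C R (P n)) \<and>
    (\<forall>n. nat_trans C R (P (Suc n)) (P n) (d n)) \<and>
    nat_epi C R (P 0) F \<epsilon> \<and>
    (\<forall>x\<in>Obj C. a_kernel (fobj (P 0) x) (fobj F x) (\<epsilon> x) = d 0 x ` carrier (fobj (P 1) x)) \<and>
    (\<forall>n. \<forall>x\<in>Obj C. a_kernel (fobj (P (Suc n)) x) (fobj (P n) x) (d n x)
      = d (Suc n) x ` carrier (fobj (P (Suc (Suc n))) x))"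

text \<open>
  \<open>H\<^sub>n(C, F)\<close>: apply the colimit to a projective resolution of \<open>F\<close> and take homology.  The
  resolution exists by \<open>projective_resolution_exists\<close> below.
\<close>

definition functor_homology ::
  "('o, 'm) category \<Rightarrow> ('r, 'x) ring_scheme \<Rightarrow> ('o, 'm, 'r, 'v) mod_functor \<Rightarrow> nat \<Rightarrow>
    ('r, ('o \<Rightarrow> ('o, 'm, 'r, 'v) universe) set set) module"
  where "functor_homology C R F n =
    (let (P, d) = (SOME (P, d). \<exists>\<epsilon>. projective_resolution C R F P d \<epsilon>) in
     homology (\<lambda>i. colim C R (P i)) (\<lambda>i. colim_map C R (P i) (d i)) n)"

section \<open>The categories \<open>\<Delta>S\<close> and \<open>\<Delta>S\<^sub>+\<close>\<close>

text \<open>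
  The object \<open>[n]\<close> is the number \<open>n\<close>.  A morphism \<open>[n] \<rightarrow> [m]\<close> is a pair \<open>(f, L)\<close> of a map \<open>f\<close> and a
  family of lists \<open>L\<close>, where \<open>L j\<close> enumerates the fibre of \<open>f\<close> over \<open>j\<close> in its total order.
  Outside \<open>[n]\<close> and \<open>[m]\<close>, \<open>f\<close> and \<open>L\<close> have fixed default values.
\<close>

definition DeltaS_Hom :: "nat \<Rightarrow> nat \<Rightarrow> ((nat \<Rightarrow> nat) \<times> (nat \<Rightarrow> nat list)) set"
  where "DeltaS_Hom n m =
    {(f, L). f \<in> {0..n} \<rightarrow>\<^sub>E {0..m} \<and>
      (\<forall>j\<in>{0..m}. distinct (L j) \<and> set (L j) = {i \<in> {0..n}. f i = j}) \<and>
      (\<forall>j. j \<notin> {0..m} \<longrightarrow> L j = [])}"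

definition DeltaS :: "(nat, (nat \<Rightarrow> nat) \<times> (nat \<Rightarrow> nat list)) category"
  where "DeltaS =
    \<lparr>Obj = UNIV, Hom = DeltaS_Hom,
     Ident = (\<lambda>n. (\<lambda>i\<in>{0..n}. i, \<lambda>j. if j \<in> {0..n} then [j] else [])),
     Comp = (\<lambda>n m l (g, K) (f, L). (\<lambda>i\<in>{0..n}. g (f i), \<lambda>i. concat (map L (K i))))\<rparr>"

text \<open>
  The object \<open>[-1]\<close> is \<open>None\<close> and \<open>[n]\<close> is \<open>Some n\<close>; each \<open>\<iota>\<^sub>n\<close> is \<open>None\<close> and a morphism \<open>\<alpha>\<close> of \<open>\<Delta>S\<close>
  is \<open>Some \<alpha>\<close>.
\<close>

definition DeltaS_plus ::
  "(nat option, ((nat \<Rightarrow> nat) \<times> (nat \<Rightarrow> nat list)) option) category"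
  where "DeltaS_plus =
    \<lparr>Obj = UNIV,
     Hom = (\<lambda>x y. case x of
         None \<Rightarrow> {None}
       | Some n \<Rightarrow> (case y of None \<Rightarrow> {} | Some m \<Rightarrow> Some ` Hom DeltaS n m)),
     Ident = map_option (Ident DeltaS),
     Comp = (\<lambda>x y z \<beta> \<alpha>. case (\<alpha>, \<beta>) of
         (Some \<alpha>', Some \<beta>') \<Rightarrow> Some (Comp DeltaS (the x) (the y) (the z) \<beta>' \<alpha>')
       | _ \<Rightarrow> None)\<rparr>"

section \<open>Algebras and tensor powers\<close>

text \<open>The locale \<open>algebra\<close> of \<^theory>\<open>HOL-Algebra.Module\<close> requires commutativity.\<close>

locale assoc_algebra = module R A + A?: ring A
  for R :: "('r, 'x) ring_scheme" (structure) and A :: "('r, 'a) module" (structure) +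
  assumes smult_mult_left: "\<lbrakk>r \<in> carrier R; a \<in> carrier A; b \<in> carrier A\<rbrakk>
      \<Longrightarrow> (r \<odot>\<^bsub>A\<^esub> a) \<otimes>\<^bsub>A\<^esub> b = r \<odot>\<^bsub>A\<^esub> (a \<otimes>\<^bsub>A\<^esub> b)"
    and smult_mult_right: "\<lbrakk>r \<in> carrier R; a \<in> carrier A; b \<in> carrier A\<rbrakk>
      \<Longrightarrow> a \<otimes>\<^bsub>A\<^esub> (r \<odot>\<^bsub>A\<^esub> b) = r \<odot>\<^bsub>A\<^esub> (a \<otimes>\<^bsub>A\<^esub> b)"

text \<open>
  The \<open>n\<close>-th tensor power is the free module on the words \<open>[a\<^sub>1, \<dots>, a\<^sub>n]\<close> in \<open>A\<close> modulo the
  multilinearity relations in each position \<open>i\<close>.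
\<close>

definition words :: "('r, 'a) module \<Rightarrow> nat \<Rightarrow> 'a list set"
  where "words A n = {as. length as = n \<and> set as \<subseteq> carrier A}"

definition tensor_relations ::
  "('r, 'x) ring_scheme \<Rightarrow> ('r, 'a) module \<Rightarrow> nat \<Rightarrow> ('a list \<Rightarrow> 'r) set"
  where "tensor_relations R A n =
    (let W = free_module R (words A n); \<delta> = free_gen R in
     module_span R W
      ({\<delta> (as[i := a \<oplus>\<^bsub>A\<^esub> b]) \<ominus>\<^bsub>W\<^esub> (\<delta> (as[i := a]) \<oplus>\<^bsub>W\<^esub> \<delta> (as[i := b])) | as i a b.
          as \<in> words A n \<and> i < n \<and> a \<in> carrier A \<and> b \<in> carrier A} \<union>
       {\<delta> (as[i := r \<odot>\<^bsub>A\<^esub> a]) \<ominus>\<^bsub>W\<^esub> (r \<odot>\<^bsub>W\<^esub> \<delta> (as[i := a])) | as i r a.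
          as \<in> words A n \<and> i < n \<and> r \<in> carrier R \<and> a \<in> carrier A}))"

definition tensor_power ::
  "('r, 'x) ring_scheme \<Rightarrow> ('r, 'a) module \<Rightarrow> nat \<Rightarrow> ('r, ('a list \<Rightarrow> 'r) set) module"
  where "tensor_power R A n =
    quotient_module (free_module R (words A n)) (tensor_relations R A n)"

definition pure_tensor ::
  "('r, 'x) ring_scheme \<Rightarrow> ('r, 'a) module \<Rightarrow> 'a list \<Rightarrow> ('a list \<Rightarrow> 'r) set"
  where "pure_tensor R A as =
    tensor_relations R A (length as) +>\<^bsub>free_module R (words A (length as))\<^esub> free_gen R as"

section \<open>The symmetric bar construction\<close>

definition fibre_products ::
  "('r, 'a) module \<Rightarrow> nat \<Rightarrow> (nat \<Rightarrow> nat list) \<Rightarrow> 'a list \<Rightarrow> 'a list"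
  where "fibre_products A m L as =
    map (\<lambda>j. foldr (\<lambda>a b. a \<otimes>\<^bsub>A\<^esub> b) (map (\<lambda>i. as ! i) (L j)) \<one>\<^bsub>A\<^esub>) [0..<Suc m]"

definition Bsym ::
  "('r, 'x) ring_scheme \<Rightarrow> ('r, 'a) module \<Rightarrow>
    (nat, (nat \<Rightarrow> nat) \<times> (nat \<Rightarrow> nat list), 'r, ('a list \<Rightarrow> 'r) set) mod_functor"
  where "Bsym R A =
    \<lparr>fobj = (\<lambda>n. tensor_power R A (Suc n)),
     fmap = (\<lambda>n m (f, L).
       induced_map (free_module R (words A (Suc m))) (tensor_relations R A (Suc m))
         (lin_ext R (free_module R (words A (Suc m)))
           (\<lambda>as. free_gen R (fibre_products A m L as))))\<rparr>"

text \<open>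
  The values of the extended functor live in a sum type: \<open>k\<close> on the left, the tensor powers on
  the right.
\<close>

definition Bsym_plus ::
  "('r, 'x) ring_scheme \<Rightarrow> ('r, 'a) module \<Rightarrow>
    (nat option, ((nat \<Rightarrow> nat) \<times> (nat \<Rightarrow> nat list)) option, 'r,
      'r + ('a list \<Rightarrow> 'r) set) mod_functor"
  where "Bsym_plus R A =
    \<lparr>fobj = (\<lambda>x. case x of
         None \<Rightarrow> transport_module Inl (regular_module R)
       | Some n \<Rightarrow> transport_module Inr (fobj (Bsym R A) n)),
     fmap = (\<lambda>x y \<alpha>. case (x, y, \<alpha>) of
         (None, Some n, None) \<Rightarrow>
           (\<lambda>v. Inr (projl v \<odot>\<^bsub>tensor_power R A (Suc n)\<^esub>
                      pure_tensor R A (replicate (Suc n) \<one>\<^bsub>A\<^esub>)))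
       | (Some n, Some m, Some \<alpha>') \<Rightarrow> (\<lambda>v. Inr (fmap (Bsym R A) n m \<alpha>' (projr v)))
       | _ \<Rightarrow> id)\<rparr>"

definition HS ::
  "('r, 'x) ring_scheme \<Rightarrow> ('r, 'a) module \<Rightarrow> nat \<Rightarrow>
    ('r, (nat \<Rightarrow> (nat, (nat \<Rightarrow> nat) \<times> (nat \<Rightarrow> nat list), 'r,
      ('a list \<Rightarrow> 'r) set) universe) set set) module"
  where "HS R A n = functor_homology DeltaS R (Bsym R A) n"

section \<open>Projective resolutions exist\<close>

lemma free_module_simps [simp]:
  "\<zero>\<^bsub>free_module R S\<^esub> = (\<lambda>s. \<zero>\<^bsub>R\<^esub>)"
  "g \<oplus>\<^bsub>free_module R S\<^esub> h = (\<lambda>s. g s \<oplus>\<^bsub>R\<^esub> h s)"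
  "r \<odot>\<^bsub>free_module R S\<^esub> g = (\<lambda>s. r \<otimes>\<^bsub>R\<^esub> g s)"
  by (simp_all add: free_module_def)

lemma free_module_module:
  assumes "cring R"
  shows "module R (free_module R S)"
proof -
  interpret cring R by fact
  let ?W = "free_module R S"
  have ag: "abelian_group ?W"
  proof (rule abelian_groupI, goal_cases)
    case (1 x y)
    have "{s. x s \<oplus>\<^bsub>R\<^esub> y s \<noteq> \<zero>\<^bsub>R\<^esub>} \<subseteq> {s. x s \<noteq> \<zero>\<^bsub>R\<^esub>} \<union> {s. y s \<noteq> \<zero>\<^bsub>R\<^esub>}"
      by auto
    with 1 show ?case
      unfolding free_module_def by (auto intro: finite_subset)
  next
    case (6 x)
    have eq: "{s. \<ominus>\<^bsub>R\<^esub> x s \<noteq> \<zero>\<^bsub>R\<^esub>} = {s. x s \<noteq> \<zero>\<^bsub>R\<^esub>}"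
      using 6 by (auto simp: free_module_def)
    show ?case
    proof (rule bexI[of _ "\<lambda>s. \<ominus>\<^bsub>R\<^esub> x s"])
      show "(\<lambda>s. \<ominus>\<^bsub>R\<^esub> x s) \<in> carrier ?W"
        using 6 unfolding free_module_def by (simp add: eq)
    qed (use 6 in \<open>auto simp: free_module_def l_neg\<close>)
  qed (auto simp: free_module_def a_ac)
  show ?thesis
  proof (rule moduleI[OF assms ag], goal_cases)
    case (1 a x)
    have "{s. a \<otimes>\<^bsub>R\<^esub> x s \<noteq> \<zero>\<^bsub>R\<^esub>} \<subseteq> {s. x s \<noteq> \<zero>\<^bsub>R\<^esub>}" using 1 by auto
    with 1 show ?case
      unfolding free_module_def by (auto intro: finite_subset)
  qed (auto simp: free_module_def l_distr r_distr m_assoc)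
qed

lemma free_module_carrier:
  "g \<in> carrier (free_module R S) \<longleftrightarrow>
    (\<forall>s. g s \<in> carrier R) \<and> finite {s. g s \<noteq> \<zero>\<^bsub>R\<^esub>} \<and> {s. g s \<noteq> \<zero>\<^bsub>R\<^esub>} \<subseteq> S"
  by (simp add: free_module_def)

lemma free_gen_carrier:
  assumes "cring R" "s \<in> S"
  shows "free_gen R s \<in> carrier (free_module R S)"
proof -
  interpret cring R by fact
  show ?thesis using assms(2)
    by (auto simp: free_module_carrier free_gen_def intro: finite_subset[of _ "{s}"])
qed

lemma module_homD:
  assumes "h \<in> module_hom R M N"
  shows "x \<in> carrier M \<Longrightarrow> h x \<in> carrier N"
    "\<lbrakk>x \<in> carrier M; y \<in> carrier M\<rbrakk> \<Longrightarrow> h (x \<oplus>\<^bsub>M\<^esub> y) = h x \<oplus>\<^bsub>N\<^esub> h y"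
    "\<lbrakk>r \<in> carrier R; x \<in> carrier M\<rbrakk> \<Longrightarrow> h (r \<odot>\<^bsub>M\<^esub> x) = r \<odot>\<^bsub>N\<^esub> h x"
  using assms by (auto simp: module_hom_def)

lemma module_homI:
  assumes "\<And>x. x \<in> carrier M \<Longrightarrow> h x \<in> carrier N"
    "\<And>x y. \<lbrakk>x \<in> carrier M; y \<in> carrier M\<rbrakk> \<Longrightarrow> h (x \<oplus>\<^bsub>M\<^esub> y) = h x \<oplus>\<^bsub>N\<^esub> h y"
    "\<And>r x. \<lbrakk>r \<in> carrier R; x \<in> carrier M\<rbrakk> \<Longrightarrow> h (r \<odot>\<^bsub>M\<^esub> x) = r \<odot>\<^bsub>N\<^esub> h x"
  shows "h \<in> module_hom R M N"
  using assms by (auto simp: module_hom_def)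

lemma module_hom_zero:
  assumes "module R M" "module R N" "h \<in> module_hom R M N"
  shows "h \<zero>\<^bsub>M\<^esub> = \<zero>\<^bsub>N\<^esub>"
proof -
  interpret M: module R M by fact
  interpret N: module R N by fact
  have "h (\<zero>\<^bsub>R\<^esub> \<odot>\<^bsub>M\<^esub> \<zero>\<^bsub>M\<^esub>) = \<zero>\<^bsub>R\<^esub> \<odot>\<^bsub>N\<^esub> h \<zero>\<^bsub>M\<^esub>"
    by (rule module_homD(3)[OF assms(3)]) auto
  then show ?thesis using module_homD(1)[OF assms(3) M.M.zero_closed] by simp
qed

lemma module_hom_comp:
  assumes "h \<in> module_hom R M N" "g \<in> module_hom R N K"
  shows "(\<lambda>x. g (h x)) \<in> module_hom R M K"
  using assms by (auto simp: module_hom_def Pi_iff)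

lemma lin_ext_superset:
  assumes "module R M" and g: "g \<in> carrier (free_module R S)" and h: "h \<in> S \<rightarrow> carrier M"
    and T: "finite T" "{s. g s \<noteq> \<zero>\<^bsub>R\<^esub>} \<subseteq> T" "T \<subseteq> S"
  shows "lin_ext R M h g = (\<Oplus>\<^bsub>M\<^esub>s\<in>T. g s \<odot>\<^bsub>M\<^esub> h s)"
proof -
  interpret module R M by fact
  have hT: "\<And>s. s \<in> T \<Longrightarrow> h s \<in> carrier M" using h T by blast
  have "(\<Oplus>\<^bsub>M\<^esub>s\<in>{s. g s \<noteq> \<zero>\<^bsub>R\<^esub>}. g s \<odot>\<^bsub>M\<^esub> h s) = (\<Oplus>\<^bsub>M\<^esub>s\<in>T. g s \<odot>\<^bsub>M\<^esub> h s)"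
    using T g hT
    by (intro M.add.finprod_mono_neutral_cong_left) (auto simp: free_module_carrier)
  then show ?thesis by (simp add: lin_ext_def)
qed

lemma lin_ext_closed:
  assumes "module R M" "g \<in> carrier (free_module R S)" "h \<in> S \<rightarrow> carrier M"
  shows "lin_ext R M h g \<in> carrier M"
proof -
  interpret module R M by fact
  show ?thesis using assms
    by (auto simp: lin_ext_def free_module_carrier intro!: M.finsum_closed)
qed

lemma lin_ext_hom:
  assumes M: "module R M" and h: "h \<in> S \<rightarrow> carrier M"
  shows "lin_ext R M h \<in> module_hom R (free_module R S) M"
proof -
  interpret module R M by fact
  interpret W: module R "free_module R S" by (rule free_module_module) (rule R.is_cring)
  show ?thesis
  proof (rule module_homI)
    fix x assume "x \<in> carrier (free_module R S)"
    then show "lin_ext R M h x \<in> carrier M" using lin_ext_closed[OF M _ h] by blast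
  next
    fix x y assume x: "x \<in> carrier (free_module R S)" and y: "y \<in> carrier (free_module R S)"
    have xy: "x \<oplus>\<^bsub>free_module R S\<^esub> y \<in> carrier (free_module R S)" using x y by blast
    let ?T = "{s. x s \<noteq> \<zero>\<^bsub>R\<^esub>} \<union> {s. y s \<noteq> \<zero>\<^bsub>R\<^esub>}"
    have T: "finite ?T" "?T \<subseteq> S" using x y by (auto simp: free_module_carrier)
    have c: "\<And>s. x s \<in> carrier R" "\<And>s. y s \<in> carrier R"
      using x y by (auto simp: free_module_carrier)
    have hs: "\<And>s. s \<in> ?T \<Longrightarrow> h s \<in> carrier M" using T h by blast
    have "lin_ext R M h (x \<oplus>\<^bsub>free_module R S\<^esub> y)
        = (\<Oplus>\<^bsub>M\<^esub>s\<in>?T. (x s \<oplus>\<^bsub>R\<^esub> y s) \<odot>\<^bsub>M\<^esub> h s)"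
      using c by (subst lin_ext_superset[OF M xy h T(1) _ T(2)]) auto
    also have "\<dots> = (\<Oplus>\<^bsub>M\<^esub>s\<in>?T. x s \<odot>\<^bsub>M\<^esub> h s \<oplus>\<^bsub>M\<^esub> y s \<odot>\<^bsub>M\<^esub> h s)"
      using c hs by (intro M.finsum_cong') (auto simp: smult_l_distr)
    also have "\<dots> = (\<Oplus>\<^bsub>M\<^esub>s\<in>?T. x s \<odot>\<^bsub>M\<^esub> h s) \<oplus>\<^bsub>M\<^esub> (\<Oplus>\<^bsub>M\<^esub>s\<in>?T. y s \<odot>\<^bsub>M\<^esub> h s)"
      using c hs by (intro M.finsum_addf) auto
    also have "\<dots> = lin_ext R M h x \<oplus>\<^bsub>M\<^esub> lin_ext R M h y"
      using lin_ext_superset[OF M x h T(1) _ T(2)] lin_ext_superset[OF M y h T(1) _ T(2)] by simp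
    finally show "lin_ext R M h (x \<oplus>\<^bsub>free_module R S\<^esub> y) = lin_ext R M h x \<oplus>\<^bsub>M\<^esub> lin_ext R M h y" .
  next
    fix r x assume r: "r \<in> carrier R" and x: "x \<in> carrier (free_module R S)"
    have rx: "r \<odot>\<^bsub>free_module R S\<^esub> x \<in> carrier (free_module R S)" using r x by blast
    let ?T = "{s. x s \<noteq> \<zero>\<^bsub>R\<^esub>}"
    have T: "finite ?T" "?T \<subseteq> S" using x by (auto simp: free_module_carrier)
    have c: "\<And>s. x s \<in> carrier R" using x by (auto simp: free_module_carrier)
    have hs: "\<And>s. s \<in> ?T \<Longrightarrow> h s \<in> carrier M" using T h by blast
    have "lin_ext R M h (r \<odot>\<^bsub>free_module R S\<^esub> x) = (\<Oplus>\<^bsub>M\<^esub>s\<in>?T. (r \<otimes>\<^bsub>R\<^esub> x s) \<odot>\<^bsub>M\<^esub> h s)"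
      using r by (subst lin_ext_superset[OF M rx h T(1) _ T(2)]) auto
    also have "\<dots> = (\<Oplus>\<^bsub>M\<^esub>s\<in>?T. r \<odot>\<^bsub>M\<^esub> (x s \<odot>\<^bsub>M\<^esub> h s))"
      using r c hs by (intro M.finsum_cong') (auto simp: smult_assoc1)
    also have "\<dots> = r \<odot>\<^bsub>M\<^esub> (\<Oplus>\<^bsub>M\<^esub>s\<in>?T. x s \<odot>\<^bsub>M\<^esub> h s)"
      using r c hs T by (subst finsum_smult_ldistr) auto
    finally show "lin_ext R M h (r \<odot>\<^bsub>free_module R S\<^esub> x) = r \<odot>\<^bsub>M\<^esub> lin_ext R M h x"
      by (simp add: lin_ext_def)
  qed
qed

lemma lin_ext_gen:
  assumes M: "module R M" and h: "h \<in> S \<rightarrow> carrier M" and s: "s \<in> S"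
  shows "lin_ext R M h (free_gen R s) = h s"
proof -
  interpret module R M by fact
  have hs: "h s \<in> carrier M" using h s by blast
  have "lin_ext R M h (free_gen R s) = (\<Oplus>\<^bsub>M\<^esub>t\<in>{s}. free_gen R s t \<odot>\<^bsub>M\<^esub> h t)"
    using s by (intro lin_ext_superset[OF M free_gen_carrier[OF R.is_cring s] h]) (auto simp: free_gen_def)
  also have "\<dots> = h s" using hs by (simp add: free_gen_def)
  finally show ?thesis .
qed

lemma module_hom_finsum:
  assumes "module R M" "module R N" "\<phi> \<in> module_hom R M N" "finite T" "f \<in> T \<rightarrow> carrier M"
  shows "\<phi> (\<Oplus>\<^bsub>M\<^esub>t\<in>T. f t) = (\<Oplus>\<^bsub>N\<^esub>t\<in>T. \<phi> (f t))"
proof -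
  interpret M: module R M by fact
  interpret N: module R N by fact
  note hom = module_homD[OF assms(3)]
  show ?thesis using assms(4,5)
  proof (induction T rule: finite_induct)
    case empty
    then show ?case using module_hom_zero[OF assms(1-3)] by simp
  next
    case (insert t T)
    have "(\<lambda>t. \<phi> (f t)) \<in> T \<rightarrow> carrier N" "\<phi> (f t) \<in> carrier N"
      using insert.prems hom(1) by auto
    then show ?case using insert hom by auto
  qed
qed

lemma free_module_finsum_apply:
  assumes "cring R" "finite T" "f \<in> T \<rightarrow> carrier (free_module R S)"
  shows "(\<Oplus>\<^bsub>free_module R S\<^esub>t\<in>T. f t) s = (\<Oplus>\<^bsub>R\<^esub>t\<in>T. f t s)"
proof -
  interpret cring R by fact
  interpret W: module R "free_module R S" by (rule free_module_module) fact
  show ?thesis using assms(2,3)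
  proof (induction T rule: finite_induct)
    case (insert t T)
    have "(\<lambda>t. f t s) \<in> T \<rightarrow> carrier R" "f t s \<in> carrier R"
      using insert.prems by (auto simp: free_module_carrier Pi_iff)
    then show ?case using insert by simp
  qed simp
qed

lemma free_module_expand:
  assumes R: "cring R" and g: "g \<in> carrier (free_module R S)"
  shows "lin_ext R (free_module R S) (free_gen R) g = g"
proof
  fix s
  interpret cring R by fact
  interpret W: module R "free_module R S" by (rule free_module_module) fact
  let ?T = "{s. g s \<noteq> \<zero>\<^bsub>R\<^esub>}"
  have fin: "finite ?T" "?T \<subseteq> S" and c: "\<And>s. g s \<in> carrier R"
    using g by (auto simp: free_module_carrier)
  have "lin_ext R (free_module R S) (free_gen R) g s
      = (\<Oplus>\<^bsub>R\<^esub>t\<in>?T. (g t \<odot>\<^bsub>free_module R S\<^esub> free_gen R t) s)"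
    unfolding lin_ext_def
  proof (rule free_module_finsum_apply[OF R fin(1)], rule Pi_I)
    fix t assume "t \<in> ?T"
    then show "g t \<odot>\<^bsub>free_module R S\<^esub> free_gen R t \<in> carrier (free_module R S)"
      using fin c by (intro W.smult_closed free_gen_carrier[OF R]) auto
  qed
  also have "\<dots> = (\<Oplus>\<^bsub>R\<^esub>t\<in>?T. if s = t then g t else \<zero>\<^bsub>R\<^esub>)"
    using c by (intro finsum_cong') (auto simp: free_gen_def)
  also have "\<dots> = g s"
  proof (cases "s \<in> ?T")
    case True
    then show ?thesis using add.finprod_singleton[OF True fin(1), of g] c by simp
  next
    case False
    then have "(\<Oplus>\<^bsub>R\<^esub>t\<in>?T. if s = t then g t else \<zero>\<^bsub>R\<^esub>) = (\<Oplus>\<^bsub>R\<^esub>t\<in>?T. \<zero>\<^bsub>R\<^esub>)"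
      by (intro finsum_cong') auto
    with False show ?thesis by simp
  qed
  finally show "lin_ext R (free_module R S) (free_gen R) g s = g s" .
qed

lemma module_hom_free_eq_lin_ext:
  assumes M: "module R M" and \<phi>: "\<phi> \<in> module_hom R (free_module R S) M"
    and g: "g \<in> carrier (free_module R S)"
  shows "\<phi> g = lin_ext R M (\<lambda>s. \<phi> (free_gen R s)) g"
proof -
  interpret module R M by fact
  interpret W: module R "free_module R S" by (rule free_module_module) (rule R.is_cring)
  let ?T = "{s. g s \<noteq> \<zero>\<^bsub>R\<^esub>}"
  have fin: "finite ?T" "?T \<subseteq> S" and c: "\<And>s. g s \<in> carrier R"
    using g by (auto simp: free_module_carrier)
  have gen: "\<And>s. s \<in> ?T \<Longrightarrow> free_gen R s \<in> carrier (free_module R S)"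
    by (rule free_gen_carrier[OF R.is_cring]) (use fin in \<open>auto\<close>)
  have "\<phi> g = \<phi> (lin_ext R (free_module R S) (free_gen R) g)"
    by (simp add: free_module_expand[OF R.is_cring g])
  also have "\<dots> = (\<Oplus>\<^bsub>M\<^esub>s\<in>?T. \<phi> (g s \<odot>\<^bsub>free_module R S\<^esub> free_gen R s))"
    unfolding lin_ext_def
    by (intro module_hom_finsum[OF W.module_axioms M \<phi> fin(1)] Pi_I W.smult_closed c gen)
  also have "\<dots> = (\<Oplus>\<^bsub>M\<^esub>s\<in>?T. g s \<odot>\<^bsub>M\<^esub> \<phi> (free_gen R s))"
  proof (rule M.finsum_cong')
    show "(\<lambda>s. g s \<odot>\<^bsub>M\<^esub> \<phi> (free_gen R s)) \<in> ?T \<rightarrow> carrier M"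
      by (intro Pi_I smult_closed c module_homD(1)[OF \<phi>] gen)
    show "\<phi> (g s \<odot>\<^bsub>free_module R S\<^esub> free_gen R s) = g s \<odot>\<^bsub>M\<^esub> \<phi> (free_gen R s)" if "s \<in> ?T" for s
      by (rule module_homD(3)[OF \<phi> c gen[OF that]])
  qed simp
  finally show ?thesis by (simp add: lin_ext_def)
qed

lemma module_hom_free_eqI:
  assumes M: "module R M" and \<phi>: "\<phi> \<in> module_hom R (free_module R S) M"
    and \<psi>: "\<psi> \<in> module_hom R (free_module R S) M"
    and eq: "\<And>s. s \<in> S \<Longrightarrow> \<phi> (free_gen R s) = \<psi> (free_gen R s)"
    and g: "g \<in> carrier (free_module R S)"
  shows "\<phi> g = \<psi> g"
proof -
  interpret module R M by fact
  have "lin_ext R M (\<lambda>s. \<phi> (free_gen R s)) g = lin_ext R M (\<lambda>s. \<psi> (free_gen R s)) g"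
    unfolding lin_ext_def
  proof (rule M.finsum_cong')
    show "(\<lambda>s. g s \<odot>\<^bsub>M\<^esub> \<psi> (free_gen R s)) \<in> {s. g s \<noteq> \<zero>\<^bsub>R\<^esub>} \<rightarrow> carrier M"
      using g module_homD(1)[OF \<psi>] free_gen_carrier[OF R.is_cring, of _ S]
      by (auto simp: free_module_carrier)
  qed (use g eq in \<open>auto simp: free_module_carrier\<close>)
  then show ?thesis
    using module_hom_free_eq_lin_ext[OF M \<phi> g] module_hom_free_eq_lin_ext[OF M \<psi> g] by simp
qed


lemma nat_transI:
  assumes "\<And>x. x \<in> Obj C \<Longrightarrow> \<eta> x \<in> module_hom R (fobj F x) (fobj G x)"
    "\<And>x y f a. \<lbrakk>x \<in> Obj C; y \<in> Obj C; f \<in> Hom C x y; a \<in> carrier (fobj F x)\<rbrakk>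
      \<Longrightarrow> \<eta> y (fmap F x y f a) = fmap G x y f (\<eta> x a)"
  shows "nat_trans C R F G \<eta>"
  using assms by (auto simp: nat_trans_def)

lemma nat_transD:
  assumes "nat_trans C R F G \<eta>"
  shows "x \<in> Obj C \<Longrightarrow> \<eta> x \<in> module_hom R (fobj F x) (fobj G x)"
    "\<lbrakk>x \<in> Obj C; y \<in> Obj C; f \<in> Hom C x y; a \<in> carrier (fobj F x)\<rbrakk>
      \<Longrightarrow> \<eta> y (fmap F x y f a) = fmap G x y f (\<eta> x a)"
  using assms by (auto simp: nat_trans_def)

lemma nat_trans_comp:
  assumes "nat_trans C R F G \<eta>" "nat_trans C R G H \<theta>"
  shows "nat_trans C R F H (\<lambda>x a. \<theta> x (\<eta> x a))"
proof (rule nat_transI)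
  fix x assume x: "x \<in> Obj C"
  show "(\<lambda>a. \<theta> x (\<eta> x a)) \<in> module_hom R (fobj F x) (fobj H x)"
    by (rule module_hom_comp[OF nat_transD(1)[OF assms(1) x] nat_transD(1)[OF assms(2) x]])
next
  fix x y f a assume xy: "x \<in> Obj C" "y \<in> Obj C" "f \<in> Hom C x y" and a: "a \<in> carrier (fobj F x)"
  have "\<eta> x a \<in> carrier (fobj G x)"
    by (rule module_homD(1)[OF nat_transD(1)[OF assms(1) xy(1)] a])
  then show "\<theta> y (\<eta> y (fmap F x y f a)) = fmap H x y f (\<theta> x (\<eta> x a))"
    using nat_transD(2)[OF assms(1) xy a] nat_transD(2)[OF assms(2) xy] by simp
qed

definition free_functor ::
  "('o, 'm) category \<Rightarrow> ('r, 'x) ring_scheme \<Rightarrow> ('o \<Rightarrow> 'w set) \<Rightarrow>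
    ('o, 'm, 'r, 'o \<times> 'w \<times> 'm \<Rightarrow> 'r) mod_functor"
  where "free_functor C R X =
    (let K = (\<lambda>x. {(c, v, f). c \<in> Obj C \<and> v \<in> X c \<and> f \<in> Hom C c x}) in
    \<lparr>fobj = (\<lambda>x. free_module R (K x)),
     fmap = (\<lambda>x y g. lin_ext R (free_module R (K y))
       (\<lambda>(c, v, f). free_gen R (c, v, Comp C c x y g f)))\<rparr>)"

definition free_nat ::
  "('o, 'm) category \<Rightarrow> ('r, 'x) ring_scheme \<Rightarrow> ('o, 'm, 'r, 'v) mod_functor \<Rightarrow>
    ('o \<Rightarrow> 'w \<Rightarrow> 'v) \<Rightarrow> 'o \<Rightarrow> ('o \<times> 'w \<times> 'm \<Rightarrow> 'r) \<Rightarrow> 'v"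
  where "free_nat C R N n x = lin_ext R (fobj N x) (\<lambda>(c, v, f). fmap N c x f (n c v))"

context
  fixes C :: "('o, 'm) category" and R :: "('r, 'x) ring_scheme" and X :: "'o \<Rightarrow> 'w set"
  assumes C: "small_category C" and R: "cring R"
begin

interpretation C: small_category C by (rule C)

abbreviation (input) "free_keys x \<equiv> {(c, v, f). c \<in> Obj C \<and> v \<in> X c \<and> f \<in> Hom C c x}"

lemma fobj_free_functor: "fobj (free_functor C R X) x = free_module R (free_keys x)"
  by (simp add: free_functor_def Let_def)

lemma fmap_free_functor: "fmap (free_functor C R X) x y g =
    lin_ext R (free_module R (free_keys y)) (\<lambda>(c, v, f). free_gen R (c, v, Comp C c x y g f))"
  by (simp add: free_functor_def Let_def)

lemma free_functor_step:
  assumes "x \<in> Obj C" "y \<in> Obj C" "g \<in> Hom C x y"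
  shows "(\<lambda>(c, v, f). free_gen R (c, v, Comp C c x y g f)) \<in> free_keys x \<rightarrow> carrier (free_module R (free_keys y))"
  using assms by (auto intro!: free_gen_carrier[OF R] C.Comp_Hom)

lemma fmap_free_functor_gen:
  assumes "x \<in> Obj C" "y \<in> Obj C" "g \<in> Hom C x y" "c \<in> Obj C" "v \<in> X c" "f \<in> Hom C c x"
  shows "fmap (free_functor C R X) x y g (free_gen R (c, v, f)) = free_gen R (c, v, Comp C c x y g f)"
  unfolding fmap_free_functor
  using lin_ext_gen[OF free_module_module[OF R] free_functor_step[OF assms(1-3)], of "(c, v, f)"] assms
  by simp

lemma free_functor_functor: "module_functor C R (free_functor C R X)"
proof (rule module_functor.intro)
  fix x assume "x \<in> Obj C"
  show "module R (fobj (free_functor C R X) x)"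
    by (simp add: fobj_free_functor free_module_module[OF R])
next
  fix x y f assume xy: "x \<in> Obj C" "y \<in> Obj C" "f \<in> Hom C x y"
  show "fmap (free_functor C R X) x y f
      \<in> module_hom R (fobj (free_functor C R X) x) (fobj (free_functor C R X) y)"
    unfolding fmap_free_functor fobj_free_functor
    by (rule lin_ext_hom[OF free_module_module[OF R] free_functor_step[OF xy]])
next
  fix x a assume x: "x \<in> Obj C" and a: "a \<in> carrier (fobj (free_functor C R X) x)"
  have "fmap (free_functor C R X) x x (Ident C x) \<in>
      module_hom R (free_module R (free_keys x)) (free_module R (free_keys x))"
    unfolding fmap_free_functor
    by (rule lin_ext_hom[OF free_module_module[OF R] free_functor_step[OF x x C.Ident_Hom[OF x]]])
  then show "fmap (free_functor C R X) x x (Ident C x) a = a"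
  proof (rule module_hom_free_eqI[OF free_module_module[OF R], where S = "free_keys x" and \<psi> = "\<lambda>a. a"])
    show "(\<lambda>a. a) \<in> module_hom R (free_module R (free_keys x)) (free_module R (free_keys x))"
      by (rule module_homI) simp_all
    show "a \<in> carrier (free_module R (free_keys x))" using a by (simp add: fobj_free_functor)
  qed (use x in \<open>auto simp: fmap_free_functor_gen C.Ident_Hom C.Comp_Ident_left\<close>)
next
  fix x y z f g a assume xyz: "x \<in> Obj C" "y \<in> Obj C" "z \<in> Obj C" "f \<in> Hom C x y" "g \<in> Hom C y z"
    and a: "a \<in> carrier (fobj (free_functor C R X) x)"
  have hom: "fmap (free_functor C R X) x y f \<in> module_hom R (free_module R (free_keys x)) (free_module R (free_keys y))"
    if "x \<in> Obj C" "y \<in> Obj C" "f \<in> Hom C x y" for x y f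
    unfolding fmap_free_functor
    by (rule lin_ext_hom[OF free_module_module[OF R] free_functor_step[OF that]])
  show "fmap (free_functor C R X) x z (Comp C x y z g f) a =
      fmap (free_functor C R X) y z g (fmap (free_functor C R X) x y f a)"
  proof (rule module_hom_free_eqI[OF free_module_module[OF R], where S = "free_keys x"
        and \<phi> = "fmap (free_functor C R X) x z (Comp C x y z g f)"
        and \<psi> = "\<lambda>a. fmap (free_functor C R X) y z g (fmap (free_functor C R X) x y f a)"])
    show "fmap (free_functor C R X) x z (Comp C x y z g f)
        \<in> module_hom R (free_module R (free_keys x)) (free_module R (free_keys z))"
      by (rule hom[OF xyz(1,3) C.Comp_Hom[OF xyz]])
    show "(\<lambda>a. fmap (free_functor C R X) y z g (fmap (free_functor C R X) x y f a))
        \<in> module_hom R (free_module R (free_keys x)) (free_module R (free_keys z))"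
      by (rule module_hom_comp[OF hom[OF xyz(1,2,4)] hom[OF xyz(2,3,5)]])
    show "a \<in> carrier (free_module R (free_keys x))" using a by (simp add: fobj_free_functor)
  qed (use xyz in \<open>auto simp: fmap_free_functor_gen C.Comp_Hom C.Comp_assoc\<close>)
qed

context
  fixes N :: "('o, 'm, 'r, 'v) mod_functor"
  assumes N: "module_functor C R N"
begin

interpretation N: module_functor C R N by (rule N)

lemma free_nat_step:
  assumes "\<And>c v. \<lbrakk>c \<in> Obj C; v \<in> X c\<rbrakk> \<Longrightarrow> n c v \<in> carrier (fobj N c)" "x \<in> Obj C"
  shows "(\<lambda>(c, v, f). fmap N c x f (n c v)) \<in> free_keys x \<rightarrow> carrier (fobj N x)"
  using assms by (auto intro!: module_homD(1)[OF N.fmap_hom])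

lemma free_nat_gen:
  assumes "\<And>c v. \<lbrakk>c \<in> Obj C; v \<in> X c\<rbrakk> \<Longrightarrow> n c v \<in> carrier (fobj N c)" "x \<in> Obj C"
    "c \<in> Obj C" "v \<in> X c" "f \<in> Hom C c x"
  shows "free_nat C R N n x (free_gen R (c, v, f)) = fmap N c x f (n c v)"
  unfolding free_nat_def
  using lin_ext_gen[OF N.fobj_module[OF assms(2)] free_nat_step[OF assms(1,2)], where s = "(c, v, f)"] assms
  by simp

lemma free_nat_nat_trans:
  assumes n: "\<And>c v. \<lbrakk>c \<in> Obj C; v \<in> X c\<rbrakk> \<Longrightarrow> n c v \<in> carrier (fobj N c)"
  shows "nat_trans C R (free_functor C R X) N (free_nat C R N n)"
proof -
  interpret F: module_functor C R "free_functor C R X" by (rule free_functor_functor)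
  have hom: "free_nat C R N n x \<in> module_hom R (fobj (free_functor C R X) x) (fobj N x)"
    if "x \<in> Obj C" for x
    unfolding free_nat_def fobj_free_functor
    by (rule lin_ext_hom[OF N.fobj_module[OF that] free_nat_step[OF n that]])
  show ?thesis
  proof (rule nat_transI[OF hom])
    fix x y f a assume xy: "x \<in> Obj C" "y \<in> Obj C" "f \<in> Hom C x y"
      and a: "a \<in> carrier (fobj (free_functor C R X) x)"
    show "free_nat C R N n y (fmap (free_functor C R X) x y f a) = fmap N x y f (free_nat C R N n x a)"
    proof (rule module_hom_free_eqI[OF N.fobj_module[OF xy(2)], where S = "free_keys x"
          and \<phi> = "\<lambda>a. free_nat C R N n y (fmap (free_functor C R X) x y f a)"
          and \<psi> = "\<lambda>a. fmap N x y f (free_nat C R N n x a)"])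
      show "(\<lambda>a. free_nat C R N n y (fmap (free_functor C R X) x y f a))
          \<in> module_hom R (free_module R (free_keys x)) (fobj N y)"
        using module_hom_comp[OF F.fmap_hom[OF xy] hom[OF xy(2)]] by (simp add: fobj_free_functor)
      show "(\<lambda>a. fmap N x y f (free_nat C R N n x a))
          \<in> module_hom R (free_module R (free_keys x)) (fobj N y)"
        using module_hom_comp[OF hom[OF xy(1)] N.fmap_hom[OF xy]] by (simp add: fobj_free_functor)
      show "a \<in> carrier (free_module R (free_keys x))" using a by (simp add: fobj_free_functor)
    next
      fix s assume "s \<in> free_keys x"
      then obtain c v g where s: "s = (c, v, g)" "c \<in> Obj C" "v \<in> X c" "g \<in> Hom C c x" by auto
      then show "free_nat C R N n y (fmap (free_functor C R X) x y f (free_gen R s)) =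
          fmap N x y f (free_nat C R N n x (free_gen R s))"
        using xy n by (simp add: fmap_free_functor_gen free_nat_gen C.Comp_Hom N.fmap_Comp)
    qed
  qed
qed

lemma free_nat_unique:
  assumes \<phi>: "nat_trans C R (free_functor C R X) N \<phi>" and \<psi>: "nat_trans C R (free_functor C R X) N \<psi>"
    and eq: "\<And>c v. \<lbrakk>c \<in> Obj C; v \<in> X c\<rbrakk>
      \<Longrightarrow> \<phi> c (free_gen R (c, v, Ident C c)) = \<psi> c (free_gen R (c, v, Ident C c))"
    and x: "x \<in> Obj C" and a: "a \<in> carrier (fobj (free_functor C R X) x)"
  shows "\<phi> x a = \<psi> x a"
proof (rule module_hom_free_eqI[OF N.fobj_module[OF x], where S = "free_keys x"])
  show "\<phi> x \<in> module_hom R (free_module R (free_keys x)) (fobj N x)"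
    using nat_transD(1)[OF \<phi> x] by (simp add: fobj_free_functor)
  show "\<psi> x \<in> module_hom R (free_module R (free_keys x)) (fobj N x)"
    using nat_transD(1)[OF \<psi> x] by (simp add: fobj_free_functor)
  show "a \<in> carrier (free_module R (free_keys x))" using a by (simp add: fobj_free_functor)
next
  fix s assume "s \<in> free_keys x"
  then obtain c v f where s: "s = (c, v, f)" "c \<in> Obj C" "v \<in> X c" "f \<in> Hom C c x" by auto
  let ?g = "free_gen R (c, v, Ident C c)"
  have g: "?g \<in> carrier (fobj (free_functor C R X) c)"
    unfolding fobj_free_functor using s C.Ident_Hom by (intro free_gen_carrier[OF R]) auto
  have "free_gen R s = fmap (free_functor C R X) c x f ?g"
    using s x C.Ident_Hom by (simp add: fmap_free_functor_gen C.Comp_Ident_right)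
  then show "\<phi> x (free_gen R s) = \<psi> x (free_gen R s)"
    using nat_transD(2)[OF \<phi> s(2) x s(4) g] nat_transD(2)[OF \<psi> s(2) x s(4) g] eq[OF s(2,3)] by simp
qed

end

lemma free_functor_lifting:
  assumes N: "module_functor C R N" and M: "module_functor C R M"
    and \<sigma>: "nat_epi C R N M \<sigma>" and \<phi>: "nat_trans C R (free_functor C R X) M \<phi>"
  shows "\<exists>\<psi>. nat_trans C R (free_functor C R X) N \<psi> \<and>
    (\<forall>x\<in>Obj C. \<forall>a\<in>carrier (fobj (free_functor C R X) x). \<sigma> x (\<psi> x a) = \<phi> x a)"
proof -
  interpret N: module_functor C R N by fact
  let ?g = "\<lambda>c v. free_gen R (c, v, Ident C c)"
  have "\<exists>b. b \<in> carrier (fobj N c) \<and> \<sigma> c b = \<phi> c (?g c v)" if "c \<in> Obj C" "v \<in> X c" for c v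
  proof -
    have "?g c v \<in> carrier (fobj (free_functor C R X) c)"
      unfolding fobj_free_functor using that C.Ident_Hom by (intro free_gen_carrier[OF R]) auto
    then have "\<phi> c (?g c v) \<in> carrier (fobj M c)"
      by (rule module_homD(1)[OF nat_transD(1)[OF \<phi> that(1)]])
    moreover have "\<sigma> c ` carrier (fobj N c) = carrier (fobj M c)"
      using \<sigma> that by (simp add: nat_epi_def)
    ultimately show ?thesis by (metis imageE)
  qed
  then obtain n where n: "\<And>c v. \<lbrakk>c \<in> Obj C; v \<in> X c\<rbrakk> \<Longrightarrow> n c v \<in> carrier (fobj N c)"
    and \<sigma>n: "\<And>c v. \<lbrakk>c \<in> Obj C; v \<in> X c\<rbrakk> \<Longrightarrow> \<sigma> c (n c v) = \<phi> c (?g c v)"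
    by metis
  have nt: "nat_trans C R (free_functor C R X) N (free_nat C R N n)"
    by (rule free_nat_nat_trans[OF N n])
  show ?thesis
  proof (intro exI[of _ "free_nat C R N n"] conjI nt ballI)
    fix x a assume x: "x \<in> Obj C" and a: "a \<in> carrier (fobj (free_functor C R X) x)"
    show "\<sigma> x (free_nat C R N n x a) = \<phi> x a"
    proof (rule free_nat_unique[OF M _ \<phi> _ x a])
      show "nat_trans C R (free_functor C R X) M (\<lambda>x a. \<sigma> x (free_nat C R N n x a))"
        using nat_trans_comp[OF nt] \<sigma> by (auto simp: nat_epi_def)
    qed (simp add: free_nat_gen[OF N n] C.Ident_Hom N.fmap_Ident n \<sigma>n)
  qed
qed

end

lemma transport_module_simps:
  "carrier (transport_module \<phi> M) = \<phi> ` carrier M"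
  "\<zero>\<^bsub>transport_module \<phi> M\<^esub> = \<phi> \<zero>\<^bsub>M\<^esub>"
  by (simp_all add: transport_module_def Let_def)

lemma transport_module_ops:
  assumes "inj_on \<phi> (carrier M)"
  shows "\<lbrakk>x \<in> carrier M; y \<in> carrier M\<rbrakk> \<Longrightarrow> \<phi> x \<oplus>\<^bsub>transport_module \<phi> M\<^esub> \<phi> y = \<phi> (x \<oplus>\<^bsub>M\<^esub> y)"
    "x \<in> carrier M \<Longrightarrow> r \<odot>\<^bsub>transport_module \<phi> M\<^esub> \<phi> x = \<phi> (r \<odot>\<^bsub>M\<^esub> x)"
  using assms by (simp_all add: transport_module_def Let_def)

lemma transport_module_module:
  assumes M: "module R M" and inj: "inj_on \<phi> (carrier M)"
  shows "module R (transport_module \<phi> M)"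
proof -
  interpret module R M by fact
  note [simp] = transport_module_simps transport_module_ops[OF inj]
  show ?thesis
  proof (rule moduleI[OF R.is_cring abelian_groupI], goal_cases)
    case (6 x)
    then obtain a where "x = \<phi> a" "a \<in> carrier M" by auto
    then show ?case by (auto intro!: bexI[of _ "\<ominus>\<^bsub>M\<^esub> a"] simp: M.l_neg)
  qed (auto simp: M.a_ac smult_l_distr smult_r_distr smult_assoc1)
qed

lemma transport_hom:
  assumes "inj_on \<phi> (carrier M)"
  shows "\<phi> \<in> module_hom R M (transport_module \<phi> M)"
  by (rule module_homI) (simp_all add: transport_module_simps transport_module_ops[OF assms])

lemma transport_inv_hom:
  assumes "module R M" "inj_on \<phi> (carrier M)"
  shows "inv_into (carrier M) \<phi> \<in> module_hom R (transport_module \<phi> M) M"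
proof -
  interpret module R M by fact
  show ?thesis
    by (rule module_homI) (use assms(2) in \<open>auto simp: transport_module_simps transport_module_ops[OF assms(2)]\<close>)
qed

definition transport_functor ::
  "('v \<Rightarrow> 'w) \<Rightarrow> ('o, 'm, 'r, 'v) mod_functor \<Rightarrow> ('o, 'm, 'r, 'w) mod_functor"
  where "transport_functor \<phi> F =
    \<lparr>fobj = (\<lambda>x. transport_module \<phi> (fobj F x)),
     fmap = (\<lambda>x y f w. \<phi> (fmap F x y f (inv_into (carrier (fobj F x)) \<phi> w)))\<rparr>"

lemma transport_functor_functor:
  assumes F: "module_functor C R F" and inj: "\<And>x. x \<in> Obj C \<Longrightarrow> inj_on \<phi> (carrier (fobj F x))"
  shows "module_functor C R (transport_functor \<phi> F)"
    and "nat_trans C R F (transport_functor \<phi> F) (\<lambda>x. \<phi>)"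
    and "nat_trans C R (transport_functor \<phi> F) F (\<lambda>x. inv_into (carrier (fobj F x)) \<phi>)"
proof -
  interpret F: module_functor C R F by fact
  show "module_functor C R (transport_functor \<phi> F)"
  proof (rule module_functor.intro, goal_cases)
    case (1 x)
    then show ?case by (simp add: transport_functor_def transport_module_module[OF F.fobj_module inj])
  next
    case (2 x y f)
    show ?case
      using module_hom_comp[OF module_hom_comp[OF transport_inv_hom[OF F.fobj_module inj] F.fmap_hom] transport_hom[OF inj]] 2
      by (simp add: transport_functor_def)
  next
    case (3 x a)
    then show ?case
      by (auto simp: transport_functor_def transport_module_simps F.fmap_Ident inj)
  next
    case (4 x y z f g a)
    then obtain b where b: "a = \<phi> b" "b \<in> carrier (fobj F x)"
      by (auto simp: transport_functor_def transport_module_simps)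
    with 4 have "fmap F x y f b \<in> carrier (fobj F y)"
      by (blast intro: module_homD(1)[OF F.fmap_hom])
    with 4 b show ?case
      by (simp add: transport_functor_def F.fmap_Comp inj)
  qed
  show "nat_trans C R F (transport_functor \<phi> F) (\<lambda>x. \<phi>)"
    by (rule nat_transI) (simp_all add: transport_functor_def transport_hom inj)
  show "nat_trans C R (transport_functor \<phi> F) F (\<lambda>x. inv_into (carrier (fobj F x)) \<phi>)"
  proof (rule nat_transI)
    fix x y f a assume xy: "x \<in> Obj C" "y \<in> Obj C" "f \<in> Hom C x y"
      and "a \<in> carrier (fobj (transport_functor \<phi> F) x)"
    then obtain b where b: "a = \<phi> b" "b \<in> carrier (fobj F x)"
      by (auto simp: transport_functor_def transport_module_simps)
    with xy have "fmap F x y f b \<in> carrier (fobj F y)"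
      by (blast intro: module_homD(1)[OF F.fmap_hom])
    with xy b show "inv_into (carrier (fobj F y)) \<phi> (fmap (transport_functor \<phi> F) x y f a) =
        fmap F x y f (inv_into (carrier (fobj F x)) \<phi> a)"
      by (simp add: transport_functor_def inj)
  qed (simp add: transport_functor_def transport_inv_hom F.fobj_module inj)
qed

definition comb :: "('r, 'x) ring_scheme \<Rightarrow> ('o \<times> ('o, 'm, 'r, 'v) universe \<times> 'm \<Rightarrow> 'r) \<Rightarrow>
    ('o, 'm, 'r, 'v) universe"
  where "comb R g = Comb (SOME l. set l = {(s, g s) | s. g s \<noteq> \<zero>\<^bsub>R\<^esub>})"

lemma comb_inj:
  fixes R :: "('b, 'x) ring_scheme"
    and S :: "('a \<times> ('a, 'c, 'b, 'd) universe \<times> 'c) set"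
  shows "inj_on (comb R) (carrier (free_module R S))"
proof (rule inj_onI)
  fix g h assume g: "g \<in> carrier (free_module R S)" and h: "h \<in> carrier (free_module R S)"
    and eq: "comb R g = comb R h"
  have *: "set (SOME l. set l = {(s, g s) | s. g s \<noteq> \<zero>\<^bsub>R\<^esub>}) = {(s, g s) | s. g s \<noteq> \<zero>\<^bsub>R\<^esub>}"
    if "g \<in> carrier (free_module R S)" for g
  proof (rule someI_ex)
    have "{(s, g s) | s. g s \<noteq> \<zero>\<^bsub>R\<^esub>} = (\<lambda>s. (s, g s)) ` {s. g s \<noteq> \<zero>\<^bsub>R\<^esub>}"
      by blast
    then have "finite {(s, g s) | s. g s \<noteq> \<zero>\<^bsub>R\<^esub>}"
      using that by (simp add: free_module_carrier)
    then show "\<exists>l. set l = {(s, g s) | s. g s \<noteq> \<zero>\<^bsub>R\<^esub>}" by (rule finite_list)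
  qed
  have eqs: "{(s, g s) | s. g s \<noteq> \<zero>\<^bsub>R\<^esub>} = {(s, h s) | s. h s \<noteq> \<zero>\<^bsub>R\<^esub>}"
    using eq *[OF g] *[OF h] by (simp add: comb_def)
  have mem: "(s, t) \<in> {(s, f s) | s. f s \<noteq> \<zero>\<^bsub>R\<^esub>} \<longleftrightarrow> t = f s \<and> f s \<noteq> \<zero>\<^bsub>R\<^esub>"
    for s t and f :: "'a \<times> ('a, 'c, 'b, 'd) universe \<times> 'c \<Rightarrow> 'b"
    by blast
  have sub: "(t = g s \<and> g s \<noteq> \<zero>\<^bsub>R\<^esub>) = (t = h s \<and> h s \<noteq> \<zero>\<^bsub>R\<^esub>)" for s t
    using arg_cong[OF eqs, of "\<lambda>A. (s, t) \<in> A"] unfolding mem .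
  show "g = h"
  proof
    fix s show "g s = h s" 
      using sub[of "g s" s] sub[of "h s" s] by (cases "g s = \<zero>\<^bsub>R\<^esub>"; cases "h s = \<zero>\<^bsub>R\<^esub>") simp_all
  qed
qed

lemma projective_cover:
  fixes F :: "('o, 'm, 'r, 'w) mod_functor" and e :: "'w \<Rightarrow> ('o, 'm, 'r, 'v) universe"
  assumes C: "small_category C" and R: "cring R" and F: "module_functor C R F" and e: "inj e"
  shows "\<exists>(P :: ('o, 'm, 'r, 'v) universe_functor) \<eta>. projective C R P \<and> nat_epi C R P F \<eta>"
proof -
  interpret C: small_category C by fact
  interpret F: module_functor C R F by fact
  define X where "X c = e ` carrier (fobj F c)" for c
  let ?G = "free_functor C R X"
  let ?P = "transport_functor (comb R) ?G"
  have G: "module_functor C R ?G" by (rule free_functor_functor[OF C R])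
  have inj: "inj_on (comb R) (carrier (fobj ?G x))" for x
    by (simp add: fobj_free_functor[OF C R] comb_inj)
  note T = transport_functor_functor[OF G inj]
  let ?i = "\<lambda>x. inv_into (carrier (fobj ?G x)) (comb R)"
  have "projective C R ?P"
    unfolding projective_def
  proof (intro conjI T(1) allI impI, elim conjE)
    fix N M :: "('o, 'm, 'r, ('o, 'm, 'r, 'v) universe) mod_functor" and \<sigma> \<phi>
    assume N: "module_functor C R N" and M: "module_functor C R M" and \<sigma>: "nat_epi C R N M \<sigma>"
      and \<phi>: "nat_trans C R ?P M \<phi>"
    obtain \<psi> where \<psi>: "nat_trans C R ?G N \<psi>"
      and eq: "\<And>x a. \<lbrakk>x \<in> Obj C; a \<in> carrier (fobj ?G x)\<rbrakk> \<Longrightarrow> \<sigma> x (\<psi> x a) = \<phi> x (comb R a)"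
      using free_functor_lifting[OF C R N M \<sigma> nat_trans_comp[OF T(2) \<phi>]] by auto
    have "\<sigma> x (\<psi> x (?i x a)) = \<phi> x a" if x: "x \<in> Obj C" and a: "a \<in> carrier (fobj ?P x)" for x a
    proof -
      obtain b where "a = comb R b" "b \<in> carrier (fobj ?G x)"
        using a by (auto simp: transport_functor_def transport_module_simps)
      then show ?thesis using eq[OF x] inj by simp
    qed
    then show "\<exists>\<psi>. nat_trans C R ?P N \<psi> \<and> (\<forall>x\<in>Obj C. \<forall>a\<in>carrier (fobj ?P x). \<sigma> x (\<psi> x a) = \<phi> x a)"
      using nat_trans_comp[OF T(3) \<psi>] by (intro exI[of _ "\<lambda>x a. \<psi> x (?i x a)"]) auto
  qed
  moreover
  let ?n = "\<lambda>c v. inv_into UNIV e v"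
  have n: "?n c v \<in> carrier (fobj F c)" if "c \<in> Obj C" "v \<in> X c" for c v
    using that e by (auto simp: X_def)
  have nt: "nat_trans C R ?G F (free_nat C R F ?n)"
    by (rule free_nat_nat_trans[OF C R F n])
  have "nat_epi C R ?P F (\<lambda>x a. free_nat C R F ?n x (?i x a))"
    unfolding nat_epi_def
  proof (intro conjI ballI nat_trans_comp[OF T(3) nt])
    fix x assume x: "x \<in> Obj C"
    show "(\<lambda>a. free_nat C R F ?n x (?i x a)) ` carrier (fobj ?P x) = carrier (fobj F x)"
    proof (intro equalityI subsetI)
      fix b assume "b \<in> (\<lambda>a. free_nat C R F ?n x (?i x a)) ` carrier (fobj ?P x)"
      then show "b \<in> carrier (fobj F x)"
        using module_homD(1)[OF nat_transD(1)[OF nat_trans_comp[OF T(3) nt] x]] by auto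
    next
      fix b assume b: "b \<in> carrier (fobj F x)"
      let ?g = "free_gen R (x, e b, Ident C x)"
      have g: "?g \<in> carrier (fobj ?G x)"
        unfolding fobj_free_functor[OF C R]
        using x b C.Ident_Hom by (intro free_gen_carrier[OF R]) (auto simp: X_def)
      have eb: "e b \<in> X x" using b by (simp add: X_def)
      have "free_nat C R F ?n x ?g = b"
        using free_nat_gen[OF C R F, of X ?n x x "e b" "Ident C x"] n x b e eb C.Ident_Hom[OF x]
        by (simp add: F.fmap_Ident)
      moreover have "comb R ?g \<in> carrier (fobj ?P x)"
        using g by (simp add: transport_functor_def transport_module_simps)
      moreover have "?i x (comb R ?g) = ?g" using g inj by simp
      ultimately show "b \<in> (\<lambda>a. free_nat C R F ?n x (?i x a)) ` carrier (fobj ?P x)"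
        by (metis (no_types, lifting) imageI)
    qed
  qed
  ultimately show ?thesis by blast
qed

lemma projective_cover_kernel:
  fixes F :: "('o, 'm, 'r, 'w) mod_functor" and e :: "'w \<Rightarrow> ('o, 'm, 'r, 'v) universe"
  assumes C: "small_category C" and R: "cring R"
    and F: "module_functor C R F" and G: "module_functor C R G" and \<theta>: "nat_trans C R F G \<theta>"
    and e: "inj e"
  shows "\<exists>(P :: ('o, 'm, 'r, 'v) universe_functor) \<eta>. projective C R P \<and> nat_trans C R P F \<eta> \<and>
    (\<forall>x\<in>Obj C. a_kernel (fobj F x) (fobj G x) (\<theta> x) = \<eta> x ` carrier (fobj P x))"
proof -
  interpret F: module_functor C R F by fact
  interpret G: module_functor C R G by fact
  define K where "K x = a_kernel (fobj F x) (fobj G x) (\<theta> x)" for x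
  have K: "a \<in> K x \<longleftrightarrow> a \<in> carrier (fobj F x) \<and> \<theta> x a = \<zero>\<^bsub>fobj G x\<^esub>" for a x
    by (auto simp: K_def a_kernel_def kernel_def)
  define FK where "FK = F\<lparr>fobj := \<lambda>x. (fobj F x)\<lparr>carrier := K x\<rparr>\<rparr>"
  have sub: "submodule (K x) R (fobj F x)" if x: "x \<in> Obj C" for x
  proof -
    interpret Fx: module R "fobj F x" using F.fobj_module[OF x] .
    interpret Gx: module R "fobj G x" using G.fobj_module[OF x] .
    note hom = module_homD[OF nat_transD(1)[OF \<theta> x]]
    note hz = module_hom_zero[OF F.fobj_module[OF x] G.fobj_module[OF x] nat_transD(1)[OF \<theta> x]]
    have inv: "\<theta> x (\<ominus>\<^bsub>fobj F x\<^esub> a) = \<zero>\<^bsub>fobj G x\<^esub>"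
      if a: "a \<in> carrier (fobj F x)" "\<theta> x a = \<zero>\<^bsub>fobj G x\<^esub>" for a
      using hom(2)[of "\<ominus>\<^bsub>fobj F x\<^esub> a" a] hom(1)[of "\<ominus>\<^bsub>fobj F x\<^esub> a"] a hz
      by (simp add: Fx.M.l_neg)
    show ?thesis
      by (rule Fx.submoduleI) (auto simp: K hom hz inv)
  qed
  have FKf: "module_functor C R FK"
  proof (rule module_functor.intro, goal_cases)
    case (1 x)
    then show ?case
      by (simp add: FK_def submodule.submodule_is_module[OF sub F.fobj_module])
  next
    case (2 x y f)
    have "fmap F x y f a \<in> K y" if "a \<in> K x" for a
      using that 2 nat_transD(2)[OF \<theta> 2] module_homD(1)[OF F.fmap_hom[OF 2]]
        module_hom_zero[OF G.fobj_module G.fobj_module G.fmap_hom[OF 2]] by (simp add: K)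
    then show ?case
      using module_homD[OF F.fmap_hom[OF 2]] by (auto intro!: module_homI simp: FK_def K)
  qed (auto simp: FK_def K F.fmap_Ident F.fmap_Comp)
  obtain P :: "('o, 'm, 'r, 'v) universe_functor" and \<eta>
    where P: "projective C R P" and \<eta>: "nat_epi C R P FK \<eta>"
    using projective_cover[OF C R FKf e] by blast
  have "nat_trans C R FK F (\<lambda>x a. a)"
    by (rule nat_transI) (auto intro!: module_homI simp: FK_def K)
  then have "nat_trans C R P F \<eta>"
    using \<eta> nat_trans_comp[of C R P FK \<eta> F "\<lambda>x a. a"] by (simp add: nat_epi_def)
  moreover have "\<forall>x\<in>Obj C. K x = \<eta> x ` carrier (fobj P x)"
    using \<eta> by (simp add: nat_epi_def FK_def)
  ultimately show ?thesis using P by (auto simp: K_def)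
qed

theorem projective_resolution_exists:
  fixes F :: "('o, 'm, 'r, 'v) mod_functor"
  assumes C: "small_category C" and R: "cring R" and F: "module_functor C R F"
  shows "\<exists>P d \<epsilon>. projective_resolution C R F P d \<epsilon>"
proof -
  have pf: "module_functor C R P" if "projective C R P" for P :: "('o, 'm, 'r, 'v) universe_functor"
    using that by (simp add: projective_def)
  have idinj: "inj (\<lambda>u :: ('o, 'm, 'r, 'v) universe. u)" by simp
  obtain P0 :: "('o, 'm, 'r, 'v) universe_functor" and \<epsilon>
    where P0: "projective C R P0" and \<epsilon>: "nat_epi C R P0 F \<epsilon>"
    using projective_cover[OF C R F, of Val] by (auto simp: inj_def)
  obtain P1 :: "('o, 'm, 'r, 'v) universe_functor" and d0
    where P1: "projective C R P1" and d0: "nat_trans C R P1 P0 d0"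
      and ex0: "\<forall>x\<in>Obj C. a_kernel (fobj P0 x) (fobj F x) (\<epsilon> x) = d0 x ` carrier (fobj P1 x)"
    using projective_cover_kernel[OF C R pf[OF P0] F _ idinj, of \<epsilon>] \<epsilon> unfolding nat_epi_def by blast
  define good :: "('o, 'm, 'r, 'v) universe_functor \<times> ('o, 'm, 'r, 'v) universe_functor \<times>
      ('o \<Rightarrow> ('o, 'm, 'r, 'v) universe \<Rightarrow> ('o, 'm, 'r, 'v) universe) \<Rightarrow> bool"
    where "good = (\<lambda>(P, Q, d). projective C R P \<and> projective C R Q \<and> nat_trans C R Q P d)"
  define link :: "('o, 'm, 'r, 'v) universe_functor \<times> ('o, 'm, 'r, 'v) universe_functor \<times>
      ('o \<Rightarrow> ('o, 'm, 'r, 'v) universe \<Rightarrow> ('o, 'm, 'r, 'v) universe) \<Rightarrow>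
      ('o, 'm, 'r, 'v) universe_functor \<times> ('o, 'm, 'r, 'v) universe_functor \<times>
      ('o \<Rightarrow> ('o, 'm, 'r, 'v) universe \<Rightarrow> ('o, 'm, 'r, 'v) universe) \<Rightarrow> bool"
    where "link = (\<lambda>(P, Q, d) (P', Q', d'). P' = Q \<and>
    (\<forall>x\<in>Obj C. a_kernel (fobj Q x) (fobj P x) (d x)
      = d' x ` carrier (fobj Q' x)))"
  have step: "\<exists>t. good t \<and> link s t" if "good s" for s
  proof -
    obtain P Q d where s: "s = (P, Q, d)" by (cases s)
    with that have g: "projective C R P" "projective C R Q" "nat_trans C R Q P d"
      by (auto simp: good_def)
    obtain Q' :: "('o, 'm, 'r, 'v) universe_functor" and d'
      where "projective C R Q'" "nat_trans C R Q' Q d'"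
        "\<forall>x\<in>Obj C. a_kernel (fobj Q x) (fobj P x) (d x) = d' x ` carrier (fobj Q' x)"
      using projective_cover_kernel[OF C R pf[OF g(2)] pf[OF g(1)] g(3) idinj] by blast
    with g s show ?thesis
      by (intro exI[of _ "(Q, Q', d')"]) (auto simp: good_def link_def)
  qed
  have g0: "good (P0, P1, d0)" using P0 P1 d0 by (simp add: good_def)
  obtain S where S0: "S 0 = (P0, P1, d0)" and S: "\<And>n. good (S n)" "\<And>n. link (S n) (S (Suc n))"
  proof -
    define S where "S = rec_nat (P0, P1, d0) (\<lambda>_ s. SOME t. good t \<and> link s t)"
    have "S 0 = (P0, P1, d0)" and SS: "\<And>n. S (Suc n) = (SOME t. good t \<and> link (S n) t)"
      by (simp_all add: S_def)
    have gS: "good (S n)" for n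
    proof (induction n)
      case (Suc n)
      show ?case using someI_ex[OF step[OF Suc]] unfolding SS by (rule conjunct1)
    qed (simp add: \<open>S 0 = _\<close> g0)
    have "link (S n) (S (Suc n))" for n
      using someI_ex[OF step[OF gS[of n]]] unfolding SS by (rule conjunct2)
    then show ?thesis by (rule that[of S, OF \<open>S 0 = _\<close> gS])
  qed
  define P where "P n = fst (S n)" for n
  define d where "d n = snd (snd (S n))" for n
  have "fst t = fst (snd s)" if "link s t" for s t
    using that by (auto simp: link_def split: prod.splits)
  then have "fst (snd (S n)) = P (Suc n)" for n using S(2)[of n] by (simp add: P_def)
  then have SP: "S n = (P n, P (Suc n), d n)" for n by (simp add: P_def d_def prod_eq_iff)
  have PP: "projective C R (P n)" "nat_trans C R (P (Suc n)) (P n) (d n)" for n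
    using S(1)[of n] by (simp_all add: SP good_def)
  have ex: "\<forall>x\<in>Obj C. a_kernel (fobj (P (Suc n)) x) (fobj (P n) x) (d n x)
      = d (Suc n) x ` carrier (fobj (P (Suc (Suc n))) x)" for n
    using S(2)[of n] by (simp add: SP link_def)
  have start: "P 0 = P0" "P (Suc 0) = P1" "d 0 = d0" using S0 SP[of 0] by simp_all
  have "projective_resolution C R F P d \<epsilon>"
    unfolding projective_resolution_def One_nat_def
    by (intro conjI allI PP ex) (use \<epsilon> ex0 in \<open>simp_all add: start\<close>)
  then show ?thesis by blast
qed

section \<open>The categories and functors are well defined\<close>

lemma DeltaS_Hom_iff: "(f, L) \<in> DeltaS_Hom n m \<longleftrightarrow>
    f \<in> {0..n} \<rightarrow>\<^sub>E {0..m} \<and>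
      (\<forall>j\<in>{0..m}. distinct (L j) \<and> set (L j) = {i \<in> {0..n}. f i = j}) \<and>
      (\<forall>j. j \<notin> {0..m} \<longrightarrow> L j = [])"
  by (simp add: DeltaS_Hom_def)

lemma DeltaS_simps [simp]:
  "Obj DeltaS = UNIV" "Hom DeltaS = DeltaS_Hom"
  "Ident DeltaS n = (\<lambda>i\<in>{0..n}. i, \<lambda>j. if j \<in> {0..n} then [j] else [])"
  "Comp DeltaS n m l (g, K) (f, L) = (\<lambda>i\<in>{0..n}. g (f i), \<lambda>i. concat (map L (K i)))"
  by (simp_all add: DeltaS_def)

lemma DeltaS_Comp_Hom:
  assumes "(f, L) \<in> DeltaS_Hom n m" "(g, K) \<in> DeltaS_Hom m l"
  shows "(\<lambda>i\<in>{0..n}. g (f i), \<lambda>i. concat (map L (K i))) \<in> DeltaS_Hom n l"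
proof -
  have f: "f i \<le> m" if "i \<le> n" for i using assms(1) that by (auto simp: DeltaS_Hom_iff)
  have g: "g i \<le> l" if "i \<le> m" for i using assms(2) that by (auto simp: DeltaS_Hom_iff)
  have L: "distinct (L j)" "set (L j) = {i. i \<le> n \<and> f i = j}" if "j \<le> m" for j
    using assms(1) that by (auto simp: DeltaS_Hom_iff)
  have K: "distinct (K j)" "set (K j) = {i. i \<le> m \<and> g i = j}" if "j \<le> l" for j
    using assms(2) that by (auto simp: DeltaS_Hom_iff)
  have K0: "K j = []" if "\<not> j \<le> l" for j using assms(2) that by (auto simp: DeltaS_Hom_iff)
  have dist: "distinct (concat (map L xs))" if "distinct xs" "set xs \<subseteq> {..m}" for xs
    using that by (induction xs) (auto simp: L)
  show ?thesis
    unfolding DeltaS_Hom_iff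
  proof (intro conjI ballI allI impI)
    show "(\<lambda>i\<in>{0..n}. g (f i)) \<in> {0..n} \<rightarrow>\<^sub>E {0..l}" using f g by auto
  next
    fix j assume "j \<in> {0..l}"
    then have j: "j \<le> l" by simp
    show "distinct (concat (map L (K j)))" using dist K[OF j] by auto
    show "set (concat (map L (K j))) = {i \<in> {0..n}. (\<lambda>i\<in>{0..n}. g (f i)) i = j}"
      using K(2)[OF j] L f by auto
  qed (simp add: K0)
qed

lemma small_category_DeltaS: "small_category DeltaS"
proof
  fix x show "Ident DeltaS x \<in> Hom DeltaS x x"
    by (auto simp: DeltaS_Hom_iff)
next
  fix x y z f g assume "f \<in> Hom DeltaS x y" "g \<in> Hom DeltaS y z"
  then show "Comp DeltaS x y z g f \<in> Hom DeltaS x z"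
    by (cases f; cases g) (simp add: DeltaS_Comp_Hom)
next
  fix x y \<alpha> assume a: "\<alpha> \<in> Hom DeltaS x y"
  obtain f L where [simp]: "\<alpha> = (f, L)" by (cases \<alpha>)
  have f: "f \<in> {0..x} \<rightarrow>\<^sub>E {0..y}" using a by (simp add: DeltaS_Hom_iff)
  have L: "set (L j) \<subseteq> {0..x}" for j
    using a by (cases "j \<le> y") (auto simp: DeltaS_Hom_iff)
  have L0: "L j = []" if "\<not> j \<le> y" for j using a that by (simp add: DeltaS_Hom_iff)
  have "concat (map (\<lambda>j. if j \<in> {0..x} then [j] else []) xs) = xs" if "set xs \<subseteq> {0..x}" for xs
    using that by (induction xs) auto
  then have 1: "(\<lambda>i. concat (map (\<lambda>j. if j \<in> {0..x} then [j] else []) (L i))) = L"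
    using L by blast
  have 2: "(\<lambda>i\<in>{0..x}. f ((\<lambda>i\<in>{0..x}. i) i)) = f" using f by (auto simp: fun_eq_iff PiE_def extensional_def)
  show "Comp DeltaS x x y \<alpha> (Ident DeltaS x) = \<alpha>" using 1 2 by simp
  have 3: "(\<lambda>i\<in>{0..x}. (\<lambda>i\<in>{0..y}. i) (f i)) = f"
    using f by (auto simp: fun_eq_iff PiE_def extensional_def)
  have 4: "(\<lambda>i. concat (map L (if i \<in> {0..y} then [i] else []))) = L" using L0 by auto
  show "Comp DeltaS x y y (Ident DeltaS y) \<alpha> = \<alpha>" using 3 4 by simp
next
  fix w x y z \<alpha> \<beta> \<gamma> assume a: "\<alpha> \<in> Hom DeltaS w x" "\<beta> \<in> Hom DeltaS x y" "\<gamma> \<in> Hom DeltaS y z"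
  obtain f L g K h M where [simp]: "\<alpha> = (f, L)" "\<beta> = (g, K)" "\<gamma> = (h, M)" by (cases \<alpha>; cases \<beta>; cases \<gamma>)
  have f: "f i \<le> x" if "i \<le> w" for i using a that by (auto simp: DeltaS_Hom_iff)
  have "concat (map L (concat (map K xs))) = concat (map (\<lambda>i. concat (map L (K i))) xs)" for xs
    by (induction xs) auto
  then show "Comp DeltaS w x z (Comp DeltaS x y z \<gamma> \<beta>) \<alpha> = Comp DeltaS w y z \<gamma> (Comp DeltaS w x y \<beta> \<alpha>)"
    using f by (auto simp: fun_eq_iff)
qed

lemma small_category_DeltaS_plus: "small_category DeltaS_plus"
proof -
  interpret small_category DeltaS by (rule small_category_DeltaS)
  note [simp del] = DeltaS_simps(2-4)
  show ?thesis
  proof (standard, goal_cases)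
    case (1 x)
    then show ?case using Ident_Hom by (auto simp: DeltaS_plus_def split: option.splits)
  next
    case (2 x y z f g)
    then show ?case using Comp_Hom by (auto simp: DeltaS_plus_def split: option.splits)
  next
    case (3 x y f)
    then show ?case using Comp_Ident_right by (auto simp: DeltaS_plus_def split: option.splits)
  next
    case (4 x y f)
    then show ?case using Comp_Ident_left by (auto simp: DeltaS_plus_def split: option.splits)
  next
    case (5 w x y z f g h)
    then show ?case using Comp_assoc by (auto simp: DeltaS_plus_def split: option.splits)
  qed
qed

subsection \<open>Spans and quotients\<close>

lemma module_span_submodule:
  assumes M: "module R M" and S: "S \<subseteq> carrier M"
  shows "submodule (module_span R M S) R M"
proof -
  interpret module R M by fact
  have car: "submodule (carrier M) R M" by (rule carrier_is_submodule)
  show ?thesis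
  proof (rule submoduleI)
    show "module_span R M S \<subseteq> carrier M" using car S by (auto simp: module_span_def)
    show "\<zero>\<^bsub>M\<^esub> \<in> module_span R M S"
      unfolding module_span_def
    proof (rule InterI, elim CollectE conjE)
      fix H assume H: "submodule H R M"
      then show "\<zero>\<^bsub>M\<^esub> \<in> H"
        using subgroup.one_closed[OF submodule.axioms(1)[OF H]] by simp
    qed
    show "\<ominus>\<^bsub>M\<^esub> a \<in> module_span R M S" if "a \<in> module_span R M S" for a
      using that submoduleE(3) unfolding module_span_def by blast
    show "a \<oplus>\<^bsub>M\<^esub> b \<in> module_span R M S" if "a \<in> module_span R M S" "b \<in> module_span R M S" for a b
      using that submoduleE(5) unfolding module_span_def by blast
    show "r \<odot>\<^bsub>M\<^esub> b \<in> module_span R M S" if "r \<in> carrier R" "b \<in> module_span R M S" for r b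
      using that submoduleE(4) unfolding module_span_def by blast
  qed
qed

lemma module_span_incl: "S \<subseteq> module_span R M S"
  by (auto simp: module_span_def)

lemma module_span_minimal: "submodule H R M \<Longrightarrow> S \<subseteq> H \<Longrightarrow> module_span R M S \<subseteq> H"
  by (auto simp: module_span_def)

lemma module_hom_minus:
  assumes M: "module R M" and N: "module R N" and h: "h \<in> module_hom R M N"
    and xy: "x \<in> carrier M" "y \<in> carrier M"
  shows "h (x \<ominus>\<^bsub>M\<^esub> y) = h x \<ominus>\<^bsub>N\<^esub> h y"
proof -
  interpret M: module R M by fact
  interpret N: module R N by fact
  note hom = module_homD[OF h]
  have "h (\<ominus>\<^bsub>M\<^esub> y) \<oplus>\<^bsub>N\<^esub> h y = \<zero>\<^bsub>N\<^esub>"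
    using hom(2)[of "\<ominus>\<^bsub>M\<^esub> y" y] xy module_hom_zero[OF M N h] by (simp add: M.M.l_neg)
  then have "h (\<ominus>\<^bsub>M\<^esub> y) = \<ominus>\<^bsub>N\<^esub> h y"
    using hom(1) xy by (metis M.M.a_inv_closed N.M.minus_equality)
  then show ?thesis using hom xy by (simp add: a_minus_def)
qed

lemma vimage_submodule:
  assumes M: "module R M" and N: "module R N" and h: "h \<in> module_hom R M N" and H: "submodule H R N"
  shows "submodule {x \<in> carrier M. h x \<in> H} R M"
proof -
  interpret M: module R M by fact
  interpret N: module R N by fact
  note hom = module_homD[OF h]
  have z: "\<zero>\<^bsub>N\<^esub> \<in> H" using subgroup.one_closed[OF submodule.axioms(1)[OF H]] by simp
  have inv: "h (\<ominus>\<^bsub>M\<^esub> a) = \<ominus>\<^bsub>N\<^esub> h a" if "a \<in> carrier M" for a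
    using module_hom_minus[OF M N h M.M.zero_closed that] that hom(1)[OF that]
    by (simp add: module_hom_zero[OF M N h] a_minus_def)
  show ?thesis
    by (rule M.submoduleI)
      (auto simp: hom inv z module_hom_zero[OF M N h] intro: N.submoduleE(3-5)[OF H])
qed

context
  fixes R :: "('r, 'x) ring_scheme" and M :: "('r, 'a) module" and H
  assumes M: "module R M" and H: "submodule H R M"
begin

interpretation module R M by (rule M)

lemma submodule_abelian_subgroup: "abelian_subgroup H M"
  by (rule abelian_subgroupI3)
    (auto intro: additive_subgroup.intro submodule.axioms(1)[OF H] M.abelian_group_axioms)

interpretation H: abelian_subgroup H M by (rule submodule_abelian_subgroup)

lemma module_coset_eq_iff:
  assumes "x \<in> carrier M" "y \<in> carrier M"
  shows "H +>\<^bsub>M\<^esub> x = H +>\<^bsub>M\<^esub> y \<longleftrightarrow> x \<ominus>\<^bsub>M\<^esub> y \<in> H"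
proof
  assume "H +>\<^bsub>M\<^esub> x = H +>\<^bsub>M\<^esub> y"
  then have "H +>\<^bsub>M\<^esub> (x \<ominus>\<^bsub>M\<^esub> y) = H"
    using M.a_coset_add_inv2 assms H.a_subset by (simp add: a_minus_def)
  then show "x \<ominus>\<^bsub>M\<^esub> y \<in> H"
    using M.a_coset_join1 assms H.a_subgroup by simp
next
  assume "x \<ominus>\<^bsub>M\<^esub> y \<in> H"
  then have "H +>\<^bsub>M\<^esub> (x \<ominus>\<^bsub>M\<^esub> y) = H"
    using M.a_coset_join2 assms H.a_subgroup by simp
  then show "H +>\<^bsub>M\<^esub> x = H +>\<^bsub>M\<^esub> y"
    using M.a_coset_add_inv1 assms H.a_subset by (simp add: a_minus_def)
qed

lemma quotient_carrier: "carrier (quotient_module M H) = (\<lambda>x. H +>\<^bsub>M\<^esub> x) ` carrier M"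
  by (auto simp: quotient_module_def A_RCOSETS_def')

lemma quotient_add:
  "\<lbrakk>x \<in> carrier M; y \<in> carrier M\<rbrakk> \<Longrightarrow>
    (H +>\<^bsub>M\<^esub> x) \<oplus>\<^bsub>quotient_module M H\<^esub> (H +>\<^bsub>M\<^esub> y) = H +>\<^bsub>M\<^esub> (x \<oplus>\<^bsub>M\<^esub> y)"
  by (simp add: quotient_module_def H.a_rcos_sum)

lemma quotient_zero: "\<zero>\<^bsub>quotient_module M H\<^esub> = H +>\<^bsub>M\<^esub> \<zero>\<^bsub>M\<^esub>"
  using H.a_subset by (simp add: quotient_module_def)

lemma quotient_smult:
  assumes r: "r \<in> carrier R" and x: "x \<in> carrier M"
  shows "r \<odot>\<^bsub>quotient_module M H\<^esub> (H +>\<^bsub>M\<^esub> x) = H +>\<^bsub>M\<^esub> (r \<odot>\<^bsub>M\<^esub> x)"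
proof -
  have sub: "\<And>h. h \<in> H \<Longrightarrow> h \<in> carrier M" using H.a_subset by blast
  have "(\<Union>h\<in>H. \<Union>k\<in>(\<lambda>x. r \<odot>\<^bsub>M\<^esub> x) ` (\<Union>h\<in>H. {h \<oplus>\<^bsub>M\<^esub> x}). {h \<oplus>\<^bsub>M\<^esub> k}) = (\<Union>h\<in>H. {h \<oplus>\<^bsub>M\<^esub> r \<odot>\<^bsub>M\<^esub> x})"
  proof (intro equalityI subsetI)
    fix y assume "y \<in> (\<Union>h\<in>H. \<Union>k\<in>(\<lambda>x. r \<odot>\<^bsub>M\<^esub> x) ` (\<Union>h\<in>H. {h \<oplus>\<^bsub>M\<^esub> x}). {h \<oplus>\<^bsub>M\<^esub> k})"
    then obtain h h' where h: "h \<in> H" "h' \<in> H" "y = h \<oplus>\<^bsub>M\<^esub> r \<odot>\<^bsub>M\<^esub> (h' \<oplus>\<^bsub>M\<^esub> x)" by auto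
    then have "y = (h \<oplus>\<^bsub>M\<^esub> r \<odot>\<^bsub>M\<^esub> h') \<oplus>\<^bsub>M\<^esub> r \<odot>\<^bsub>M\<^esub> x"
      using sub r x by (simp add: smult_r_distr M.a_assoc)
    moreover have "h \<oplus>\<^bsub>M\<^esub> r \<odot>\<^bsub>M\<^esub> h' \<in> H" using h r submoduleE(4,5)[OF H] by blast
    ultimately show "y \<in> (\<Union>h\<in>H. {h \<oplus>\<^bsub>M\<^esub> r \<odot>\<^bsub>M\<^esub> x})" by blast
  next
    fix y assume "y \<in> (\<Union>h\<in>H. {h \<oplus>\<^bsub>M\<^esub> r \<odot>\<^bsub>M\<^esub> x})"
    then obtain h where h: "h \<in> H" "y = h \<oplus>\<^bsub>M\<^esub> r \<odot>\<^bsub>M\<^esub> x" by blast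
    then have "y = h \<oplus>\<^bsub>M\<^esub> r \<odot>\<^bsub>M\<^esub> (\<zero>\<^bsub>M\<^esub> \<oplus>\<^bsub>M\<^esub> x)" using x by simp
    then show "y \<in> (\<Union>h\<in>H. \<Union>k\<in>(\<lambda>x. r \<odot>\<^bsub>M\<^esub> x) ` (\<Union>h\<in>H. {h \<oplus>\<^bsub>M\<^esub> x}). {h \<oplus>\<^bsub>M\<^esub> k})"
      using h(1) H.zero_closed by blast
  qed
  then show ?thesis by (simp add: quotient_module_def set_add_def' a_r_coset_def')
qed

lemma quotient_module_module: "module R (quotient_module M H)"
proof (rule moduleI[OF R.is_cring abelian_groupI], goal_cases)
  case (6 X)
  then obtain x where x: "X = H +>\<^bsub>M\<^esub> x" "x \<in> carrier M" by (auto simp: quotient_carrier)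
  then show ?case
    by (intro bexI[of _ "H +>\<^bsub>M\<^esub> (\<ominus>\<^bsub>M\<^esub> x)"])
      (auto simp: quotient_carrier quotient_zero quotient_add M.l_neg simp del: M.a_coset_add_zero)
qed (auto simp: quotient_carrier quotient_zero quotient_add quotient_smult M.a_ac smult_l_distr
      smult_r_distr smult_assoc1 simp del: M.a_coset_add_zero)

end

lemma induced_map_coset:
  assumes M: "module R M" and N: "module R N" and f: "f \<in> module_hom R M N"
    and K: "submodule K R M" and H: "submodule H R N" and fK: "f ` K \<subseteq> H" and x: "x \<in> carrier M"
  shows "induced_map N H f (K +>\<^bsub>M\<^esub> x) = H +>\<^bsub>N\<^esub> f x"
proof -
  interpret M: module R M by fact
  interpret N: module R N by fact
  interpret K: abelian_subgroup K M by (rule submodule_abelian_subgroup[OF M K])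
  interpret H: abelian_subgroup H N by (rule submodule_abelian_subgroup[OF N H])
  note hom = module_homD[OF f]
  have "H +>\<^bsub>N\<^esub> f (k \<oplus>\<^bsub>M\<^esub> x) = H +>\<^bsub>N\<^esub> f x" if k: "k \<in> K" for k
  proof -
    have kc: "k \<in> carrier M" using k K.a_subset by blast
    have fk: "f k \<in> H" using fK k by blast
    have "f (k \<oplus>\<^bsub>M\<^esub> x) = f k \<oplus>\<^bsub>N\<^esub> f x" using hom(2) kc x by blast
    moreover have "f (k \<oplus>\<^bsub>M\<^esub> x) \<ominus>\<^bsub>N\<^esub> f x = f k"
      using hom(1) kc x by (simp add: calculation a_minus_def N.M.a_assoc N.M.r_neg)
    ultimately show ?thesis using fk hom(1) kc x by (simp add: module_coset_eq_iff[OF N H])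
  qed
  moreover have "K \<noteq> {}" using K.zero_closed by blast
  ultimately show ?thesis by (auto simp: induced_map_def a_r_coset_def'[of M])
qed

lemma induced_map_hom:
  assumes M: "module R M" and N: "module R N" and f: "f \<in> module_hom R M N"
    and K: "submodule K R M" and H: "submodule H R N" and fK: "f ` K \<subseteq> H"
  shows "induced_map N H f \<in> module_hom R (quotient_module M K) (quotient_module N H)"
proof -
  interpret M: module R M by fact
  interpret N: module R N by fact
  note hom = module_homD[OF f]
  note [simp] = induced_map_coset[OF assms] quotient_carrier[OF M K] quotient_carrier[OF N H]
    quotient_add[OF M K] quotient_add[OF N H] quotient_smult[OF M K] quotient_smult[OF N H]
  show ?thesis by (rule module_homI) (auto simp: hom)
qed

subsection \<open>The symmetric bar construction is functorial\<close>

context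
  fixes R :: "('r, 'x) ring_scheme" and A :: "('r, 'a) module"
  assumes RA: "assoc_algebra R A"
begin

interpretation assoc_algebra R A by (rule RA)

abbreviation "words_module n \<equiv> free_module R (words A n)"

lemma words_module_module: "module R (words_module n)" by (rule free_module_module) (rule R.is_cring)

lemma words_gen: "as \<in> words A n \<Longrightarrow> free_gen R as \<in> carrier (words_module n)"
  by (rule free_gen_carrier) (rule R.is_cring)

lemma words_update: "\<lbrakk>as \<in> words A n; a \<in> carrier A\<rbrakk> \<Longrightarrow> as[i := a] \<in> words A n"
  using set_update_subset_insert[of as i a] by (auto simp: words_def)

abbreviation "tensor_rel_add n \<equiv> {free_gen R (as[i := a \<oplus>\<^bsub>A\<^esub> b]) \<ominus>\<^bsub>words_module n\<^esub>
   (free_gen R (as[i := a]) \<oplus>\<^bsub>words_module n\<^esub> free_gen R (as[i := b])) | as i a b.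
          as \<in> words A n \<and> i < n \<and> a \<in> carrier A \<and> b \<in> carrier A}"
abbreviation "tensor_rel_smult n \<equiv> {free_gen R (as[i := r \<odot>\<^bsub>A\<^esub> a]) \<ominus>\<^bsub>words_module n\<^esub>
   (r \<odot>\<^bsub>words_module n\<^esub> free_gen R (as[i := a])) | as i r a.
          as \<in> words A n \<and> i < n \<and> r \<in> carrier R \<and> a \<in> carrier A}"

lemma tensor_rel_addI: "\<lbrakk>as \<in> words A n; i < n; a \<in> carrier A; b \<in> carrier A\<rbrakk> \<Longrightarrow>
   free_gen R (as[i := a \<oplus>\<^bsub>A\<^esub> b]) \<ominus>\<^bsub>words_module n\<^esub>
   (free_gen R (as[i := a]) \<oplus>\<^bsub>words_module n\<^esub> free_gen R (as[i := b])) \<in> tensor_rel_add n"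
  by (rule CollectI) (intro exI conjI, rule refl, assumption+)

lemma tensor_rel_smultI: "\<lbrakk>as \<in> words A n; i < n; r \<in> carrier R; a \<in> carrier A\<rbrakk> \<Longrightarrow>
   free_gen R (as[i := r \<odot>\<^bsub>A\<^esub> a]) \<ominus>\<^bsub>words_module n\<^esub>
   (r \<odot>\<^bsub>words_module n\<^esub> free_gen R (as[i := a])) \<in> tensor_rel_smult n"
  by (rule CollectI) (intro exI conjI, rule refl, assumption+)

lemma tensor_relations_eq: "tensor_relations R A n = module_span R (words_module n) (tensor_rel_add n \<union> tensor_rel_smult n)"
  unfolding tensor_relations_def Let_def ..

lemma tensor_relations_carrier: "tensor_rel_add n \<union> tensor_rel_smult n \<subseteq> carrier (words_module n)"
proof -
  interpret W: module R "words_module n" by (rule words_module_module)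
  show ?thesis
    by (safe; intro W.M.minus_closed W.M.a_closed W.smult_closed words_gen words_update) auto
qed

lemma tensor_relations_submodule: "submodule (tensor_relations R A n) R (words_module n)"
  unfolding tensor_relations_eq by (rule module_span_submodule[OF words_module_module tensor_relations_carrier])

abbreviation "list_mult xs \<equiv> foldr (\<lambda>a b. a \<otimes>\<^bsub>A\<^esub> b) xs \<one>\<^bsub>A\<^esub>"

lemma list_mult_closed: "set xs \<subseteq> carrier A \<Longrightarrow> list_mult xs \<in> carrier A"
  by (induction xs) auto

lemma list_mult_append: "\<lbrakk>set xs \<subseteq> carrier A; set ys \<subseteq> carrier A\<rbrakk>
    \<Longrightarrow> list_mult (xs @ ys) = list_mult xs \<otimes>\<^bsub>A\<^esub> list_mult ys"
  by (induction xs) (auto simp: list_mult_closed A.m_assoc)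

lemma nth_words: "\<lbrakk>as \<in> words A n; i < n\<rbrakk> \<Longrightarrow> as ! i \<in> carrier A"
  by (auto simp: words_def)

lemma fibre_closed:
  assumes "(f, L) \<in> DeltaS_Hom n m" "as \<in> words A (Suc n)"
  shows "set (map (\<lambda>i. as ! i) (L j)) \<subseteq> carrier A"
proof -
  have "set (L j) \<subseteq> {0..n}"
    using assms(1) by (cases "j \<le> m") (auto simp: DeltaS_Hom_iff)
  then show ?thesis using nth_words[OF assms(2)] by auto
qed

lemma fibre_products_words:
  assumes "(f, L) \<in> DeltaS_Hom n m" "as \<in> words A (Suc n)"
  shows "fibre_products A m L as \<in> words A (Suc m)"
  using list_mult_closed[OF fibre_closed[OF assms]]
  unfolding words_def fibre_products_def by (auto simp del: upt_Suc)

lemma fibre_products_nth: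
  "j \<le> m \<Longrightarrow> fibre_products A m L as ! j = list_mult (map (\<lambda>i. as ! i) (L j))"
  unfolding fibre_products_def by (simp del: upt_Suc)

lemma fibre_products_length: "length (fibre_products A m L as) = Suc m"
  by (simp add: fibre_products_def)

lemma fibre_products_update:
  assumes h: "(f, L) \<in> DeltaS_Hom n m" and as: "as \<in> words A (Suc n)" and i: "i < Suc n"
  obtains bs j u v where "bs \<in> words A (Suc m)" "j < Suc m" "u \<in> carrier A" "v \<in> carrier A"
    "\<And>a. a \<in> carrier A \<Longrightarrow> fibre_products A m L (as[i := a]) = bs[j := u \<otimes>\<^bsub>A\<^esub> (a \<otimes>\<^bsub>A\<^esub> v)]"
proof -
  let ?j = "f i"
  have j: "?j \<le> m" using h i by (auto simp: DeltaS_Hom_iff)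
  have Lj: "distinct (L j)" "set (L j) = {i. i \<le> n \<and> f i = j}" if "j \<le> m" for j
    using h that by (auto simp: DeltaS_Hom_iff)
  have "i \<in> set (L ?j)" using Lj[OF j] i by auto
  then obtain p q where pq: "L ?j = p @ i # q" by (meson split_list)
  have nip: "i \<notin> set p" "i \<notin> set q" using Lj(1)[OF j] pq by auto
  have car: "set (map (\<lambda>i. as ! i) p) \<subseteq> carrier A" "set (map (\<lambda>i. as ! i) q) \<subseteq> carrier A"
    using fibre_closed[OF h as, of ?j] pq by auto
  have len: "length as = Suc n" using as by (simp add: words_def)
  show thesis
  proof (rule that[of "fibre_products A m L as" ?j "list_mult (map (\<lambda>i. as ! i) p)" "list_mult (map (\<lambda>i. as ! i) q)"])
    fix a assume a: "a \<in> carrier A"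
    have ne: "map (\<lambda>k. as[i := a] ! k) xs = map (\<lambda>k. as ! k) xs" if "i \<notin> set xs" for xs
      using that by (induction xs) auto
    show "fibre_products A m L (as[i := a]) = (fibre_products A m L as)
       [?j := list_mult (map (\<lambda>i. as ! i) p) \<otimes>\<^bsub>A\<^esub> (a \<otimes>\<^bsub>A\<^esub> list_mult (map (\<lambda>i. as ! i) q))]" (is "?l = ?r")
    proof (rule nth_equalityI)
      show "length ?l = length ?r" by (simp add: fibre_products_length)
      fix k assume "k < length ?l"
      then have k: "k \<le> m" by (simp add: fibre_products_length)
      show "?l ! k = ?r ! k"
      proof (cases "k = ?j")
        case True
        have "list_mult (map (\<lambda>k. as[i := a] ! k) (p @ i # q)) =
           list_mult (map (\<lambda>i. as ! i) p @ a # map (\<lambda>i. as ! i) q)"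
          using i len by (simp add: ne[OF nip(1)] ne[OF nip(2)] del: foldr_append)
        also have "\<dots> = list_mult (map (\<lambda>i. as ! i) p) \<otimes>\<^bsub>A\<^esub> list_mult (a # map (\<lambda>i. as ! i) q)"
          using car a by (intro list_mult_append) auto
        finally show ?thesis using True j k pq
          by (simp add: fibre_products_nth fibre_products_length del: foldr_append)
      next
        case False
        then have "i \<notin> set (L k)" using Lj[OF k] by auto
        then show ?thesis using False k by (simp add: fibre_products_nth ne)
      qed
    qed
  qed (use fibre_products_words[OF h as] j list_mult_closed car in auto)
qed

abbreviation "bar_lin n m L \<equiv> lin_ext R (words_module (Suc m)) (\<lambda>as. free_gen R (fibre_products A m L as))"

lemma bar_lin_step:
  assumes "(f, L) \<in> DeltaS_Hom n m"
  shows "(\<lambda>as. free_gen R (fibre_products A m L as)) \<in> words A (Suc n) \<rightarrow> carrier (words_module (Suc m))"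
  by (rule Pi_I, rule words_gen, rule fibre_products_words[OF assms])

lemma bar_lin_hom: "(f, L) \<in> DeltaS_Hom n m \<Longrightarrow> bar_lin n m L \<in> module_hom R (words_module (Suc n)) (words_module (Suc m))"
  by (rule lin_ext_hom[OF words_module_module bar_lin_step])

lemma bar_lin_gen: "\<lbrakk>(f, L) \<in> DeltaS_Hom n m; as \<in> words A (Suc n)\<rbrakk>
    \<Longrightarrow> bar_lin n m L (free_gen R as) = free_gen R (fibre_products A m L as)"
  by (rule lin_ext_gen[OF words_module_module bar_lin_step])

lemma bar_lin_rels:
  assumes h: "(f, L) \<in> DeltaS_Hom n m"
  shows "bar_lin n m L ` tensor_relations R A (Suc n) \<subseteq> tensor_relations R A (Suc m)"
proof -
  let ?T = "tensor_relations R A (Suc m)"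
  interpret W: module R "words_module (Suc n)" by (rule words_module_module)
  note lh = bar_lin_hom[OF h]
  note mn = module_hom_minus[OF words_module_module words_module_module lh]
  have "tensor_rel_add (Suc n) \<union> tensor_rel_smult (Suc n) \<subseteq> {x \<in> carrier (words_module (Suc n)). bar_lin n m L x \<in> ?T}"
  proof
    fix x assume x: "x \<in> tensor_rel_add (Suc n) \<union> tensor_rel_smult (Suc n)"
    then have xc: "x \<in> carrier (words_module (Suc n))" by (rule subsetD[OF tensor_relations_carrier])
    have "bar_lin n m L x \<in> tensor_rel_add (Suc m) \<union> tensor_rel_smult (Suc m)"
      using x
    proof
      assume "x \<in> tensor_rel_add (Suc n)"
      then obtain as i a b where x: "x = free_gen R (as[i := a \<oplus>\<^bsub>A\<^esub> b]) \<ominus>\<^bsub>words_module (Suc n)\<^esub>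
          (free_gen R (as[i := a]) \<oplus>\<^bsub>words_module (Suc n)\<^esub> free_gen R (as[i := b]))"
        and as: "as \<in> words A (Suc n)" "i < Suc n" and ab: "a \<in> carrier A" "b \<in> carrier A" by auto
      obtain bs j u v where bs: "bs \<in> words A (Suc m)" "j < Suc m" and uv: "u \<in> carrier A" "v \<in> carrier A"
        and up: "\<And>a. a \<in> carrier A \<Longrightarrow> fibre_products A m L (as[i := a]) = bs[j := u \<otimes>\<^bsub>A\<^esub> (a \<otimes>\<^bsub>A\<^esub> v)]"
        by (rule fibre_products_update[OF h as]) (rule that; assumption)
      have w: "as[i := c] \<in> words A (Suc n)" if "c \<in> carrier A" for c by (rule words_update[OF as(1) that])
      have "bar_lin n m L x = free_gen R (bs[j := u \<otimes>\<^bsub>A\<^esub> ((a \<oplus>\<^bsub>A\<^esub> b) \<otimes>\<^bsub>A\<^esub> v)]) \<ominus>\<^bsub>words_module (Suc m)\<^esub>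
         (free_gen R (bs[j := u \<otimes>\<^bsub>A\<^esub> (a \<otimes>\<^bsub>A\<^esub> v)]) \<oplus>\<^bsub>words_module (Suc m)\<^esub> free_gen R (bs[j := u \<otimes>\<^bsub>A\<^esub> (b \<otimes>\<^bsub>A\<^esub> v)]))"
        using ab unfolding x
        by (simp add: mn words_gen w module_homD(2)[OF lh] bar_lin_gen[OF h] up del: free_module_simps)
      also have "u \<otimes>\<^bsub>A\<^esub> ((a \<oplus>\<^bsub>A\<^esub> b) \<otimes>\<^bsub>A\<^esub> v) = (u \<otimes>\<^bsub>A\<^esub> (a \<otimes>\<^bsub>A\<^esub> v)) \<oplus>\<^bsub>A\<^esub> (u \<otimes>\<^bsub>A\<^esub> (b \<otimes>\<^bsub>A\<^esub> v))"
        using ab uv by (simp add: A.l_distr A.r_distr)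
      finally have eq: "bar_lin n m L x = free_gen R (bs[j := (u \<otimes>\<^bsub>A\<^esub> (a \<otimes>\<^bsub>A\<^esub> v)) \<oplus>\<^bsub>A\<^esub> (u \<otimes>\<^bsub>A\<^esub> (b \<otimes>\<^bsub>A\<^esub> v))]) \<ominus>\<^bsub>words_module (Suc m)\<^esub>
         (free_gen R (bs[j := u \<otimes>\<^bsub>A\<^esub> (a \<otimes>\<^bsub>A\<^esub> v)]) \<oplus>\<^bsub>words_module (Suc m)\<^esub> free_gen R (bs[j := u \<otimes>\<^bsub>A\<^esub> (b \<otimes>\<^bsub>A\<^esub> v)]))" .
      show ?thesis unfolding eq by (rule UnI1, rule tensor_rel_addI[OF bs]) (use ab uv in simp_all)
    next
      assume "x \<in> tensor_rel_smult (Suc n)"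
      then obtain as i r a where x: "x = free_gen R (as[i := r \<odot>\<^bsub>A\<^esub> a]) \<ominus>\<^bsub>words_module (Suc n)\<^esub>
          (r \<odot>\<^bsub>words_module (Suc n)\<^esub> free_gen R (as[i := a]))"
        and as: "as \<in> words A (Suc n)" "i < Suc n" and ra: "r \<in> carrier R" "a \<in> carrier A" by auto
      obtain bs j u v where bs: "bs \<in> words A (Suc m)" "j < Suc m" and uv: "u \<in> carrier A" "v \<in> carrier A"
        and up: "\<And>a. a \<in> carrier A \<Longrightarrow> fibre_products A m L (as[i := a]) = bs[j := u \<otimes>\<^bsub>A\<^esub> (a \<otimes>\<^bsub>A\<^esub> v)]"
        by (rule fibre_products_update[OF h as]) (rule that; assumption)
      have w: "as[i := c] \<in> words A (Suc n)" if "c \<in> carrier A" for c by (rule words_update[OF as(1) that])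
      have "bar_lin n m L x = free_gen R (bs[j := u \<otimes>\<^bsub>A\<^esub> ((r \<odot>\<^bsub>A\<^esub> a) \<otimes>\<^bsub>A\<^esub> v)]) \<ominus>\<^bsub>words_module (Suc m)\<^esub>
         (r \<odot>\<^bsub>words_module (Suc m)\<^esub> free_gen R (bs[j := u \<otimes>\<^bsub>A\<^esub> (a \<otimes>\<^bsub>A\<^esub> v)]))"
        using ra unfolding x
        by (simp add: mn words_gen w module_homD(3)[OF lh] bar_lin_gen[OF h] up del: free_module_simps)
      also have "u \<otimes>\<^bsub>A\<^esub> ((r \<odot>\<^bsub>A\<^esub> a) \<otimes>\<^bsub>A\<^esub> v) = r \<odot>\<^bsub>A\<^esub> (u \<otimes>\<^bsub>A\<^esub> (a \<otimes>\<^bsub>A\<^esub> v))"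
        using ra uv by (simp add: smult_mult_left smult_mult_right)
      finally have eq: "bar_lin n m L x = free_gen R (bs[j := r \<odot>\<^bsub>A\<^esub> (u \<otimes>\<^bsub>A\<^esub> (a \<otimes>\<^bsub>A\<^esub> v))]) \<ominus>\<^bsub>words_module (Suc m)\<^esub>
         (r \<odot>\<^bsub>words_module (Suc m)\<^esub> free_gen R (bs[j := u \<otimes>\<^bsub>A\<^esub> (a \<otimes>\<^bsub>A\<^esub> v)]))" .
      show ?thesis unfolding eq by (rule UnI2, rule tensor_rel_smultI[OF bs]) (use ra uv in simp_all)
    qed
    then have "bar_lin n m L x \<in> ?T" unfolding tensor_relations_eq by (rule subsetD[OF module_span_incl])
    with xc show "x \<in> {x \<in> carrier (words_module (Suc n)). bar_lin n m L x \<in> ?T}" by blast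
  qed
  then have "tensor_relations R A (Suc n) \<subseteq> {x \<in> carrier (words_module (Suc n)). bar_lin n m L x \<in> ?T}"
    unfolding tensor_relations_eq[of "Suc n"]
    by (rule module_span_minimal[OF vimage_submodule[OF words_module_module words_module_module lh tensor_relations_submodule]])
  then show ?thesis by blast
qed

lemma Bsym_fobj: "fobj (Bsym R A) n = quotient_module (words_module (Suc n)) (tensor_relations R A (Suc n))"
  by (simp add: Bsym_def tensor_power_def)

lemma Bsym_fmap: "fmap (Bsym R A) n m (f, L) =
    induced_map (words_module (Suc m)) (tensor_relations R A (Suc m)) (bar_lin n m L)"
  by (simp add: Bsym_def)

lemma Bsym_fmap_coset:
  assumes "(f, L) \<in> DeltaS_Hom n m" "x \<in> carrier (words_module (Suc n))"
  shows "fmap (Bsym R A) n m (f, L) (tensor_relations R A (Suc n) +>\<^bsub>words_module (Suc n)\<^esub> x) =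
    tensor_relations R A (Suc m) +>\<^bsub>words_module (Suc m)\<^esub> bar_lin n m L x"
  unfolding Bsym_fmap
  by (rule induced_map_coset[OF words_module_module words_module_module bar_lin_hom[OF assms(1)] tensor_relations_submodule tensor_relations_submodule
        bar_lin_rels[OF assms(1)] assms(2)])

lemma Bsym_pure:
  assumes "(f, L) \<in> DeltaS_Hom n m" "as \<in> words A (Suc n)"
  shows "fmap (Bsym R A) n m (f, L) (pure_tensor R A as) = pure_tensor R A (fibre_products A m L as)"
proof -
  have "length as = Suc n" using assms(2) by (simp add: words_def)
  then show ?thesis
    using Bsym_fmap_coset[OF assms(1) words_gen[OF assms(2)]] bar_lin_gen[OF assms]
    by (simp add: pure_tensor_def fibre_products_length)
qed

lemma Bsym_functor: "module_functor DeltaS R (Bsym R A)"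
proof (rule module_functor.intro, goal_cases)
  case (1 n)
  show ?case unfolding Bsym_fobj by (rule quotient_module_module[OF words_module_module tensor_relations_submodule])
next
  case (2 n m \<alpha>)
  obtain f L where a: "\<alpha> = (f, L)" by (cases \<alpha>)
  with 2 have h: "(f, L) \<in> DeltaS_Hom n m" by simp
  show ?case unfolding a Bsym_fmap Bsym_fobj
    by (rule induced_map_hom[OF words_module_module words_module_module bar_lin_hom[OF h] tensor_relations_submodule tensor_relations_submodule bar_lin_rels[OF h]])
next
  case (3 n X)
  then obtain x where x: "X = tensor_relations R A (Suc n) +>\<^bsub>words_module (Suc n)\<^esub> x" "x \<in> carrier (words_module (Suc n))"
    by (auto simp: Bsym_fobj quotient_carrier[OF words_module_module tensor_relations_submodule])
  let ?L = "\<lambda>j. if j \<in> {0..n} then [j] else []"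
  have h: "(\<lambda>i\<in>{0..n}. i, ?L) \<in> DeltaS_Hom n n" by (auto simp: DeltaS_Hom_iff)
  have "bar_lin n n ?L x = (\<lambda>x. x) x"
  proof (rule module_hom_free_eqI[OF words_module_module bar_lin_hom[OF h] _ _ x(2)])
    show "(\<lambda>x. x) \<in> module_hom R (words_module (Suc n)) (words_module (Suc n))" by (rule module_homI) simp_all
    fix as assume as: "as \<in> words A (Suc n)"
    have "fibre_products A n ?L as = as"
    proof (rule nth_equalityI)
      show "length (fibre_products A n ?L as) = length as"
        using as by (simp add: fibre_products_length words_def)
      fix j assume "j < length (fibre_products A n ?L as)"
      then have "j \<le> n" by (simp add: fibre_products_length)
      then show "fibre_products A n ?L as ! j = as ! j"
        using nth_words[OF as, of j] by (simp add: fibre_products_nth)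
    qed
    then show "bar_lin n n ?L (free_gen R as) = free_gen R as" using bar_lin_gen[OF h as] by simp
  qed
  then show ?case using Bsym_fmap_coset[OF h x(2)] x(1) by simp
next
  case (4 n m l \<alpha> \<beta> X)
  obtain f L g K where a: "\<alpha> = (f, L)" "\<beta> = (g, K)" by (cases \<alpha>; cases \<beta>)
  with 4 have h: "(f, L) \<in> DeltaS_Hom n m" and k: "(g, K) \<in> DeltaS_Hom m l" by auto
  note hk = DeltaS_Comp_Hom[OF h k]
  let ?M = "\<lambda>i. concat (map L (K i))"
  obtain x where x: "X = tensor_relations R A (Suc n) +>\<^bsub>words_module (Suc n)\<^esub> x" "x \<in> carrier (words_module (Suc n))"
    using 4 by (auto simp: Bsym_fobj quotient_carrier[OF words_module_module tensor_relations_submodule])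
  have "bar_lin n l ?M x = (\<lambda>x. bar_lin m l K (bar_lin n m L x)) x"
  proof (rule module_hom_free_eqI[OF words_module_module bar_lin_hom[OF hk] _ _ x(2)])
    show "(\<lambda>x. bar_lin m l K (bar_lin n m L x)) \<in> module_hom R (words_module (Suc n)) (words_module (Suc l))"
      by (rule module_hom_comp[OF bar_lin_hom[OF h] bar_lin_hom[OF k]])
    fix as assume as: "as \<in> words A (Suc n)"
    note fw = fibre_products_words[OF h as]
    have "fibre_products A l ?M as = fibre_products A l K (fibre_products A m L as)"
    proof (rule nth_equalityI)
      fix i assume "i < length (fibre_products A l ?M as)"
      then have i: "i \<le> l" by (simp add: fibre_products_length)
      have Ki: "set (K i) \<subseteq> {0..m}" using k i by (auto simp: DeltaS_Hom_iff)
      have "list_mult (map (\<lambda>i. as ! i) (concat (map L xs))) =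
          list_mult (map (\<lambda>j. fibre_products A m L as ! j) xs)" if "set xs \<subseteq> {0..m}" for xs
        using that
      proof (induction xs)
        case (Cons j xs)
        have c: "set (map (\<lambda>i. as ! i) (concat (map L xs))) \<subseteq> carrier A"
          using fibre_closed[OF h as] by fastforce
        have "list_mult (map (\<lambda>i. as ! i) (L j) @ map (\<lambda>i. as ! i) (concat (map L xs))) =
          list_mult (map (\<lambda>i. as ! i) (L j)) \<otimes>\<^bsub>A\<^esub> list_mult (map (\<lambda>i. as ! i) (concat (map L xs)))"
          by (rule list_mult_append[OF fibre_closed[OF h as] c])
        then show ?case using Cons by (simp add: fibre_products_nth del: foldr_append)
      qed simp
      from this[OF Ki] show "fibre_products A l ?M as ! i = fibre_products A l K (fibre_products A m L as) ! i"
        using i by (simp add: fibre_products_nth)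
    qed (simp add: fibre_products_length)
    then show "bar_lin n l ?M (free_gen R as) = bar_lin m l K (bar_lin n m L (free_gen R as))"
      by (simp add: bar_lin_gen[OF h as] bar_lin_gen[OF k fw] bar_lin_gen[OF hk as])
  qed
  then show ?case
    using x(1) Bsym_fmap_coset[OF h x(2)] Bsym_fmap_coset[OF hk x(2)]
      Bsym_fmap_coset[OF k module_homD(1)[OF bar_lin_hom[OF h] x(2)]] by (simp add: a)
qed

lemma regular_module_module: "module R (regular_module R)"
proof (rule moduleI[OF R.is_cring abelian_groupI], goal_cases)
  case (6 x)
  then show ?case by (auto simp: regular_module_def intro!: bexI[of _ "\<ominus>\<^bsub>R\<^esub> x"] R.l_neg)
qed (auto simp: regular_module_def R.a_ac R.m_assoc R.l_distr R.r_distr)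

lemma Bsym_plus_functor: "module_functor DeltaS_plus R (Bsym_plus R A)"
proof -
  interpret B: module_functor DeltaS R "Bsym R A" by (rule Bsym_functor)
  let ?P = "\<lambda>n. pure_tensor R A (replicate (Suc n) \<one>\<^bsub>A\<^esub>)"
  have wd: "replicate (Suc n) \<one>\<^bsub>A\<^esub> \<in> words A (Suc n)" for n by (auto simp: words_def)
  have pc: "?P n \<in> carrier (fobj (Bsym R A) n)" for n
    using words_gen[OF wd] by (simp add: Bsym_fobj quotient_carrier[OF words_module_module tensor_relations_submodule] pure_tensor_def)
  have tp: "tensor_power R A (Suc n) = fobj (Bsym R A) n" for n by (simp add: Bsym_def)
  have unit: "fmap (Bsym R A) n m \<alpha> (?P n) = ?P m" if h: "\<alpha> \<in> DeltaS_Hom n m" for n m \<alpha>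
  proof -
    obtain f L where a: "\<alpha> = (f, L)" by (cases \<alpha>)
    have one: "list_mult (map (\<lambda>i. replicate (Suc n) \<one>\<^bsub>A\<^esub> ! i) xs) = \<one>\<^bsub>A\<^esub>" if "set xs \<subseteq> {0..n}" for xs
      using that by (induction xs) (auto simp del: replicate_Suc)
    have "set (L j) \<subseteq> {0..n}" if "j \<le> m" for j using h that by (auto simp: a DeltaS_Hom_iff)
    then have "fibre_products A m L (replicate (Suc n) \<one>\<^bsub>A\<^esub>) = replicate (Suc m) \<one>\<^bsub>A\<^esub>"
      by (intro nth_equalityI) (auto simp: fibre_products_length fibre_products_nth one simp del: replicate_Suc)
    then show ?thesis using Bsym_pure[of f L n m, OF _ wd] h a by simp
  qed
  have inl: "inj_on Inl S" "inj_on Inr T" for S :: "'r set" and T :: "('a list \<Rightarrow> 'r) set set" by auto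
  note tops = transport_module_ops[OF inl(1)] transport_module_ops[OF inl(2)]
  interpret reg: module R "regular_module R" by (rule regular_module_module)
  note rs = transport_module_simps
  have rc: "carrier (regular_module R) = carrier R" by (simp add: regular_module_def)
  have ra: "x \<oplus>\<^bsub>regular_module R\<^esub> y = x \<oplus>\<^bsub>R\<^esub> y" "x \<odot>\<^bsub>regular_module R\<^esub> y = x \<otimes>\<^bsub>R\<^esub> y" for x y
    by (simp_all add: regular_module_def)
  note [simp del] = DeltaS_simps(3,4) replicate_Suc
  have obj: "fobj (Bsym_plus R A) None = transport_module Inl (regular_module R)"
    "fobj (Bsym_plus R A) (Some n) = transport_module Inr (fobj (Bsym R A) n)" for n
    by (simp_all add: Bsym_plus_def)
  have mp: "fmap (Bsym_plus R A) None None None = id"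
    "fmap (Bsym_plus R A) None (Some n) None = (\<lambda>v. Inr (projl v \<odot>\<^bsub>fobj (Bsym R A) n\<^esub> ?P n))"
    "fmap (Bsym_plus R A) (Some n) (Some m) (Some \<alpha>) = (\<lambda>v. Inr (fmap (Bsym R A) n m \<alpha> (projr v)))" for n m \<alpha>
    by (simp_all add: Bsym_plus_def tp)
  have hom_cases: "(x = None \<and> f = None) \<or> (\<exists>n m \<alpha>. x = Some n \<and> y = Some m \<and> f = Some \<alpha> \<and> \<alpha> \<in> DeltaS_Hom n m)"
    if "f \<in> Hom DeltaS_plus x y" for f x y
    using that by (auto simp: DeltaS_plus_def split: option.splits)
  have car: "a \<in> carrier (fobj (Bsym R A) n) \<Longrightarrow> fmap (Bsym R A) n m \<alpha> a \<in> carrier (fobj (Bsym R A) m)"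
    if "\<alpha> \<in> DeltaS_Hom n m" for n m \<alpha> a using module_homD(1)[OF B.fmap_hom, of n m \<alpha> a] that by simp
  show ?thesis
  proof (rule module_functor.intro, goal_cases)
    case (1 x)
    then show ?case
      by (cases x) (simp_all add: obj transport_module_module regular_module_module B.fobj_module)
  next
    case (2 x y f)
    from hom_cases[OF 2(3)] show ?case
    proof (elim disjE conjE exE)
      assume xf: "x = None" "f = None"
      show ?thesis
      proof (cases y)
        case None
        then show ?thesis using xf by (auto intro!: module_homI simp: mp obj)
      next
        case (Some n)
        interpret T: module R "fobj (Bsym R A) n" by (rule B.fobj_module) simp
        show ?thesis unfolding xf Some mp obj
          using pc[of n]
          by (auto intro!: module_homI simp: rs tops rc ra T.smult_l_distr T.smult_assoc1)
      qed
    next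
      fix n m \<alpha> assume e: "x = Some n" "y = Some m" "f = Some \<alpha>" and h: "\<alpha> \<in> DeltaS_Hom n m"
      interpret Tn: module R "fobj (Bsym R A) n" by (rule B.fobj_module) simp
      interpret Tm: module R "fobj (Bsym R A) m" by (rule B.fobj_module) simp
      have hm: "fmap (Bsym R A) n m \<alpha> \<in> module_hom R (fobj (Bsym R A) n) (fobj (Bsym R A) m)"
        using B.fmap_hom h by simp
      show ?thesis unfolding e mp obj
        using car[OF h]
        by (auto intro!: module_homI simp: rs tops module_homD(2,3)[OF hm])
    qed
  next
    case (3 x a)
    show ?case
    proof (cases x)
      case None
      then show ?thesis by (simp add: DeltaS_plus_def mp)
    next
      case (Some n)
      have "Ident DeltaS_plus (Some n) = Some (Ident DeltaS n)" by (simp add: DeltaS_plus_def)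
      then show ?thesis using 3 Some B.fmap_Ident[of n] by (auto simp: mp obj rs)
    qed
  next
    case (4 x y z f g a)
    from hom_cases[OF 4(4)] show ?case
    proof (elim disjE conjE exE)
      assume xf: "x = None" "f = None"
      have cf: "Comp DeltaS_plus x y z g f = None" by (simp add: DeltaS_plus_def xf)
      obtain r where r: "a = Inl r" "r \<in> carrier R" using 4(6) xf by (auto simp: obj rs rc)
      from hom_cases[OF 4(5)] show ?thesis
      proof (elim disjE conjE exE)
        assume e: "y = None" "g = None"
        show ?thesis unfolding cf unfolding e xf mp by simp
      next
        fix n m \<alpha> assume e: "y = Some n" "z = Some m" "g = Some \<alpha>" and h: "\<alpha> \<in> DeltaS_Hom n m"
        have hm: "fmap (Bsym R A) n m \<alpha> \<in> module_hom R (fobj (Bsym R A) n) (fobj (Bsym R A) m)"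
          using B.fmap_hom h by simp
        show ?thesis unfolding cf unfolding e xf mp using r
          by (simp add: module_homD(3)[OF hm _ pc] unit[OF h])
      qed
    next
      fix n m \<alpha> assume e: "x = Some n" "y = Some m" "f = Some \<alpha>" and h: "\<alpha> \<in> DeltaS_Hom n m"
      from hom_cases[OF 4(5)] e obtain l \<beta> where e2: "z = Some l" "g = Some \<beta>" and k: "\<beta> \<in> DeltaS_Hom m l"
        by auto
      have cf: "Comp DeltaS_plus x y z g f = Some (Comp DeltaS n m l \<beta> \<alpha>)"
        by (simp add: DeltaS_plus_def e e2)
      show ?thesis unfolding cf unfolding e e2 mp
        using 4(6) h k B.fmap_Comp[of n m l \<alpha> \<beta>] by (auto simp: e obj rs)
    qed
  qed
qed

end

end

theory Submission
  imports Defs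
begin

text \<open>
  Let \<open>i : \<Delta>S \<rightarrow> \<Delta>S\<^sub>+\<close> be the inclusion and let \<open>j : \<Delta>S\<^sub>+ \<rightarrow> \<Delta>S\<close> add a point to every set, so that
  \<open>j [-1] = [0]\<close> and \<open>j [n] = [n+1]\<close>.  The inclusion of a set into the set with one more point is a
  natural transformation from the identity to \<open>j i\<close> and also to \<open>i j\<close>.  A natural transformation
  from the identity to an endofunctor \<open>S\<close> becomes invisible in colimits, since \<open>a \<in> F(x)\<close> is
  identified there with its image in \<open>F(S x)\<close>.  Therefore \<open>i\<close> and \<open>j\<close> induce mutually inverse maps in
  homology.

  To see this on complexes, let \<open>P\<close> and \<open>Q\<close> be projective resolutions of the bar constructions
  over \<open>\<Delta>S\<close> and over \<open>\<Delta>S\<^sub>+\<close>.  Pullbacks of resolutions are exact, so the comparison theorem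
  (\<open>chain_lift_exists\<close>) gives chain maps \<open>P \<rightarrow> i\<^sup>*Q\<close> and \<open>Q \<rightarrow> j\<^sup>*P\<close>, which induce maps between the
  colimits of \<open>P\<close> and \<open>Q\<close>.  The composite \<open>P \<rightarrow> (j i)\<^sup>*P\<close> covers the same map as the one given by the
  inclusions \<open>x \<rightarrow> j i x\<close>; hence the two are homotopic (\<open>chain_lift_homotopy\<close>), and the second one is
  the identity on colimits.  The same holds with the roles exchanged.  The lemma
  \<open>chain_lift_colim_cycles\<close> is this argument for one side, and \<open>functor_homology_isomorphic\<close>
  combines both sides for general categories.  The projective functors involved take values in
  different types; \<open>projective_lifting\<close> removes this obstacle.
\<close>

section \<open>Lifting against functors of arbitrary type\<close>

lemma module_hom_diff:
  assumes M: "module R M" and N: "module R N" and f: "f \<in> module_hom R M N" and g: "g \<in> module_hom R M N"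
  shows "(\<lambda>x. f x \<ominus>\<^bsub>N\<^esub> g x) \<in> module_hom R M N"
proof -
  interpret M: module R M by fact
  interpret N: module R N by fact
  note f = module_homD[OF f] and g = module_homD[OF g]
  show ?thesis
  proof (rule module_homI)
    fix x y assume "x \<in> carrier M" "y \<in> carrier M"
    then show "f (x \<oplus>\<^bsub>M\<^esub> y) \<ominus>\<^bsub>N\<^esub> g (x \<oplus>\<^bsub>M\<^esub> y) = (f x \<ominus>\<^bsub>N\<^esub> g x) \<oplus>\<^bsub>N\<^esub> (f y \<ominus>\<^bsub>N\<^esub> g y)"
      using f(1)[of x] f(1)[of y] g(1)[of x] g(1)[of y]
      by (simp add: f(2) g(2) a_minus_def N.M.minus_add N.M.a_ac)
  next
    fix r x assume "r \<in> carrier R" "x \<in> carrier M"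
    then show "f (r \<odot>\<^bsub>M\<^esub> x) \<ominus>\<^bsub>N\<^esub> g (r \<odot>\<^bsub>M\<^esub> x) = r \<odot>\<^bsub>N\<^esub> (f x \<ominus>\<^bsub>N\<^esub> g x)"
      using f(1)[of x] g(1)[of x]
      by (simp add: f(3) g(3) a_minus_def N.smult_r_distr N.smult_r_minus)
  qed (simp add: f(1) g(1))
qed

lemma nat_trans_diff:
  assumes F: "module_functor C R F" and G: "module_functor C R G"
    and \<eta>: "nat_trans C R F G \<eta>" and \<theta>: "nat_trans C R F G \<theta>"
  shows "nat_trans C R F G (\<lambda>x a. \<eta> x a \<ominus>\<^bsub>fobj G x\<^esub> \<theta> x a)"
proof (rule nat_transI)
  interpret F: module_functor C R F by fact
  interpret G: module_functor C R G by fact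
  fix x assume x: "x \<in> Obj C"
  show "(\<lambda>a. \<eta> x a \<ominus>\<^bsub>fobj G x\<^esub> \<theta> x a) \<in> module_hom R (fobj F x) (fobj G x)"
    by (rule module_hom_diff[OF F.fobj_module[OF x] G.fobj_module[OF x] nat_transD(1)[OF \<eta> x] nat_transD(1)[OF \<theta> x]])
  fix y f a assume y: "y \<in> Obj C" and f: "f \<in> Hom C x y" and a: "a \<in> carrier (fobj F x)"
  show "\<eta> y (fmap F x y f a) \<ominus>\<^bsub>fobj G y\<^esub> \<theta> y (fmap F x y f a) =
      fmap G x y f (\<eta> x a \<ominus>\<^bsub>fobj G x\<^esub> \<theta> x a)"
    using module_hom_minus[OF G.fobj_module[OF x] G.fobj_module[OF y] G.fmap_hom[OF x y f],
        OF module_homD(1)[OF nat_transD(1)[OF \<eta> x] a] module_homD(1)[OF nat_transD(1)[OF \<theta> x] a]]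
    by (simp add: nat_transD(2)[OF \<eta> x y f a] nat_transD(2)[OF \<theta> x y f a])
qed

lemma nat_trans_closed:
  assumes "nat_trans C R F G \<eta>" "x \<in> Obj C" "a \<in> carrier (fobj F x)"
  shows "\<eta> x a \<in> carrier (fobj G x)"
  by (rule module_homD(1)[OF nat_transD(1)[OF assms(1,2)] assms(3)])

lemma nat_trans_zero:
  assumes "module_functor C R F" "module_functor C R G" "nat_trans C R F G \<eta>" "x \<in> Obj C"
  shows "\<eta> x \<zero>\<^bsub>fobj F x\<^esub> = \<zero>\<^bsub>fobj G x\<^esub>"
  by (rule module_hom_zero[OF module_functor.fobj_module module_functor.fobj_module nat_transD(1)])
    (use assms in auto)

lemma nat_trans_id: "nat_trans C R F F (\<lambda>x a. a)"
  by (rule nat_transI) (auto intro!: module_homI)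

text \<open>
  The definition of \<open>projective\<close> only tests functors whose values lie in one fixed type, while
  resolutions over \<open>\<Delta>S\<close> have to be compared with pulled-back resolutions whose values lie in
  another.  The type \<open>universe\<close> contains the free functor on the values of \<open>P\<close>, so \<open>P\<close> is a
  retract of that free functor, and a free functor lifts against functors of every type.
  Asking only that \<open>\<delta>\<close> hits the image of \<open>\<phi>\<close> spares the construction of image and kernel
  subfunctors below.
\<close>

lemma projective_lifting:
  fixes P :: "('o, 'm, 'r, 'v) universe_functor"
    and N :: "('o, 'm, 'r, 'w) mod_functor" and M :: "('o, 'm, 'r, 'u) mod_functor"
  assumes C: "small_category C" and R: "cring R" and P: "projective C R P"
    and N: "module_functor C R N" and M: "module_functor C R M"
    and \<delta>: "nat_trans C R N M \<delta>" and \<phi>: "nat_trans C R P M \<phi>"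
    and im: "\<And>x a. \<lbrakk>x \<in> Obj C; a \<in> carrier (fobj P x)\<rbrakk> \<Longrightarrow> \<phi> x a \<in> \<delta> x ` carrier (fobj N x)"
  obtains \<psi> where "nat_trans C R P N \<psi>"
    "\<And>x a. \<lbrakk>x \<in> Obj C; a \<in> carrier (fobj P x)\<rbrakk> \<Longrightarrow> \<delta> x (\<psi> x a) = \<phi> x a"
proof -
  interpret C: small_category C by fact
  have Pf: "module_functor C R P" using P by (simp add: projective_def)
  interpret P: module_functor C R P by fact
  interpret N: module_functor C R N by fact
  define X where "X c = carrier (fobj P c)" for c
  let ?G = "free_functor C R X"
  have G: "module_functor C R ?G" by (rule free_functor_functor[OF C R])
  have inj: "inj_on (comb R) (carrier (fobj ?G x))" for x
    by (simp add: fobj_free_functor[OF C R] comb_inj)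
  note T = transport_functor_functor[OF G inj]
  let ?T = "transport_functor (comb R) ?G"
  let ?i = "\<lambda>x. inv_into (carrier (fobj ?G x)) (comb R)"
  let ?\<kappa> = "free_nat C R P (\<lambda>c v. v)"
  have \<kappa>: "nat_trans C R ?G P ?\<kappa>" by (rule free_nat_nat_trans[OF C R Pf]) (simp add: X_def)
  have \<kappa>_gen: "?\<kappa> x (free_gen R (x, v, Ident C x)) = v" if "x \<in> Obj C" "v \<in> carrier (fobj P x)" for x v
    using free_nat_gen[OF C R Pf, of X "\<lambda>c v. v" x x v "Ident C x"] that
    by (simp add: X_def C.Ident_Hom P.fmap_Ident)
  \<comment> \<open>The copy \<open>?T\<close> of the free functor has values in the type of \<open>P\<close>, so \<open>P\<close> lifts its own identity to a section of \<open>?T \<rightarrow> P\<close>.\<close>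
  have "nat_epi C R ?T P (\<lambda>x a. ?\<kappa> x (?i x a))"
    unfolding nat_epi_def
  proof (intro conjI ballI nat_trans_comp[OF T(3) \<kappa>] equalityI subsetI)
    fix x b assume x: "x \<in> Obj C" and "b \<in> (\<lambda>a. ?\<kappa> x (?i x a)) ` carrier (fobj ?T x)"
    then show "b \<in> carrier (fobj P x)" using nat_trans_closed[OF nat_trans_comp[OF T(3) \<kappa>] x] by auto
  next
    fix x b assume x: "x \<in> Obj C" and b: "b \<in> carrier (fobj P x)"
    let ?g = "free_gen R (x, b, Ident C x)"
    have g: "?g \<in> carrier (fobj ?G x)"
      unfolding fobj_free_functor[OF C R]
      using x b C.Ident_Hom by (intro free_gen_carrier[OF R]) (auto simp: X_def)
    then have "comb R ?g \<in> carrier (fobj ?T x)" and "?i x (comb R ?g) = ?g"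
      using inj by (simp_all add: transport_functor_def transport_module_simps)
    then show "b \<in> (\<lambda>a. ?\<kappa> x (?i x a)) ` carrier (fobj ?T x)"
      using \<kappa>_gen[OF x b] by (metis (no_types, lifting) imageI)
  qed
  then have "\<exists>s. nat_trans C R P ?T s \<and>
      (\<forall>x\<in>Obj C. \<forall>a\<in>carrier (fobj P x). ?\<kappa> x (?i x (s x a)) = (\<lambda>x a. a) x a)"
    using P T(1) Pf nat_trans_id[of C R P] unfolding projective_def by blast
  then obtain s where s: "nat_trans C R P ?T s"
    and s_sec: "\<And>x a. \<lbrakk>x \<in> Obj C; a \<in> carrier (fobj P x)\<rbrakk> \<Longrightarrow> ?\<kappa> x (?i x (s x a)) = a"
    by blast
  obtain m where m: "\<And>c v. \<lbrakk>c \<in> Obj C; v \<in> X c\<rbrakk> \<Longrightarrow> m c v \<in> carrier (fobj N c)"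
    and \<delta>m: "\<And>c v. \<lbrakk>c \<in> Obj C; v \<in> X c\<rbrakk> \<Longrightarrow> \<delta> c (m c v) = \<phi> c v"
  proof -
    have "\<forall>c v. \<exists>b. c \<in> Obj C \<longrightarrow> v \<in> X c \<longrightarrow> b \<in> carrier (fobj N c) \<and> \<delta> c b = \<phi> c v"
      using im unfolding X_def image_iff by metis
    then show ?thesis using that by metis
  qed
  let ?\<mu> = "free_nat C R N m"
  have \<mu>: "nat_trans C R ?G N ?\<mu>" by (rule free_nat_nat_trans[OF C R N m])
  have \<delta>\<mu>: "\<delta> x (?\<mu> x a) = \<phi> x (?\<kappa> x a)" if "x \<in> Obj C" "a \<in> carrier (fobj ?G x)" for x a
  proof (rule free_nat_unique[OF C R M nat_trans_comp[OF \<mu> \<delta>] nat_trans_comp[OF \<kappa> \<phi>] _ that])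
    fix c v assume c: "c \<in> Obj C" and v: "v \<in> X c"
    have "?\<mu> c (free_gen R (c, v, Ident C c)) = m c v"
      using free_nat_gen[OF C R N, of X m c c v "Ident C c"] m c v
      by (simp add: C.Ident_Hom N.fmap_Ident)
    with c v show "\<delta> c (?\<mu> c (free_gen R (c, v, Ident C c))) = \<phi> c (?\<kappa> c (free_gen R (c, v, Ident C c)))"
      by (simp add: \<delta>m \<kappa>_gen X_def)
  qed
  note i = nat_trans_comp[OF s T(3)]
  show ?thesis
  proof
    show "nat_trans C R P N (\<lambda>x a. ?\<mu> x (?i x (s x a)))" by (rule nat_trans_comp[OF i \<mu>])
    show "\<delta> x (?\<mu> x (?i x (s x a))) = \<phi> x a" if "x \<in> Obj C" "a \<in> carrier (fobj P x)" for x a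
      using \<delta>\<mu>[OF that(1) nat_trans_closed[OF i that]] s_sec[OF that] by simp
  qed
qed

section \<open>Resolutions and the comparison theorem\<close>

text \<open>
  A resolution of \<open>F\<close> by arbitrary functors.  Projectivity is kept apart because the pullback of a
  projective resolution along a functor of categories is again exact, but in general no longer
  projective.
\<close>

locale resolution =
  fixes C :: "('o, 'm) category" and R :: "('r, 'x) ring_scheme"
    and F :: "('o, 'm, 'r, 'v) mod_functor"
    and P :: "nat \<Rightarrow> ('o, 'm, 'r, 'w) mod_functor" and d :: "nat \<Rightarrow> 'o \<Rightarrow> 'w \<Rightarrow> 'w"
    and \<epsilon> :: "'o \<Rightarrow> 'w \<Rightarrow> 'v"
  assumes F_functor: "module_functor C R F"
    and P_functor: "module_functor C R (P n)"
    and d_nat: "nat_trans C R (P (Suc n)) (P n) (d n)"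
    and aug_nat: "nat_trans C R (P 0) F \<epsilon>"
    and aug_surj: "\<lbrakk>x \<in> Obj C; b \<in> carrier (fobj F x)\<rbrakk> \<Longrightarrow> b \<in> \<epsilon> x ` carrier (fobj (P 0) x)"
    and aug_d: "\<lbrakk>x \<in> Obj C; a \<in> carrier (fobj (P (Suc 0)) x)\<rbrakk> \<Longrightarrow> \<epsilon> x (d 0 x a) = \<zero>\<^bsub>fobj F x\<^esub>"
    and exact_aug: "\<lbrakk>x \<in> Obj C; a \<in> carrier (fobj (P 0) x); \<epsilon> x a = \<zero>\<^bsub>fobj F x\<^esub>\<rbrakk>
      \<Longrightarrow> a \<in> d 0 x ` carrier (fobj (P (Suc 0)) x)"
    and d_d: "\<lbrakk>x \<in> Obj C; a \<in> carrier (fobj (P (Suc (Suc n))) x)\<rbrakk>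
      \<Longrightarrow> d n x (d (Suc n) x a) = \<zero>\<^bsub>fobj (P n) x\<^esub>"
    and exact: "\<lbrakk>x \<in> Obj C; a \<in> carrier (fobj (P (Suc n)) x); d n x a = \<zero>\<^bsub>fobj (P n) x\<^esub>\<rbrakk>
      \<Longrightarrow> a \<in> d (Suc n) x ` carrier (fobj (P (Suc (Suc n))) x)"

lemma a_kernel_eq: "a_kernel M N h = {a \<in> carrier M. h a = \<zero>\<^bsub>N\<^esub>}"
  by (auto simp: a_kernel_def kernel_def)

lemma projective_resolution_resolution:
  assumes F: "module_functor C R F" and P: "projective_resolution C R F P d \<epsilon>"
  shows "resolution C R F P d \<epsilon>"
proof -
  note P = P[unfolded projective_resolution_def a_kernel_eq One_nat_def]
  have e0: "(a \<in> carrier (fobj (P 0) x) \<and> \<epsilon> x a = \<zero>\<^bsub>fobj F x\<^esub>)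
      \<longleftrightarrow> a \<in> d 0 x ` carrier (fobj (P (Suc 0)) x)" if "x \<in> Obj C" for x a
  proof -
    have "{a \<in> carrier (fobj (P 0) x). \<epsilon> x a = \<zero>\<^bsub>fobj F x\<^esub>} = d 0 x ` carrier (fobj (P (Suc 0)) x)"
      using P that by simp
    then show ?thesis by (simp add: set_eq_iff)
  qed
  have e1: "(a \<in> carrier (fobj (P (Suc n)) x) \<and> d n x a = \<zero>\<^bsub>fobj (P n) x\<^esub>)
      \<longleftrightarrow> a \<in> d (Suc n) x ` carrier (fobj (P (Suc (Suc n))) x)" if "x \<in> Obj C" for n x a
  proof -
    have "{a \<in> carrier (fobj (P (Suc n)) x). d n x a = \<zero>\<^bsub>fobj (P n) x\<^esub>}
        = d (Suc n) x ` carrier (fobj (P (Suc (Suc n))) x)"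
      using P that by simp
    then show ?thesis by (simp add: set_eq_iff)
  qed
  show ?thesis
  proof (rule resolution.intro, goal_cases)
    case (6 x a)
    then show ?case using e0[of x "d 0 x a"] by blast
  next
    case (7 x a)
    then show ?case using e0[of x a] by blast
  next
    case (8 x a n)
    then show ?case using e1[of x "d (Suc n) x a" n] by blast
  next
    case (9 x a n)
    then show ?case using e1[of x a n] by blast
  qed (use P F in \<open>simp_all add: projective_def nat_epi_def\<close>)
qed

definition chain_lift ::
  "('o, 'm) category \<Rightarrow> ('r, 'x) ring_scheme \<Rightarrow>
    (nat \<Rightarrow> ('o, 'm, 'r, 'w) mod_functor) \<Rightarrow> (nat \<Rightarrow> 'o \<Rightarrow> 'w \<Rightarrow> 'w) \<Rightarrow> ('o \<Rightarrow> 'w \<Rightarrow> 'v) \<Rightarrow>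
    (nat \<Rightarrow> ('o, 'm, 'r, 'z) mod_functor) \<Rightarrow> (nat \<Rightarrow> 'o \<Rightarrow> 'z \<Rightarrow> 'z) \<Rightarrow> ('o \<Rightarrow> 'z \<Rightarrow> 'u) \<Rightarrow>
    ('o \<Rightarrow> 'v \<Rightarrow> 'u) \<Rightarrow> (nat \<Rightarrow> 'o \<Rightarrow> 'w \<Rightarrow> 'z) \<Rightarrow> bool"
  where "chain_lift C R P d \<epsilon> Q d' \<epsilon>' \<phi> c \<longleftrightarrow>
    (\<forall>n. nat_trans C R (P n) (Q n) (c n)) \<and>
    (\<forall>x\<in>Obj C. \<forall>a\<in>carrier (fobj (P 0) x). \<epsilon>' x (c 0 x a) = \<phi> x (\<epsilon> x a)) \<and>
    (\<forall>n. \<forall>x\<in>Obj C. \<forall>a\<in>carrier (fobj (P (Suc n)) x). d' n x (c (Suc n) x a) = c n x (d n x a))"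

lemma chain_liftI:
  assumes "\<And>n. nat_trans C R (P n) (Q n) (c n)"
    "\<And>x a. \<lbrakk>x \<in> Obj C; a \<in> carrier (fobj (P 0) x)\<rbrakk> \<Longrightarrow> \<epsilon>' x (c 0 x a) = \<phi> x (\<epsilon> x a)"
    "\<And>n x a. \<lbrakk>x \<in> Obj C; a \<in> carrier (fobj (P (Suc n)) x)\<rbrakk> \<Longrightarrow> d' n x (c (Suc n) x a) = c n x (d n x a)"
  shows "chain_lift C R P d \<epsilon> Q d' \<epsilon>' \<phi> c"
  using assms by (simp add: chain_lift_def)

lemma chain_liftD:
  assumes "chain_lift C R P d \<epsilon> Q d' \<epsilon>' \<phi> c"
  shows "nat_trans C R (P n) (Q n) (c n)"
    "\<lbrakk>x \<in> Obj C; a \<in> carrier (fobj (P 0) x)\<rbrakk> \<Longrightarrow> \<epsilon>' x (c 0 x a) = \<phi> x (\<epsilon> x a)"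
    "\<lbrakk>x \<in> Obj C; a \<in> carrier (fobj (P (Suc n)) x)\<rbrakk> \<Longrightarrow> d' n x (c (Suc n) x a) = c n x (d n x a)"
  using assms by (simp_all add: chain_lift_def)

locale comparison = P: resolution C R F P d \<epsilon> + Q: resolution C R F' Q d' \<epsilon>'
  for C :: "('o, 'm) category" and R :: "('r, 'x) ring_scheme"
    and F :: "('o, 'm, 'r, 'v) mod_functor"
    and P :: "nat \<Rightarrow> ('o, 'm, 'r, 'p) universe_functor" and d \<epsilon>
    and F' :: "('o, 'm, 'r, 'u) mod_functor"
    and Q :: "nat \<Rightarrow> ('o, 'm, 'r, 'z) mod_functor" and d' \<epsilon>' +
  assumes C: "small_category C" and R: "cring R" and P_projective: "projective C R (P n)"
begin

text \<open>
  The components are chosen one after the other.  The invariant that carries the recursion is that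
  \<open>c\<^sub>n \<circ> d\<^sub>n\<close> has its values in the image of \<open>d'\<^sub>n\<close>, which is what the next lift needs.
\<close>

lemma chain_lift_exists:
  assumes \<phi>: "nat_trans C R F F' \<phi>"
  obtains c where "chain_lift C R P d \<epsilon> Q d' \<epsilon>' \<phi> c"
proof -
  define good where "good n c \<longleftrightarrow> nat_trans C R (P n) (Q n) c \<and>
      (\<forall>x\<in>Obj C. \<forall>a\<in>carrier (fobj (P (Suc n)) x). c x (d n x a) \<in> d' n x ` carrier (fobj (Q (Suc n)) x)) \<and>
      (n = 0 \<longrightarrow> (\<forall>x\<in>Obj C. \<forall>a\<in>carrier (fobj (P 0) x). \<epsilon>' x (c x a) = \<phi> x (\<epsilon> x a)))" for n c
  define link where "link n c c' \<longleftrightarrow>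
      (\<forall>x\<in>Obj C. \<forall>a\<in>carrier (fobj (P (Suc n)) x). d' n x (c' x a) = c x (d n x a))" for n c c'
  have "\<exists>f. \<forall>n. good n (f n) \<and> link n (f n) (f (Suc n))"
  proof (rule dependent_nat_choice)
    note \<phi>\<epsilon> = nat_trans_comp[OF P.aug_nat \<phi>]
    obtain c where c: "nat_trans C R (P 0) (Q 0) c"
      "\<And>x a. \<lbrakk>x \<in> Obj C; a \<in> carrier (fobj (P 0) x)\<rbrakk> \<Longrightarrow> \<epsilon>' x (c x a) = \<phi> x (\<epsilon> x a)"
      using projective_lifting[OF C R P_projective[of 0] Q.P_functor[of 0] Q.F_functor Q.aug_nat \<phi>\<epsilon>
        Q.aug_surj[OF _ nat_trans_closed[OF \<phi>\<epsilon>]]] by blast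
    have "c x (d 0 x a) \<in> d' 0 x ` carrier (fobj (Q (Suc 0)) x)"
      if x: "x \<in> Obj C" and a: "a \<in> carrier (fobj (P (Suc 0)) x)" for x a
    proof (rule Q.exact_aug[OF x])
      have da: "d 0 x a \<in> carrier (fobj (P 0) x)" by (rule nat_trans_closed[OF P.d_nat x a])
      show "c x (d 0 x a) \<in> carrier (fobj (Q 0) x)" by (rule nat_trans_closed[OF c(1) x da])
      show "\<epsilon>' x (c x (d 0 x a)) = \<zero>\<^bsub>fobj F' x\<^esub>"
        by (simp add: c(2)[OF x da] P.aug_d[OF x a] nat_trans_zero[OF P.F_functor Q.F_functor \<phi> x])
    qed
    with c show "\<exists>c. good 0 c" by (auto simp: good_def)
  next
    fix c n assume "good n c"
    then have c: "nat_trans C R (P n) (Q n) c"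
      and im: "\<And>x a. \<lbrakk>x \<in> Obj C; a \<in> carrier (fobj (P (Suc n)) x)\<rbrakk>
        \<Longrightarrow> c x (d n x a) \<in> d' n x ` carrier (fobj (Q (Suc n)) x)"
      by (auto simp: good_def)
    obtain c' where c': "nat_trans C R (P (Suc n)) (Q (Suc n)) c'"
      "\<And>x a. \<lbrakk>x \<in> Obj C; a \<in> carrier (fobj (P (Suc n)) x)\<rbrakk> \<Longrightarrow> d' n x (c' x a) = c x (d n x a)"
      using projective_lifting[OF C R P_projective Q.P_functor Q.P_functor Q.d_nat
          nat_trans_comp[OF P.d_nat c] im] by blast
    have "c' x (d (Suc n) x a) \<in> d' (Suc n) x ` carrier (fobj (Q (Suc (Suc n))) x)"
      if x: "x \<in> Obj C" and a: "a \<in> carrier (fobj (P (Suc (Suc n))) x)" for x a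
    proof (rule Q.exact[OF x])
      have da: "d (Suc n) x a \<in> carrier (fobj (P (Suc n)) x)" by (rule nat_trans_closed[OF P.d_nat x a])
      show "c' x (d (Suc n) x a) \<in> carrier (fobj (Q (Suc n)) x)" by (rule nat_trans_closed[OF c'(1) x da])
      show "d' n x (c' x (d (Suc n) x a)) = \<zero>\<^bsub>fobj (Q n) x\<^esub>"
        by (simp add: c'(2)[OF x da] P.d_d[OF x a] nat_trans_zero[OF P.P_functor Q.P_functor c x])
    qed
    with c' show "\<exists>c'. good (Suc n) c' \<and> link n c c'" by (auto simp: good_def link_def)
  qed
  then obtain f where f: "\<And>n. good n (f n)" "\<And>n. link n (f n) (f (Suc n))" by blast
  have "chain_lift C R P d \<epsilon> Q d' \<epsilon>' \<phi> f"
    by (rule chain_liftI) (use f(1) f(1)[of 0] f(2) in \<open>auto simp: good_def link_def\<close>)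
  then show ?thesis by (rule that)
qed

text \<open>
  The difference \<open>e = a - b\<close> covers zero.  The homotopy solves \<open>d' h\<^sub>0 = e\<^sub>0\<close> and
  \<open>d' h\<^sub>n\<^sub>+\<^sub>1 = e\<^sub>n\<^sub>+\<^sub>1 - h\<^sub>n d\<close>; the right-hand sides are cycles of \<open>Q\<close>, hence boundaries.  The conclusion
  is stated with sums, the form in which additive maps transport it.
\<close>

lemma chain_lift_homotopy:
  assumes a: "chain_lift C R P d \<epsilon> Q d' \<epsilon>' \<phi> a" and b: "chain_lift C R P d \<epsilon> Q d' \<epsilon>' \<phi> b"
  obtains h where "\<And>n. nat_trans C R (P n) (Q (Suc n)) (h n)"
    "\<And>x p. \<lbrakk>x \<in> Obj C; p \<in> carrier (fobj (P 0) x)\<rbrakk>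
      \<Longrightarrow> a 0 x p = b 0 x p \<oplus>\<^bsub>fobj (Q 0) x\<^esub> d' 0 x (h 0 x p)"
    "\<And>n x p. \<lbrakk>x \<in> Obj C; p \<in> carrier (fobj (P (Suc n)) x)\<rbrakk>
      \<Longrightarrow> a (Suc n) x p = b (Suc n) x p \<oplus>\<^bsub>fobj (Q (Suc n)) x\<^esub>
        (d' (Suc n) x (h (Suc n) x p) \<oplus>\<^bsub>fobj (Q (Suc n)) x\<^esub> h n x (d n x p))"
proof -
  define e where "e n x p = a n x p \<ominus>\<^bsub>fobj (Q n) x\<^esub> b n x p" for n x p
  note a = chain_liftD[OF a] and b = chain_liftD[OF b]
  have e: "nat_trans C R (P n) (Q n) (e n)" for n
    unfolding e_def by (rule nat_trans_diff[OF P.P_functor Q.P_functor a(1) b(1)])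
  define r where "r n h x p = e (Suc n) x p \<ominus>\<^bsub>fobj (Q (Suc n)) x\<^esub> h x (d n x p)" for n h x p
  have r: "nat_trans C R (P (Suc n)) (Q (Suc n)) (r n h)" if "nat_trans C R (P n) (Q (Suc n)) h" for n h
    unfolding r_def by (rule nat_trans_diff[OF P.P_functor Q.P_functor e nat_trans_comp[OF P.d_nat that]])
  have Qm: "module R (fobj (Q n) x)" if "x \<in> Obj C" for n x
    using Q.P_functor that by (rule module_functor.fobj_module)
  have de: "d' n x (e (Suc n) x p) = e n x (d n x p)"
    if x: "x \<in> Obj C" and p: "p \<in> carrier (fobj (P (Suc n)) x)" for n x p
    unfolding e_def
    using module_hom_minus[OF Qm[OF x] Qm[OF x] nat_transD(1)[OF Q.d_nat x]
        nat_trans_closed[OF a(1) x p] nat_trans_closed[OF b(1) x p]]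
    by (simp add: a(3)[OF x p] b(3)[OF x p])
  define good where "good n h \<longleftrightarrow> nat_trans C R (P n) (Q (Suc n)) h \<and>
      (\<forall>x\<in>Obj C. \<forall>p\<in>carrier (fobj (P (Suc n)) x). r n h x p \<in> d' (Suc n) x ` carrier (fobj (Q (Suc (Suc n))) x)) \<and>
      (n = 0 \<longrightarrow> (\<forall>x\<in>Obj C. \<forall>p\<in>carrier (fobj (P 0) x). d' 0 x (h x p) = e 0 x p))" for n h
  define link where "link n h h' \<longleftrightarrow>
      (\<forall>x\<in>Obj C. \<forall>p\<in>carrier (fobj (P (Suc n)) x). d' (Suc n) x (h' x p) = r n h x p)" for n h h'
  have rim: "r n h x p \<in> d' (Suc n) x ` carrier (fobj (Q (Suc (Suc n))) x)"
    if h: "nat_trans C R (P n) (Q (Suc n)) h" and x: "x \<in> Obj C" and p: "p \<in> carrier (fobj (P (Suc n)) x)"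
      and dh: "d' n x (h x (d n x p)) = e n x (d n x p)" for n h x p
  proof (rule Q.exact[OF x])
    interpret M: module R "fobj (Q n) x" by (rule Qm[OF x])
    show "r n h x p \<in> carrier (fobj (Q (Suc n)) x)" by (rule nat_trans_closed[OF r[OF h] x p])
    have dp: "d n x p \<in> carrier (fobj (P n) x)" by (rule nat_trans_closed[OF P.d_nat x p])
    have "d' n x (r n h x p) = e n x (d n x p) \<ominus>\<^bsub>fobj (Q n) x\<^esub> e n x (d n x p)"
      unfolding r_def
      using module_hom_minus[OF Qm[OF x] Qm[OF x] nat_transD(1)[OF Q.d_nat x]
          nat_trans_closed[OF e x p] nat_trans_closed[OF h x dp]] by (simp add: de[OF x p] dh)
    then show "d' n x (r n h x p) = \<zero>\<^bsub>fobj (Q n) x\<^esub>"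
      using nat_trans_closed[OF e x dp] by (simp add: a_minus_def M.M.r_neg)
  qed
  have "\<exists>h. \<forall>n. good n (h n) \<and> link n (h n) (h (Suc n))"
  proof (rule dependent_nat_choice)
    have im: "e 0 x p \<in> d' 0 x ` carrier (fobj (Q (Suc 0)) x)"
      if x: "x \<in> Obj C" and p: "p \<in> carrier (fobj (P 0) x)" for x p
    proof (rule Q.exact_aug[OF x])
      interpret M: module R "fobj F' x" using Q.F_functor x by (rule module_functor.fobj_module)
      show "e 0 x p \<in> carrier (fobj (Q 0) x)" by (rule nat_trans_closed[OF e x p])
      show "\<epsilon>' x (e 0 x p) = \<zero>\<^bsub>fobj F' x\<^esub>"
        unfolding e_def
        using module_hom_minus[OF Qm[OF x] M.module_axioms nat_transD(1)[OF Q.aug_nat x]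
            nat_trans_closed[OF a(1) x p] nat_trans_closed[OF b(1) x p]]
          nat_trans_closed[OF Q.aug_nat x nat_trans_closed[OF b(1) x p]]
        by (simp add: a(2)[OF x p] b(2)[OF x p] a_minus_def M.M.r_neg)
    qed
    obtain h where h: "nat_trans C R (P 0) (Q (Suc 0)) h"
      "\<And>x p. \<lbrakk>x \<in> Obj C; p \<in> carrier (fobj (P 0) x)\<rbrakk> \<Longrightarrow> d' 0 x (h x p) = e 0 x p"
      using projective_lifting[OF C R P_projective Q.P_functor Q.P_functor Q.d_nat e im] by blast
    then have "good 0 h"
      by (auto simp: good_def intro!: rim nat_trans_closed[OF P.d_nat])
    then show "\<exists>h. good 0 h" by blast
  next
    fix h n assume "good n h"
    then have h: "nat_trans C R (P n) (Q (Suc n)) h"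
      and im: "\<And>x p. \<lbrakk>x \<in> Obj C; p \<in> carrier (fobj (P (Suc n)) x)\<rbrakk>
        \<Longrightarrow> r n h x p \<in> d' (Suc n) x ` carrier (fobj (Q (Suc (Suc n))) x)"
      by (auto simp: good_def)
    obtain h' where h': "nat_trans C R (P (Suc n)) (Q (Suc (Suc n))) h'"
      "\<And>x p. \<lbrakk>x \<in> Obj C; p \<in> carrier (fobj (P (Suc n)) x)\<rbrakk> \<Longrightarrow> d' (Suc n) x (h' x p) = r n h x p"
      using projective_lifting[OF C R P_projective Q.P_functor Q.P_functor Q.d_nat r[OF h] im] by blast
    have "d' (Suc n) x (h' x (d (Suc n) x p)) = e (Suc n) x (d (Suc n) x p)"
      if x: "x \<in> Obj C" and p: "p \<in> carrier (fobj (P (Suc (Suc n))) x)" for x p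
    proof -
      interpret M: module R "fobj (Q (Suc n)) x" by (rule Qm[OF x])
      have dp: "d (Suc n) x p \<in> carrier (fobj (P (Suc n)) x)" by (rule nat_trans_closed[OF P.d_nat x p])
      have "h x (d n x (d (Suc n) x p)) = \<zero>\<^bsub>fobj (Q (Suc n)) x\<^esub>"
        by (simp add: P.d_d[OF x p] nat_trans_zero[OF P.P_functor Q.P_functor h x])
      then show ?thesis
        using nat_trans_closed[OF e x dp] by (simp add: h'(2)[OF x dp] r_def a_minus_def)
    qed
    then have "good (Suc n) h'" using h'(1) by (auto simp: good_def intro!: rim)
    with h'(2) show "\<exists>h'. good (Suc n) h' \<and> link n h h'" by (auto simp: link_def)
  qed
  then obtain h where h: "\<And>n. good n (h n)" "\<And>n. link n (h n) (h (Suc n))" by blast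
  then have hn: "nat_trans C R (P n) (Q (Suc n)) (h n)" for n by (simp add: good_def)
  show ?thesis
  proof (rule that[OF hn])
    fix x p assume x: "x \<in> Obj C" and p: "p \<in> carrier (fobj (P 0) x)"
    interpret M: module R "fobj (Q 0) x" by (rule Qm[OF x])
    have "d' 0 x (h 0 x p) = e 0 x p" using h(1)[of 0] x p by (simp add: good_def)
    then show "a 0 x p = b 0 x p \<oplus>\<^bsub>fobj (Q 0) x\<^esub> d' 0 x (h 0 x p)"
      using nat_trans_closed[OF a(1) x p] nat_trans_closed[OF b(1) x p]
      by (simp add: e_def a_minus_def M.M.a_ac M.M.r_neg M.M.r_neg2)
  next
    fix n x p assume x: "x \<in> Obj C" and p: "p \<in> carrier (fobj (P (Suc n)) x)"
    interpret M: module R "fobj (Q (Suc n)) x" by (rule Qm[OF x])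
    have dp: "d n x p \<in> carrier (fobj (P n) x)" by (rule nat_trans_closed[OF P.d_nat x p])
    have "d' (Suc n) x (h (Suc n) x p) = r n (h n) x p" using h(2)[of n] x p by (simp add: link_def)
    then show "a (Suc n) x p = b (Suc n) x p \<oplus>\<^bsub>fobj (Q (Suc n)) x\<^esub>
        (d' (Suc n) x (h (Suc n) x p) \<oplus>\<^bsub>fobj (Q (Suc n)) x\<^esub> h n x (d n x p))"
      using nat_trans_closed[OF a(1) x p] nat_trans_closed[OF b(1) x p] nat_trans_closed[OF hn x dp]
      by (simp add: r_def e_def a_minus_def M.M.a_assoc M.M.l_neg)
        (simp add: M.M.a_ac M.M.r_neg M.M.r_neg2)
  qed
qed

end

section \<open>Maps out of a colimit\<close>

lemma quotient_desc:
  assumes M: "module R M" and N: "module R N" and H: "submodule H R M"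
    and f: "f \<in> module_hom R M N" and fH: "\<And>h. h \<in> H \<Longrightarrow> f h = \<zero>\<^bsub>N\<^esub>"
  obtains \<kappa> where "\<kappa> \<in> module_hom R (quotient_module M H) N"
    "\<And>x. x \<in> carrier M \<Longrightarrow> \<kappa> (H +>\<^bsub>M\<^esub> x) = f x"
proof -
  interpret M: module R M by fact
  interpret N: module R N by fact
  note hom = module_homD[OF f]
  define \<kappa> where "\<kappa> X = f (SOME x. x \<in> carrier M \<and> X = H +>\<^bsub>M\<^esub> x)" for X
  have \<kappa>: "\<kappa> (H +>\<^bsub>M\<^esub> x) = f x" if x: "x \<in> carrier M" for x
  proof -
    define y where "y = (SOME y. y \<in> carrier M \<and> H +>\<^bsub>M\<^esub> x = H +>\<^bsub>M\<^esub> y)"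
    have y: "y \<in> carrier M \<and> H +>\<^bsub>M\<^esub> x = H +>\<^bsub>M\<^esub> y"
      unfolding y_def by (rule someI[of _ x]) (simp add: x)
    then have "x \<ominus>\<^bsub>M\<^esub> y \<in> H" using module_coset_eq_iff[OF M H x] by blast
    then have "f x \<ominus>\<^bsub>N\<^esub> f y = \<zero>\<^bsub>N\<^esub>"
      using fH module_hom_minus[OF M N f x] y by metis
    moreover have "f x = (f x \<ominus>\<^bsub>N\<^esub> f y) \<oplus>\<^bsub>N\<^esub> f y"
      using hom(1) x y by (simp add: a_minus_def N.M.a_assoc N.M.l_neg)
    ultimately have "f x = f y" using hom(1) y by simp
    then show ?thesis by (simp add: \<kappa>_def y_def)
  qed
  have "\<kappa> \<in> module_hom R (quotient_module M H) N"
    by (rule module_homI)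
      (auto simp: quotient_carrier[OF M H] quotient_add[OF M H] quotient_smult[OF M H] \<kappa> hom)
  then show ?thesis using \<kappa> by (rule that)
qed

lemma direct_sum_simps:
  "g \<in> carrier (direct_sum I M) \<longleftrightarrow>
    g \<in> (\<Pi>\<^sub>E i\<in>I. carrier (M i)) \<and> finite {i \<in> I. g i \<noteq> \<zero>\<^bsub>M i\<^esub>}"
  "\<zero>\<^bsub>direct_sum I M\<^esub> = (\<lambda>i\<in>I. \<zero>\<^bsub>M i\<^esub>)"
  "g \<oplus>\<^bsub>direct_sum I M\<^esub> h = (\<lambda>i\<in>I. g i \<oplus>\<^bsub>M i\<^esub> h i)"
  "r \<odot>\<^bsub>direct_sum I M\<^esub> g = (\<lambda>i\<in>I. r \<odot>\<^bsub>M i\<^esub> g i)"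
  by (simp_all add: direct_sum_def)

context
  fixes R :: "('r, 'x) ring_scheme" and I :: "'i set" and M :: "'i \<Rightarrow> ('r, 'a) module"
  assumes R: "cring R" and M: "\<And>i. i \<in> I \<Longrightarrow> module R (M i)"
begin

lemmas summand_group = module.axioms(2)[OF M]

lemmas summand_monoid = abelian_group.axioms(1)[OF summand_group]

lemmas summand_simps =
  abelian_monoid.zero_closed[OF summand_monoid] abelian_monoid.a_closed[OF summand_monoid]
  abelian_monoid.l_zero[OF summand_monoid] abelian_monoid.r_zero[OF summand_monoid]
  abelian_monoid.a_assoc[OF summand_monoid]
  abelian_group.a_inv_closed[OF summand_group]
  abelian_group.l_neg[OF summand_group]
  module.smult_closed[OF M] module.smult_r_null[OF M] module.smult_l_distr[OF M]
  module.smult_r_distr[OF M] module.smult_assoc1[OF M] module.smult_one[OF M]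

lemma summand_minus_zero: "i \<in> I \<Longrightarrow> \<ominus>\<^bsub>M i\<^esub> \<zero>\<^bsub>M i\<^esub> = \<zero>\<^bsub>M i\<^esub>"
  using summand_simps(4)[of i "\<ominus>\<^bsub>M i\<^esub> \<zero>\<^bsub>M i\<^esub>"] summand_simps(1,6,7) by metis

lemma direct_sum_module: "module R (direct_sum I M)"
proof -
  note [simp] = direct_sum_simps summand_simps summand_minus_zero
  have c: "g i \<in> carrier (M i)" if "g \<in> (\<Pi>\<^sub>E i\<in>I. carrier (M i))" "i \<in> I" for g i
    using that by auto
  have car: "(\<lambda>i\<in>I. e i) \<in> carrier (direct_sum I M)"
    if "g \<in> carrier (direct_sum I M)" "h \<in> carrier (direct_sum I M)" "\<And>i. i \<in> I \<Longrightarrow> e i \<in> carrier (M i)"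
      "\<And>i. \<lbrakk>i \<in> I; g i = \<zero>\<^bsub>M i\<^esub>; h i = \<zero>\<^bsub>M i\<^esub>\<rbrakk> \<Longrightarrow> e i = \<zero>\<^bsub>M i\<^esub>" for e g h
  proof -
    have "finite {i \<in> I. g i \<noteq> \<zero>\<^bsub>M i\<^esub>}" "finite {i \<in> I. h i \<noteq> \<zero>\<^bsub>M i\<^esub>}" using that(1,2) by simp_all
    then have "finite {i \<in> I. (\<lambda>i\<in>I. e i) i \<noteq> \<zero>\<^bsub>M i\<^esub>}"
      by (rule finite_subset[OF _ finite_UnI, rotated]) (use that(4) in auto)
    then show ?thesis using that(3) by simp
  qed
  show ?thesis
  proof (rule moduleI[OF R abelian_groupI], goal_cases)
    case (1 g h)
    then show ?case unfolding direct_sum_simps(3) by (intro car[of g h]) (auto simp: c)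
  next
    case 2
    then show ?case by auto
  next
    case (3 f g h)
    then show ?case by (auto simp: fun_eq_iff c)
  next
    case (4 g h)
    then show ?case by (auto simp: fun_eq_iff c abelian_monoid.a_comm[OF summand_monoid])
  next
    case (5 g)
    then show ?case by (auto simp: fun_eq_iff c PiE_def extensional_def)
  next
    case (6 g)
    then have "(\<lambda>i\<in>I. \<ominus>\<^bsub>M i\<^esub> g i) \<in> carrier (direct_sum I M)"
      by (intro car[of g g]) (auto simp: c)
    moreover have "(\<lambda>i\<in>I. \<ominus>\<^bsub>M i\<^esub> g i) \<oplus>\<^bsub>direct_sum I M\<^esub> g = \<zero>\<^bsub>direct_sum I M\<^esub>"
      using 6 by (auto simp: fun_eq_iff c)
    ultimately show ?case by blast
  next
    case (7 r g)
    then show ?case unfolding direct_sum_simps(4) by (intro car[of g g]) (auto simp: c)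
  qed (auto simp: fun_eq_iff c PiE_def extensional_def)
qed

lemma direct_sum_incl_hom:
  assumes i: "i \<in> I"
  shows "direct_sum_incl I M i \<in> module_hom R (M i) (direct_sum I M)"
proof (rule module_homI)
  fix a assume a: "a \<in> carrier (M i)"
  show "direct_sum_incl I M i a \<in> carrier (direct_sum I M)"
    using i a by (auto simp: direct_sum_simps direct_sum_incl_def summand_simps
      intro: finite_subset[of _ "{i}"] split: if_splits)
  show "direct_sum_incl I M i (a \<oplus>\<^bsub>M i\<^esub> b) =
      direct_sum_incl I M i a \<oplus>\<^bsub>direct_sum I M\<^esub> direct_sum_incl I M i b" for b
    using i by (auto simp: fun_eq_iff direct_sum_simps direct_sum_incl_def summand_simps)
  show "direct_sum_incl I M i (r \<odot>\<^bsub>M i\<^esub> a) = r \<odot>\<^bsub>direct_sum I M\<^esub> direct_sum_incl I M i a"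
    if "r \<in> carrier R" for r
    using i that by (auto simp: fun_eq_iff direct_sum_simps direct_sum_incl_def summand_simps)
qed

text \<open>
  Every element is a finite sum of elements of the summands: adding the entries of \<open>u\<close> one index
  at a time passes from zero to \<open>u\<close>.
\<close>

lemma direct_sum_hom_eqI:
  assumes N: "module R N" and f: "f \<in> module_hom R (direct_sum I M) N" and g: "g \<in> module_hom R (direct_sum I M) N"
    and eq: "\<And>i a. \<lbrakk>i \<in> I; a \<in> carrier (M i)\<rbrakk> \<Longrightarrow> f (direct_sum_incl I M i a) = g (direct_sum_incl I M i a)"
    and u: "u \<in> carrier (direct_sum I M)"
  shows "f u = g u"
proof -
  interpret D: module R "direct_sum I M" by (rule direct_sum_module)
  have ui: "u i \<in> carrier (M i)" if "i \<in> I" for i using u that by (auto simp: direct_sum_simps)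
  let ?u = "\<lambda>T. \<lambda>i\<in>I. if i \<in> T then u i else \<zero>\<^bsub>M i\<^esub>"
  have "?u T \<in> carrier (direct_sum I M) \<and> f (?u T) = g (?u T)" if "finite T" "T \<subseteq> I" for T
    using that
  proof (induction T rule: finite_induct)
    case empty
    have "?u {} = \<zero>\<^bsub>direct_sum I M\<^esub>" by (simp add: direct_sum_simps)
    then show ?case
      using module_hom_zero[OF D.module_axioms N f] module_hom_zero[OF D.module_axioms N g] D.M.zero_closed
      by (simp del: if_False)
  next
    case (insert i T)
    then have i: "i \<in> I" by blast
    have inc: "direct_sum_incl I M i (u i) \<in> carrier (direct_sum I M)"
      by (rule module_homD(1)[OF direct_sum_incl_hom[OF i] ui[OF i]])
    have u_insert: "?u (insert i T) = ?u T \<oplus>\<^bsub>direct_sum I M\<^esub> direct_sum_incl I M i (u i)"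
      using insert(2) i ui by (auto simp: fun_eq_iff direct_sum_simps direct_sum_incl_def summand_simps)
    have uT: "?u T \<in> carrier (direct_sum I M)" and IH: "f (?u T) = g (?u T)"
      using insert.IH insert.prems by blast+
    show ?case
      unfolding u_insert module_homD(2)[OF f uT inc] module_homD(2)[OF g uT inc] IH eq[OF i ui[OF i]]
      using D.M.a_closed[OF uT inc] by blast
  qed
  from this[of "{i \<in> I. u i \<noteq> \<zero>\<^bsub>M i\<^esub>}"] have "f (?u {i \<in> I. u i \<noteq> \<zero>\<^bsub>M i\<^esub>}) = g (?u {i \<in> I. u i \<noteq> \<zero>\<^bsub>M i\<^esub>})"
    using u by (simp add: direct_sum_simps)
  moreover have "?u {i \<in> I. u i \<noteq> \<zero>\<^bsub>M i\<^esub>} = u"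
    using u by (auto simp: fun_eq_iff direct_sum_simps PiE_def extensional_def)
  ultimately show ?thesis by simp
qed

lemma direct_sum_desc:
  assumes N: "module R N" and k: "\<And>i. i \<in> I \<Longrightarrow> k i \<in> module_hom R (M i) N"
  shows "\<exists>f\<in>module_hom R (direct_sum I M) N.
    \<forall>i\<in>I. \<forall>a\<in>carrier (M i). f (direct_sum_incl I M i a) = k i a"
proof -
  interpret N: module R N by fact
  interpret D: module R "direct_sum I M" by (rule direct_sum_module)
  define f where "f u = (\<Oplus>\<^bsub>N\<^esub>i\<in>{i \<in> I. u i \<noteq> \<zero>\<^bsub>M i\<^esub>}. k i (u i))" for u
  have k0: "k i \<zero>\<^bsub>M i\<^esub> = \<zero>\<^bsub>N\<^esub>" if "i \<in> I" for i by (rule module_hom_zero[OF M N k]) (use that in auto)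
  have kc: "k i (u i) \<in> carrier N" if "u \<in> carrier (direct_sum I M)" "i \<in> I" for u i
    using that module_homD(1)[OF k] by (auto simp: direct_sum_simps)
  have f_sup: "f u = (\<Oplus>\<^bsub>N\<^esub>i\<in>T. k i (u i))"
    if "u \<in> carrier (direct_sum I M)" "finite T" "T \<subseteq> I" "{i \<in> I. u i \<noteq> \<zero>\<^bsub>M i\<^esub>} \<subseteq> T" for u T
    unfolding f_def using that kc[OF that(1)] k0
    by (intro N.M.add.finprod_mono_neutral_cong_left) auto
  have "f \<in> module_hom R (direct_sum I M) N"
  proof (rule module_homI)
    fix u assume u: "u \<in> carrier (direct_sum I M)"
    then show "f u \<in> carrier N" unfolding f_def using kc by (intro N.M.finsum_closed) auto
  next
    fix u v assume u: "u \<in> carrier (direct_sum I M)" and v: "v \<in> carrier (direct_sum I M)"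
    let ?T = "{i \<in> I. u i \<noteq> \<zero>\<^bsub>M i\<^esub>} \<union> {i \<in> I. v i \<noteq> \<zero>\<^bsub>M i\<^esub>}"
    have T: "finite ?T" "?T \<subseteq> I" using u v by (auto simp: direct_sum_simps)
      have "f (u \<oplus>\<^bsub>direct_sum I M\<^esub> v) = (\<Oplus>\<^bsub>N\<^esub>i\<in>?T. k i ((u \<oplus>\<^bsub>direct_sum I M\<^esub> v) i))"
      by (rule f_sup[OF D.M.a_closed[OF u v] T]) (auto simp: direct_sum_simps summand_simps)
    also have "\<dots> = (\<Oplus>\<^bsub>N\<^esub>i\<in>?T. k i (u i) \<oplus>\<^bsub>N\<^esub> k i (v i))"
    proof (rule N.M.finsum_cong')
      show "(\<lambda>i. k i (u i) \<oplus>\<^bsub>N\<^esub> k i (v i)) \<in> ?T \<rightarrow> carrier N" using kc u v by auto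
      fix i assume "i \<in> ?T"
      then have i: "i \<in> I" by blast
      then have "u i \<in> carrier (M i)" "v i \<in> carrier (M i)" using u v by (auto simp: direct_sum_simps)
      then show "k i ((u \<oplus>\<^bsub>direct_sum I M\<^esub> v) i) = k i (u i) \<oplus>\<^bsub>N\<^esub> k i (v i)"
        using i by (simp add: direct_sum_simps module_homD(2)[OF k[OF i]])
    qed simp
    also have "\<dots> = (\<Oplus>\<^bsub>N\<^esub>i\<in>?T. k i (u i)) \<oplus>\<^bsub>N\<^esub> (\<Oplus>\<^bsub>N\<^esub>i\<in>?T. k i (v i))"
      using kc u v by (intro N.M.finsum_addf) auto
    also have "\<dots> = f u \<oplus>\<^bsub>N\<^esub> f v" using f_sup[OF u T] f_sup[OF v T] by simp
    finally show "f (u \<oplus>\<^bsub>direct_sum I M\<^esub> v) = f u \<oplus>\<^bsub>N\<^esub> f v" .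
  next
    fix r u assume r: "r \<in> carrier R" and u: "u \<in> carrier (direct_sum I M)"
    let ?T = "{i \<in> I. u i \<noteq> \<zero>\<^bsub>M i\<^esub>}"
    have T: "finite ?T" "?T \<subseteq> I" using u by (auto simp: direct_sum_simps)
    have sub: "{i \<in> I. (r \<odot>\<^bsub>direct_sum I M\<^esub> u) i \<noteq> \<zero>\<^bsub>M i\<^esub>} \<subseteq> ?T"
      using r by (auto simp: direct_sum_simps summand_simps)
    have "f (r \<odot>\<^bsub>direct_sum I M\<^esub> u) = (\<Oplus>\<^bsub>N\<^esub>i\<in>?T. k i ((r \<odot>\<^bsub>direct_sum I M\<^esub> u) i))"
      by (rule f_sup[OF D.smult_closed[OF r u] T sub])
    also have "\<dots> = (\<Oplus>\<^bsub>N\<^esub>i\<in>?T. r \<odot>\<^bsub>N\<^esub> k i (u i))"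
    proof (rule N.M.finsum_cong')
      show "(\<lambda>i. r \<odot>\<^bsub>N\<^esub> k i (u i)) \<in> ?T \<rightarrow> carrier N" using kc u r by auto
      fix i assume "i \<in> ?T"
      then have i: "i \<in> I" by blast
      then have "u i \<in> carrier (M i)" using u by (auto simp: direct_sum_simps)
      then show "k i ((r \<odot>\<^bsub>direct_sum I M\<^esub> u) i) = r \<odot>\<^bsub>N\<^esub> k i (u i)"
        using i r by (simp add: direct_sum_simps module_homD(3)[OF k[OF i]])
    qed simp
    also have "\<dots> = r \<odot>\<^bsub>N\<^esub> f u"
      unfolding f_def using r kc u T by (subst N.finsum_smult_ldistr) auto
    finally show "f (r \<odot>\<^bsub>direct_sum I M\<^esub> u) = r \<odot>\<^bsub>N\<^esub> f u" .
  qed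
  moreover have "f (direct_sum_incl I M i a) = k i a" if i: "i \<in> I" and a: "a \<in> carrier (M i)" for i a
  proof -
    have "f (direct_sum_incl I M i a) = (\<Oplus>\<^bsub>N\<^esub>j\<in>{i}. k j (direct_sum_incl I M i a j))"
      using i by (intro f_sup module_homD(1)[OF direct_sum_incl_hom[OF i] a])
        (auto simp: direct_sum_incl_def split: if_splits)
    then show ?thesis using i a module_homD(1)[OF k[OF i] a] by (simp add: direct_sum_incl_def)
  qed
  ultimately show ?thesis by blast
qed

end

text \<open>
  The canonical map from \<open>F(x)\<close> to the colimit.  Together with \<open>colim_hom_eqI\<close> and \<open>colim_desc\<close>,
  the universal property, it replaces all computations with cosets of families.
\<close>

definition colim_in ::
  "('o, 'm) category \<Rightarrow> ('r, 'x) ring_scheme \<Rightarrow> ('o, 'm, 'r, 'v) mod_functor \<Rightarrow> 'o \<Rightarrow> 'v \<Rightarrow> ('o \<Rightarrow> 'v) set"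
  where "colim_in C R F x a =
    colim_relations C R F +>\<^bsub>direct_sum (Obj C) (fobj F)\<^esub> direct_sum_incl (Obj C) (fobj F) x a"

context
  fixes C :: "('o, 'm) category" and R :: "('r, 'x) ring_scheme" and F :: "('o, 'm, 'r, 'v) mod_functor"
  assumes R: "cring R" and F: "module_functor C R F"
begin

interpretation F: module_functor C R F by (rule F)

private abbreviation (input) "D \<equiv> direct_sum (Obj C) (fobj F)"
private abbreviation (input) "incl \<equiv> direct_sum_incl (Obj C) (fobj F)"
private abbreviation (input) "rels \<equiv> {incl y (fmap F x y f a) \<ominus>\<^bsub>D\<^esub> incl x a | x y f a.
   x \<in> Obj C \<and> y \<in> Obj C \<and> f \<in> Hom C x y \<and> a \<in> carrier (fobj F x)}"

interpretation D: module R D by (rule direct_sum_module[OF R F.fobj_module])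

lemma incl_hom: "x \<in> Obj C \<Longrightarrow> incl x \<in> module_hom R (fobj F x) D"
  by (rule direct_sum_incl_hom[OF R F.fobj_module])

lemma rels_carrier: "rels \<subseteq> carrier D"
proof clarify
  fix x y f a assume xy: "x \<in> Obj C" "y \<in> Obj C" "f \<in> Hom C x y" and a: "a \<in> carrier (fobj F x)"
  show "incl y (fmap F x y f a) \<ominus>\<^bsub>D\<^esub> incl x a \<in> carrier D"
    by (intro D.M.minus_closed module_homD(1)[OF incl_hom] module_homD(1)[OF F.fmap_hom[OF xy]] xy a)
qed

lemma colim_relations_submodule: "submodule (colim_relations C R F) R D"
  unfolding colim_relations_def Let_def by (rule module_span_submodule[OF D.module_axioms rels_carrier])

lemma colim_module: "module R (colim C R F)"
  unfolding colim_def by (rule quotient_module_module[OF D.module_axioms colim_relations_submodule])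

lemma colim_coset_hom: "(\<lambda>u. colim_relations C R F +>\<^bsub>D\<^esub> u) \<in> module_hom R D (colim C R F)"
  unfolding colim_def
  by (rule module_homI)
    (auto simp: quotient_carrier[OF D.module_axioms colim_relations_submodule]
      quotient_add[OF D.module_axioms colim_relations_submodule] quotient_smult[OF D.module_axioms colim_relations_submodule])

lemma colim_in_hom: "x \<in> Obj C \<Longrightarrow> colim_in C R F x \<in> module_hom R (fobj F x) (colim C R F)"
  using module_hom_comp[OF incl_hom colim_coset_hom] by (simp add: colim_in_def[abs_def])

lemma colim_in_fmap:
  assumes "x \<in> Obj C" "y \<in> Obj C" "f \<in> Hom C x y" "a \<in> carrier (fobj F x)"
  shows "colim_in C R F y (fmap F x y f a) = colim_in C R F x a"
proof -
  have "incl y (fmap F x y f a) \<ominus>\<^bsub>D\<^esub> incl x a \<in> rels" using assms by blast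
  then have "incl y (fmap F x y f a) \<ominus>\<^bsub>D\<^esub> incl x a \<in> colim_relations C R F"
    unfolding colim_relations_def Let_def by (rule subsetD[OF module_span_incl])
  moreover have "fmap F x y f a \<in> carrier (fobj F y)"
    using module_homD(1)[OF F.fmap_hom] assms by blast
  ultimately show ?thesis
    using module_homD(1)[OF incl_hom] assms
    by (simp add: colim_in_def module_coset_eq_iff[OF D.module_axioms colim_relations_submodule])
qed

lemma colim_hom_eqI:
  assumes N: "module R N" and f: "f \<in> module_hom R (colim C R F) N" and g: "g \<in> module_hom R (colim C R F) N"
    and eq: "\<And>x a. \<lbrakk>x \<in> Obj C; a \<in> carrier (fobj F x)\<rbrakk> \<Longrightarrow> f (colim_in C R F x a) = g (colim_in C R F x a)"
    and z: "z \<in> carrier (colim C R F)"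
  shows "f z = g z"
proof -
  obtain u where u: "u \<in> carrier D" and zu: "z = colim_relations C R F +>\<^bsub>D\<^esub> u"
    using z by (auto simp: colim_def quotient_carrier[OF D.module_axioms colim_relations_submodule])
  show ?thesis
    unfolding zu
    by (rule direct_sum_hom_eqI[OF R F.fobj_module N module_hom_comp[OF colim_coset_hom f]
          module_hom_comp[OF colim_coset_hom g] _ u])
      (simp_all add: eq[unfolded colim_in_def])
qed

lemma colim_desc:
  assumes N: "module R N" and k: "\<And>x. x \<in> Obj C \<Longrightarrow> k x \<in> module_hom R (fobj F x) N"
    and k_fmap: "\<And>x y f a. \<lbrakk>x \<in> Obj C; y \<in> Obj C; f \<in> Hom C x y; a \<in> carrier (fobj F x)\<rbrakk>
      \<Longrightarrow> k y (fmap F x y f a) = k x a"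
  shows "\<exists>\<kappa>\<in>module_hom R (colim C R F) N.
    \<forall>x\<in>Obj C. \<forall>a\<in>carrier (fobj F x). \<kappa> (colim_in C R F x a) = k x a"
proof -
  interpret N: module R N by fact
  have "\<exists>f\<in>module_hom R D N. \<forall>x\<in>Obj C. \<forall>a\<in>carrier (fobj F x). f (incl x a) = k x a"
    by (rule direct_sum_desc[OF R F.fobj_module N k])
  then obtain f where f: "f \<in> module_hom R D N"
    and f_incl: "\<And>x a. \<lbrakk>x \<in> Obj C; a \<in> carrier (fobj F x)\<rbrakk> \<Longrightarrow> f (incl x a) = k x a"
    by blast
  have z: "submodule {\<zero>\<^bsub>N\<^esub>} R N" by (rule N.submoduleI) auto
  have "rels \<subseteq> {u \<in> carrier D. f u \<in> {\<zero>\<^bsub>N\<^esub>}}"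
  proof
    fix u assume u: "u \<in> rels"
    then obtain x y g a where uu: "u = incl y (fmap F x y g a) \<ominus>\<^bsub>D\<^esub> incl x a"
      and xy: "x \<in> Obj C" "y \<in> Obj C" "g \<in> Hom C x y" and a: "a \<in> carrier (fobj F x)" by blast
    have ga: "fmap F x y g a \<in> carrier (fobj F y)" by (rule module_homD(1)[OF F.fmap_hom[OF xy] a])
    have "f u = k x a \<ominus>\<^bsub>N\<^esub> k x a"
      unfolding uu
      using module_hom_minus[OF D.module_axioms N f module_homD(1)[OF incl_hom[OF xy(2)] ga] module_homD(1)[OF incl_hom[OF xy(1)] a]]
      by (simp add: f_incl xy a ga k_fmap)
    then have "f u = \<zero>\<^bsub>N\<^esub>"
      using module_homD(1)[OF k[OF xy(1)] a] by (simp add: a_minus_def N.M.r_neg)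
    with u rels_carrier show "u \<in> {u \<in> carrier D. f u \<in> {\<zero>\<^bsub>N\<^esub>}}" by blast
  qed
  then have "colim_relations C R F \<subseteq> {u \<in> carrier D. f u \<in> {\<zero>\<^bsub>N\<^esub>}}"
    unfolding colim_relations_def Let_def
    by (rule module_span_minimal[OF vimage_submodule[OF D.module_axioms N f z]])
  then have f0: "\<And>u. u \<in> colim_relations C R F \<Longrightarrow> f u = \<zero>\<^bsub>N\<^esub>" by blast
  obtain \<kappa> where "\<kappa> \<in> module_hom R (quotient_module D (colim_relations C R F)) N"
    "\<And>u. u \<in> carrier D \<Longrightarrow> \<kappa> (colim_relations C R F +>\<^bsub>D\<^esub> u) = f u"
    by (rule quotient_desc[OF D.module_axioms N colim_relations_submodule f f0]) blast+
  then show ?thesis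
    using module_homD(1)[OF incl_hom] f_incl by (auto simp: colim_def colim_in_def intro!: bexI[of _ \<kappa>])
qed

end

lemma colim_map_colim:
  assumes R: "cring R" and F: "module_functor C R F" and G: "module_functor C R G"
    and \<eta>: "nat_trans C R F G \<eta>"
  shows "colim_map C R G \<eta> \<in> module_hom R (colim C R F) (colim C R G)"
    and "\<lbrakk>x \<in> Obj C; a \<in> carrier (fobj F x)\<rbrakk> \<Longrightarrow> colim_map C R G \<eta> (colim_in C R F x a) = colim_in C R G x (\<eta> x a)"
proof -
  interpret F: module_functor C R F by fact
  interpret G: module_functor C R G by fact
  let ?D = "direct_sum (Obj C) (fobj F)" and ?E = "direct_sum (Obj C) (fobj G)"
  let ?\<eta> = "\<lambda>g. \<lambda>x\<in>Obj C. \<eta> x (g x)"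
  have D: "module R ?D" by (rule direct_sum_module[OF R F.fobj_module])
  have E: "module R ?E" by (rule direct_sum_module[OF R G.fobj_module])
  note SF = colim_relations_submodule[OF R F] and SG = colim_relations_submodule[OF R G]
  note hom = module_homD[OF nat_transD(1)[OF \<eta>]]
  have \<eta>0: "\<eta> x \<zero>\<^bsub>fobj F x\<^esub> = \<zero>\<^bsub>fobj G x\<^esub>" if "x \<in> Obj C" for x by (rule nat_trans_zero[OF F G \<eta> that])
  have h: "?\<eta> \<in> module_hom R ?D ?E"
  proof (rule module_homI)
    fix g assume g: "g \<in> carrier ?D"
    then have "finite {x \<in> Obj C. g x \<noteq> \<zero>\<^bsub>fobj F x\<^esub>}" by (simp add: direct_sum_simps)
    then have "finite {x \<in> Obj C. ?\<eta> g x \<noteq> \<zero>\<^bsub>fobj G x\<^esub>}"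
      by (rule rev_finite_subset) (auto simp: \<eta>0)
    with g hom(1) show "?\<eta> g \<in> carrier ?E" by (auto simp: direct_sum_simps)
  next
    fix g h assume "g \<in> carrier ?D" "h \<in> carrier ?D"
    then show "?\<eta> (g \<oplus>\<^bsub>?D\<^esub> h) = ?\<eta> g \<oplus>\<^bsub>?E\<^esub> ?\<eta> h"
      by (auto simp: fun_eq_iff direct_sum_simps PiE_iff hom(2))
  next
    fix r g assume "r \<in> carrier R" "g \<in> carrier ?D"
    then show "?\<eta> (r \<odot>\<^bsub>?D\<^esub> g) = r \<odot>\<^bsub>?E\<^esub> ?\<eta> g"
      by (auto simp: fun_eq_iff direct_sum_simps PiE_iff hom(3))
  qed
  have inc: "?\<eta> (direct_sum_incl (Obj C) (fobj F) x a) = direct_sum_incl (Obj C) (fobj G) x (\<eta> x a)"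
    if "x \<in> Obj C" for x a
    using that by (auto simp: fun_eq_iff direct_sum_incl_def \<eta>0)
  have "colim_relations C R F \<subseteq> {u \<in> carrier ?D. ?\<eta> u \<in> colim_relations C R G}"
    unfolding colim_relations_def[of C R F] Let_def
  proof (rule module_span_minimal[OF vimage_submodule[OF D E h SG]], rule subsetI)
    fix u assume "u \<in> {direct_sum_incl (Obj C) (fobj F) y (fmap F x y f a) \<ominus>\<^bsub>?D\<^esub> direct_sum_incl (Obj C) (fobj F) x a |x y f a.
           x \<in> Obj C \<and> y \<in> Obj C \<and> f \<in> Hom C x y \<and> a \<in> carrier (fobj F x)}"
    then obtain x y f a where u: "u = direct_sum_incl (Obj C) (fobj F) y (fmap F x y f a) \<ominus>\<^bsub>?D\<^esub> direct_sum_incl (Obj C) (fobj F) x a"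
      and xy: "x \<in> Obj C" "y \<in> Obj C" "f \<in> Hom C x y" and a: "a \<in> carrier (fobj F x)" by blast
    have fa: "fmap F x y f a \<in> carrier (fobj F y)" by (rule module_homD(1)[OF F.fmap_hom[OF xy] a])
    note i1 = module_homD(1)[OF incl_hom[OF R F xy(2)] fa] and i2 = module_homD(1)[OF incl_hom[OF R F xy(1)] a]
    have "?\<eta> u = direct_sum_incl (Obj C) (fobj G) y (fmap G x y f (\<eta> x a)) \<ominus>\<^bsub>?E\<^esub> direct_sum_incl (Obj C) (fobj G) x (\<eta> x a)"
      unfolding u module_hom_minus[OF D E h i1 i2] inc[OF xy(1)] inc[OF xy(2)]
      by (simp add: nat_transD(2)[OF \<eta> xy a])
    also have "\<dots> \<in> colim_relations C R G"
      unfolding colim_relations_def Let_def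
      by (rule subsetD[OF module_span_incl]) (use xy hom(1)[OF xy(1) a] in blast)
    finally have "?\<eta> u \<in> colim_relations C R G" .
    moreover have "u \<in> carrier ?D"
      unfolding u using i1 i2 abelian_group.minus_closed[OF module.axioms(2)[OF D]] by blast
    ultimately show "u \<in> {u \<in> carrier ?D. ?\<eta> u \<in> colim_relations C R G}" by blast
  qed
  then have sub: "?\<eta> ` colim_relations C R F \<subseteq> colim_relations C R G" by blast
  show "colim_map C R G \<eta> \<in> module_hom R (colim C R F) (colim C R G)"
    unfolding colim_map_def colim_def by (rule induced_map_hom[OF D E h SF SG sub])
  show "colim_map C R G \<eta> (colim_in C R F x a) = colim_in C R G x (\<eta> x a)"
    if x: "x \<in> Obj C" and a: "a \<in> carrier (fobj F x)"
    unfolding colim_map_def colim_in_def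
      induced_map_coset[OF D E h SF SG sub module_homD(1)[OF incl_hom[OF R F x] a]] inc[OF x] ..
qed

section \<open>Chain maps that are mutually inverse up to boundaries\<close>

lemma module_hom_add:
  assumes N: "module R N" and f: "f \<in> module_hom R M N" and g: "g \<in> module_hom R M N"
  shows "(\<lambda>x. f x \<oplus>\<^bsub>N\<^esub> g x) \<in> module_hom R M N"
proof -
  interpret N: module R N by fact
  note f = module_homD[OF f] and g = module_homD[OF g]
  show ?thesis
    by (rule module_homI) (simp_all add: f g N.M.a_ac N.smult_r_distr)
qed

lemma module_hom_const_zero:
  assumes N: "module R N"
  shows "(\<lambda>x. \<zero>\<^bsub>N\<^esub>) \<in> module_hom R M N"
proof -
  interpret N: module R N by fact
  show ?thesis by (rule module_homI) simp_all
qed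

lemma module_hom_id: "(\<lambda>x. x) \<in> module_hom R M M"
  by (rule module_homI) simp_all

locale chain_complex =
  fixes R :: "('r, 'x) ring_scheme" and X :: "nat \<Rightarrow> ('r, 'a) module" and d :: "nat \<Rightarrow> 'a \<Rightarrow> 'a"
  assumes X_module: "module R (X n)"
    and d_hom: "d n \<in> module_hom R (X (Suc n)) (X n)"
    and d_d: "z \<in> carrier (X (Suc (Suc n))) \<Longrightarrow> d n (d (Suc n) z) = \<zero>\<^bsub>X n\<^esub>"
begin

abbreviation "Z n \<equiv> X n\<lparr>carrier := cycles X d n\<rparr>"
abbreviation "B n \<equiv> boundaries X d n"

lemma cycles_0: "cycles X d 0 = carrier (X 0)" by (simp add: cycles_def)

lemma cycles_Suc: "cycles X d (Suc n) = {z \<in> carrier (X (Suc n)). d n z = \<zero>\<^bsub>X n\<^esub>}"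
  by (simp add: cycles_def a_kernel_eq)

lemma cycles_carrier: "z \<in> cycles X d n \<Longrightarrow> z \<in> carrier (X n)"
  by (cases n) (simp_all add: cycles_0 cycles_Suc)

lemma cycles_submodule: "submodule (cycles X d n) R (X n)"
proof (cases n)
  case 0
  then show ?thesis using module.carrier_is_submodule[OF X_module[of 0]] by (simp add: cycles_0)
next
  case (Suc m)
  interpret M: module R "X m" by (rule X_module)
  have "submodule {\<zero>\<^bsub>X m\<^esub>} R (X m)" by (rule M.submoduleI) auto
  from vimage_submodule[OF X_module M.module_axioms d_hom this]
  show ?thesis by (simp add: Suc cycles_Suc)
qed

lemma Z_module: "module R (Z n)"
  by (rule submodule.submodule_is_module[OF cycles_submodule X_module])

lemma boundaries_cycles: "b \<in> B n \<Longrightarrow> b \<in> cycles X d n"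
  using module_homD(1)[OF d_hom]
  by (cases n) (auto simp: boundaries_def cycles_0 cycles_Suc d_d)

lemma boundaries_submodule: "submodule (B n) R (Z n)"
proof -
  interpret X: module R "X (Suc n)" by (rule X_module)
  interpret Z: module R "Z n" by (rule Z_module)
  have smult: "r \<odot>\<^bsub>X n\<^esub> b \<in> B n" if r: "r \<in> carrier R" and b: "b \<in> B n" for r b
  proof -
    obtain u where "u \<in> carrier (X (Suc n))" "b = d n u" using b by (auto simp: boundaries_def)
    then show ?thesis
      using r module_homD(3)[OF d_hom, of r u n]
      by (auto simp: boundaries_def intro!: image_eqI[of _ _ "r \<odot>\<^bsub>X (Suc n)\<^esub> u"])
  qed
  have car: "B n \<subseteq> carrier (Z n)" by (auto intro: boundaries_cycles)
  show ?thesis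
  proof (rule Z.submoduleI[OF car])
    have "\<zero>\<^bsub>X n\<^esub> = d n \<zero>\<^bsub>X (Suc n)\<^esub>" using module_hom_zero[OF X_module X_module d_hom] by simp
    then show "\<zero>\<^bsub>Z n\<^esub> \<in> B n" by (auto simp: boundaries_def)
  next
    fix b assume b: "b \<in> B n"
    then have bZ: "b \<in> carrier (Z n)" using car by blast
    \<comment> \<open>An inverse in \<open>Z n\<close> is not visibly the inverse in \<open>X n\<close>; scalar multiplication by \<open>-1\<close> is the same in both.\<close>
    have "\<ominus>\<^bsub>Z n\<^esub> b = (\<ominus>\<^bsub>R\<^esub> \<one>\<^bsub>R\<^esub>) \<odot>\<^bsub>Z n\<^esub> b"
      using bZ Z.smult_l_minus[OF _ bZ, of "\<one>\<^bsub>R\<^esub>"] Z.smult_one[OF bZ] by simp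
    then show "\<ominus>\<^bsub>Z n\<^esub> b \<in> B n" using smult[OF _ b, of "\<ominus>\<^bsub>R\<^esub> \<one>\<^bsub>R\<^esub>"] by simp
  next
    fix b c assume "b \<in> B n" "c \<in> B n"
    then obtain u v where "u \<in> carrier (X (Suc n))" "v \<in> carrier (X (Suc n))" "b = d n u" "c = d n v"
      by (auto simp: boundaries_def)
    then show "b \<oplus>\<^bsub>Z n\<^esub> c \<in> B n"
      using module_homD(2)[OF d_hom, of u n v] by (auto simp: boundaries_def intro!: image_eqI[of _ _ "u \<oplus>\<^bsub>X (Suc n)\<^esub> v"])
  qed (use smult in simp)
qed

text \<open>
  Subtraction in the module of cycles is a priori another operation than in the ambient module,
  since inverses refer to the carrier.  For this reason homologous cycles are written as \<open>z\<close> and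
  \<open>z + b\<close> here and below.
\<close>

lemma coset_add_boundary:
  assumes z: "z \<in> cycles X d n" and b: "b \<in> B n"
  shows "B n +>\<^bsub>Z n\<^esub> (z \<oplus>\<^bsub>X n\<^esub> b) = B n +>\<^bsub>Z n\<^esub> z"
proof -
  interpret Z: module R "Z n" by (rule Z_module)
  have zb: "z \<in> carrier (Z n)" "b \<in> carrier (Z n)" using z boundaries_cycles[OF b] by simp_all
  have "(z \<oplus>\<^bsub>Z n\<^esub> b) \<ominus>\<^bsub>Z n\<^esub> z = b"
    using zb by (simp only: a_minus_def Z.M.a_ac Z.M.a_closed Z.M.a_inv_closed Z.M.r_neg Z.M.r_neg2 Z.M.r_zero)
  then show ?thesis
    using module_coset_eq_iff[OF Z_module boundaries_submodule, of "z \<oplus>\<^bsub>Z n\<^esub> b" n z] zb b Z.M.a_closed[OF zb]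
    by simp
qed

end

lemma chain_map_cycles:
  assumes X: "chain_complex R X d" and Y: "chain_complex R Y e"
    and \<alpha>: "\<And>n. \<alpha> n \<in> module_hom R (X n) (Y n)"
    and \<alpha>_d: "\<And>n z. z \<in> carrier (X (Suc n)) \<Longrightarrow> \<alpha> n (d n z) = e n (\<alpha> (Suc n) z)"
  shows "\<alpha> n \<in> module_hom R (X n\<lparr>carrier := cycles X d n\<rparr>) (Y n\<lparr>carrier := cycles Y e n\<rparr>)"
    and "\<alpha> n ` boundaries X d n \<subseteq> boundaries Y e n"
proof -
  interpret X: chain_complex R X d by fact
  interpret Y: chain_complex R Y e by fact
  have "\<alpha> n z \<in> cycles Y e n" if z: "z \<in> cycles X d n" for z
  proof (cases n)
    case 0
    then show ?thesis using z module_homD(1)[OF \<alpha>[of 0]] by (simp add: X.cycles_0 Y.cycles_0)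
  next
    case (Suc m)
    then have "z \<in> carrier (X (Suc m))" "d m z = \<zero>\<^bsub>X m\<^esub>" using z by (simp_all add: X.cycles_Suc)
    then show ?thesis
      using module_homD(1)[OF \<alpha>] \<alpha>_d[of z m] module_hom_zero[OF X.X_module Y.X_module \<alpha>]
      by (simp add: Suc Y.cycles_Suc)
  qed
  then show "\<alpha> n \<in> module_hom R (X n\<lparr>carrier := cycles X d n\<rparr>) (Y n\<lparr>carrier := cycles Y e n\<rparr>)"
    by (intro module_homI) (simp_all add: X.cycles_carrier module_homD(2,3)[OF \<alpha>])
  show "\<alpha> n ` boundaries X d n \<subseteq> boundaries Y e n"
    using module_homD(1)[OF \<alpha>] \<alpha>_d by (auto simp: boundaries_def)
qed

text \<open>
  A chain homotopy enters only through its consequence on cycles: \<open>\<beta> \<circ> \<alpha>\<close> and \<open>\<alpha> \<circ> \<beta>\<close> move a cycle by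
  a boundary.
\<close>

lemma homology_isomorphic:
  assumes X: "chain_complex R X d" and Y: "chain_complex R Y e"
    and \<alpha>: "\<And>n. \<alpha> n \<in> module_hom R (X n) (Y n)" and \<beta>: "\<And>n. \<beta> n \<in> module_hom R (Y n) (X n)"
    and \<alpha>_d: "\<And>n z. z \<in> carrier (X (Suc n)) \<Longrightarrow> \<alpha> n (d n z) = e n (\<alpha> (Suc n) z)"
    and \<beta>_e: "\<And>n z. z \<in> carrier (Y (Suc n)) \<Longrightarrow> \<beta> n (e n z) = d n (\<beta> (Suc n) z)"
    and \<beta>\<alpha>: "\<And>n z. z \<in> cycles X d n \<Longrightarrow> \<exists>b\<in>boundaries X d n. \<beta> n (\<alpha> n z) = z \<oplus>\<^bsub>X n\<^esub> b"
    and \<alpha>\<beta>: "\<And>n z. z \<in> cycles Y e n \<Longrightarrow> \<exists>b\<in>boundaries Y e n. \<alpha> n (\<beta> n z) = z \<oplus>\<^bsub>Y n\<^esub> b"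
  shows "module_isomorphic R (homology X d n) (homology Y e n)"
proof -
  interpret X: chain_complex R X d by fact
  interpret Y: chain_complex R Y e by fact
  have \<alpha>Z: "\<alpha> n \<in> module_hom R (X.Z n) (Y.Z n)" "\<alpha> n ` X.B n \<subseteq> Y.B n"
    using chain_map_cycles[where \<alpha> = \<alpha>, OF X Y \<alpha> \<alpha>_d] by blast+
  have \<beta>Z: "\<beta> n \<in> module_hom R (Y.Z n) (X.Z n)" "\<beta> n ` Y.B n \<subseteq> X.B n"
    using chain_map_cycles[where \<alpha> = \<beta>, OF Y X \<beta> \<beta>_e] by blast+
  let ?\<alpha> = "induced_map (Y.Z n) (Y.B n) (\<alpha> n)" and ?\<beta> = "induced_map (X.Z n) (X.B n) (\<beta> n)"
  have hom: "?\<alpha> \<in> module_hom R (homology X d n) (homology Y e n)"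
    unfolding homology_def
    by (rule induced_map_hom[OF X.Z_module[of n] Y.Z_module[of n] \<alpha>Z(1) X.boundaries_submodule[of n] Y.boundaries_submodule[of n] \<alpha>Z(2)])
  have hom': "?\<beta> \<in> module_hom R (homology Y e n) (homology X d n)"
    unfolding homology_def
    by (rule induced_map_hom[OF Y.Z_module[of n] X.Z_module[of n] \<beta>Z(1) Y.boundaries_submodule[of n] X.boundaries_submodule[of n] \<beta>Z(2)])
  note coset = induced_map_coset[OF X.Z_module[of n] Y.Z_module[of n] \<alpha>Z(1) X.boundaries_submodule[of n] Y.boundaries_submodule[of n] \<alpha>Z(2)]
    induced_map_coset[OF Y.Z_module[of n] X.Z_module[of n] \<beta>Z(1) Y.boundaries_submodule[of n] X.boundaries_submodule[of n] \<beta>Z(2)]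
  note car = quotient_carrier[OF X.Z_module X.boundaries_submodule, of n]
    quotient_carrier[OF Y.Z_module Y.boundaries_submodule, of n]
  have "bij_betw ?\<alpha> (carrier (homology X d n)) (carrier (homology Y e n))"
  proof (rule bij_betw_byWitness[where f' = ?\<beta>])
    show "\<forall>c\<in>carrier (homology X d n). ?\<beta> (?\<alpha> c) = c"
    proof
      fix c assume "c \<in> carrier (homology X d n)"
      then obtain z where z: "z \<in> carrier (X.Z n)" and c: "c = X.B n +>\<^bsub>X.Z n\<^esub> z"
        unfolding homology_def car by blast
      obtain b where b: "b \<in> X.B n" "\<beta> n (\<alpha> n z) = z \<oplus>\<^bsub>X n\<^esub> b" using \<beta>\<alpha>[of z n] z by auto
      show "?\<beta> (?\<alpha> c) = c"
        unfolding c coset(1)[OF z] coset(2)[OF module_homD(1)[OF \<alpha>Z(1) z]] b(2)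
        by (rule X.coset_add_boundary) (use z b(1) in simp_all)
    qed
    show "\<forall>c\<in>carrier (homology Y e n). ?\<alpha> (?\<beta> c) = c"
    proof
      fix c assume "c \<in> carrier (homology Y e n)"
      then obtain z where z: "z \<in> carrier (Y.Z n)" and c: "c = Y.B n +>\<^bsub>Y.Z n\<^esub> z"
        unfolding homology_def car by blast
      obtain b where b: "b \<in> Y.B n" "\<alpha> n (\<beta> n z) = z \<oplus>\<^bsub>Y n\<^esub> b" using \<alpha>\<beta>[of z n] z by auto
      show "?\<alpha> (?\<beta> c) = c"
        unfolding c coset(2)[OF z] coset(1)[OF module_homD(1)[OF \<beta>Z(1) z]] b(2)
        by (rule Y.coset_add_boundary) (use z b(1) in simp_all)
    qed
  qed (use module_homD(1)[OF hom] module_homD(1)[OF hom'] in auto)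
  with hom show ?thesis unfolding module_isomorphic_def by blast
qed

section \<open>Functors between categories\<close>

locale cat_functor =
  fixes C :: "('o, 'm) category" and D :: "('p, 'n) category"
    and fo :: "'o \<Rightarrow> 'p" and fm :: "'o \<Rightarrow> 'o \<Rightarrow> 'm \<Rightarrow> 'n"
  assumes fo_Obj: "x \<in> Obj C \<Longrightarrow> fo x \<in> Obj D"
    and fm_Hom: "\<lbrakk>x \<in> Obj C; y \<in> Obj C; f \<in> Hom C x y\<rbrakk> \<Longrightarrow> fm x y f \<in> Hom D (fo x) (fo y)"
    and fm_Ident: "x \<in> Obj C \<Longrightarrow> fm x x (Ident C x) = Ident D (fo x)"
    and fm_Comp: "\<lbrakk>x \<in> Obj C; y \<in> Obj C; z \<in> Obj C; f \<in> Hom C x y; g \<in> Hom C y z\<rbrakk>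
      \<Longrightarrow> fm x z (Comp C x y z g f) = Comp D (fo x) (fo y) (fo z) (fm y z g) (fm x y f)"

lemma cat_functor_comp:
  assumes "cat_functor C D fo fm" "cat_functor D E go gm"
  shows "cat_functor C E (\<lambda>x. go (fo x)) (\<lambda>x y f. gm (fo x) (fo y) (fm x y f))"
proof -
  interpret f: cat_functor C D fo fm by fact
  interpret g: cat_functor D E go gm by fact
  show ?thesis
    by standard (simp_all add: f.fo_Obj f.fm_Hom f.fm_Ident f.fm_Comp g.fo_Obj g.fm_Hom g.fm_Ident g.fm_Comp)
qed

definition pullback ::
  "('o \<Rightarrow> 'p) \<Rightarrow> ('o \<Rightarrow> 'o \<Rightarrow> 'm \<Rightarrow> 'n) \<Rightarrow> ('p, 'n, 'r, 'v) mod_functor \<Rightarrow> ('o, 'm, 'r, 'v) mod_functor"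
  where "pullback fo fm F =
    \<lparr>fobj = (\<lambda>x. fobj F (fo x)), fmap = (\<lambda>x y f. fmap F (fo x) (fo y) (fm x y f))\<rparr>"

lemma pullback_simps [simp]:
  "fobj (pullback fo fm F) x = fobj F (fo x)"
  "fmap (pullback fo fm F) x y f = fmap F (fo x) (fo y) (fm x y f)"
  by (simp_all add: pullback_def)

lemma pullback_pullback:
  "pullback fo fm (pullback go gm F) = pullback (\<lambda>x. go (fo x)) (\<lambda>x y f. gm (fo x) (fo y) (fm x y f)) F"
  by (simp add: pullback_def)

context cat_functor
begin

lemma pullback_functor:
  assumes "module_functor D R F"
  shows "module_functor C R (pullback fo fm F)"
proof -
  interpret F: module_functor D R F by fact
  show ?thesis
    by (rule module_functor.intro)
      (simp_all add: fo_Obj fm_Hom fm_Ident fm_Comp F.fobj_module F.fmap_hom F.fmap_Ident F.fmap_Comp)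
qed

lemma pullback_nat_trans:
  assumes "nat_trans D R F G \<eta>"
  shows "nat_trans C R (pullback fo fm F) (pullback fo fm G) (\<lambda>x. \<eta> (fo x))"
  by (rule nat_transI) (simp_all add: nat_transD[OF assms] fo_Obj fm_Hom)

lemma pullback_resolution:
  assumes "resolution D R F P d \<epsilon>"
  shows "resolution C R (pullback fo fm F) (\<lambda>n. pullback fo fm (P n)) (\<lambda>n x. d n (fo x)) (\<lambda>x. \<epsilon> (fo x))"
proof -
  interpret resolution D R F P d \<epsilon> by fact
  show ?thesis
    by (rule resolution.intro)
      (simp_all add: pullback_functor pullback_nat_trans F_functor P_functor d_nat aug_nat fo_Obj
        aug_surj aug_d exact_aug d_d exact)
qed

lemma colim_along:
  assumes R: "cring R" and F: "module_functor C R F" and G: "module_functor D R G"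
    and \<eta>: "nat_trans C R F (pullback fo fm G) \<eta>"
  shows "\<exists>\<kappa>\<in>module_hom R (colim C R F) (colim D R G).
    \<forall>x\<in>Obj C. \<forall>a\<in>carrier (fobj F x). \<kappa> (colim_in C R F x a) = colim_in D R G (fo x) (\<eta> x a)"
proof (rule colim_desc[OF R F colim_module[OF R G]])
  fix x assume x: "x \<in> Obj C"
  show "(\<lambda>a. colim_in D R G (fo x) (\<eta> x a)) \<in> module_hom R (fobj F x) (colim D R G)"
    using module_hom_comp[OF nat_transD(1)[OF \<eta> x], of "colim_in D R G (fo x)"] colim_in_hom[OF R G fo_Obj[OF x]]
    by simp
  fix y f a assume y: "y \<in> Obj C" and f: "f \<in> Hom C x y" and a: "a \<in> carrier (fobj F x)"
  show "colim_in D R G (fo y) (\<eta> y (fmap F x y f a)) = colim_in D R G (fo x) (\<eta> x a)"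
    using colim_in_fmap[OF R G fo_Obj[OF x] fo_Obj[OF y] fm_Hom[OF x y f], of "\<eta> x a"]
      nat_trans_closed[OF \<eta> x a] nat_transD(2)[OF \<eta> x y f a] by simp
qed

end

lemma colim_chain_complex:
  assumes R: "cring R" and P: "resolution C R F P d \<epsilon>"
  shows "chain_complex R (\<lambda>n. colim C R (P n)) (\<lambda>n. colim_map C R (P n) (d n))"
proof -
  interpret resolution C R F P d \<epsilon> by fact
  note dm = colim_map_colim[OF R P_functor P_functor d_nat]
  show ?thesis
  proof (rule chain_complex.intro)
    fix n z assume z: "z \<in> carrier (colim C R (P (Suc (Suc n))))"
    show "colim_map C R (P n) (d n) (colim_map C R (P (Suc n)) (d (Suc n)) z) = \<zero>\<^bsub>colim C R (P n)\<^esub>"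
    proof (rule colim_hom_eqI[OF R P_functor colim_module[OF R P_functor]
          module_hom_comp[OF dm(1) dm(1)] module_hom_const_zero[OF colim_module[OF R P_functor]] _ z])
      fix x a assume xa: "x \<in> Obj C" "a \<in> carrier (fobj (P (Suc (Suc n))) x)"
      show "colim_map C R (P n) (d n) (colim_map C R (P (Suc n)) (d (Suc n)) (colim_in C R (P (Suc (Suc n))) x a)) =
          \<zero>\<^bsub>colim C R (P n)\<^esub>"
        using module_hom_zero[OF module_functor.fobj_module[OF P_functor xa(1)] colim_module[OF R P_functor]
            colim_in_hom[OF R P_functor xa(1)], of n]
        by (simp add: dm(2) xa nat_trans_closed[OF d_nat] d_d)
    qed
  qed (rule colim_module[OF R P_functor] dm(1))+
qed

text \<open>
  An endofunctor \<open>S\<close> with a natural transformation \<open>\<tau>\<close> from the identity to \<open>S\<close>.  In the colimit of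
  \<open>F\<close>, an element \<open>a \<in> F(x)\<close> and its image \<open>F(\<tau>\<^sub>x)(a) \<in> F(S x)\<close> become equal, so \<open>F(\<tau>)\<close> induces
  the identity of the colimit.
\<close>

locale pointed_endofunctor = small_category C + S: cat_functor C C so sm
  for C :: "('o, 'm) category" and so sm +
  fixes \<tau> :: "'o \<Rightarrow> 'm"
  assumes \<tau>_Hom: "x \<in> Obj C \<Longrightarrow> \<tau> x \<in> Hom C x (so x)"
    and \<tau>_nat: "\<lbrakk>x \<in> Obj C; y \<in> Obj C; f \<in> Hom C x y\<rbrakk>
      \<Longrightarrow> Comp C x (so x) (so y) (sm x y f) (\<tau> x) = Comp C x y (so y) (\<tau> y) f"
begin

lemma unit_nat_trans:
  assumes "module_functor C R F"
  shows "nat_trans C R F (pullback so sm F) (\<lambda>x. fmap F x (so x) (\<tau> x))"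
proof -
  interpret F: module_functor C R F by fact
  show ?thesis
  proof (rule nat_transI)
    fix x assume "x \<in> Obj C"
    then show "fmap F x (so x) (\<tau> x) \<in> module_hom R (fobj F x) (fobj (pullback so sm F) x)"
      by (simp add: F.fmap_hom S.fo_Obj \<tau>_Hom)
  next
    fix x y f a assume "x \<in> Obj C" "y \<in> Obj C" "f \<in> Hom C x y" "a \<in> carrier (fobj F x)"
    then show "fmap F y (so y) (\<tau> y) (fmap F x y f a) = fmap (pullback so sm F) x y f (fmap F x (so x) (\<tau> x) a)"
      using F.fmap_Comp[of x y "so y" f "\<tau> y" a] F.fmap_Comp[of x "so x" "so y" "\<tau> x" "sm x y f" a]
      by (simp add: S.fo_Obj S.fm_Hom \<tau>_Hom \<tau>_nat)
  qed
qed

lemma unit_chain_lift: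
  assumes P: "resolution C R F P d \<epsilon>"
    and \<phi>: "\<And>x a. \<lbrakk>x \<in> Obj C; a \<in> carrier (fobj F x)\<rbrakk> \<Longrightarrow> \<phi> x a = fmap F x (so x) (\<tau> x) a"
  shows "chain_lift C R P d \<epsilon> (\<lambda>n. pullback so sm (P n)) (\<lambda>n x. d n (so x)) (\<lambda>x. \<epsilon> (so x)) \<phi>
    (\<lambda>n x. fmap (P n) x (so x) (\<tau> x))"
proof -
  interpret resolution C R F P d \<epsilon> by fact
  show ?thesis
    by (rule chain_liftI)
      (simp_all add: unit_nat_trans P_functor nat_transD(2)[OF aug_nat] nat_transD(2)[OF d_nat]
        nat_trans_closed[OF aug_nat] \<phi> S.fo_Obj \<tau>_Hom)
qed

text \<open>
  Both \<open>c\<close> and \<open>P(\<tau>)\<close> are chain maps from \<open>P\<close> to its pullback along \<open>S\<close> that cover the same map, so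
  they are homotopic.  On colimits \<open>P(\<tau>)\<close> induces the identity, and the homotopy induces one
  between the identity and the map \<open>K\<close> induced by \<open>c\<close>.
\<close>

lemma chain_lift_colim_cycles:
  fixes P :: "nat \<Rightarrow> ('o, 'm, 'r, 'v) universe_functor"
  assumes R: "cring R" and P: "resolution C R F P d \<epsilon>" and proj: "\<And>n. projective C R (P n)"
    and \<phi>: "\<And>x a. \<lbrakk>x \<in> Obj C; a \<in> carrier (fobj F x)\<rbrakk> \<Longrightarrow> \<phi> x a = fmap F x (so x) (\<tau> x) a"
    and c: "chain_lift C R P d \<epsilon> (\<lambda>n. pullback so sm (P n)) (\<lambda>n x. d n (so x)) (\<lambda>x. \<epsilon> (so x)) \<phi> c"
    and K: "K \<in> module_hom R (colim C R (P n)) (colim C R (P n))"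
    and K_in: "\<And>x p. \<lbrakk>x \<in> Obj C; p \<in> carrier (fobj (P n) x)\<rbrakk>
      \<Longrightarrow> K (colim_in C R (P n) x p) = colim_in C R (P n) (so x) (c n x p)"
    and z: "z \<in> cycles (\<lambda>n. colim C R (P n)) (\<lambda>n. colim_map C R (P n) (d n)) n"
  shows "\<exists>b\<in>boundaries (\<lambda>n. colim C R (P n)) (\<lambda>n. colim_map C R (P n) (d n)) n.
    K z = z \<oplus>\<^bsub>colim C R (P n)\<^esub> b"
proof -
  interpret P: resolution C R F P d \<epsilon> by fact
  interpret X: chain_complex R "\<lambda>n. colim C R (P n)" "\<lambda>n. colim_map C R (P n) (d n)"
    by (rule colim_chain_complex[OF R P])
  interpret comparison C R F P d \<epsilon> "pullback so sm F" "\<lambda>n. pullback so sm (P n)" "\<lambda>n x. d n (so x)" "\<lambda>x. \<epsilon> (so x)"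
    by (intro comparison.intro comparison_axioms.intro P S.pullback_resolution[OF P] small_category_axioms R proj)
  obtain h where h: "\<And>n. nat_trans C R (P n) (pullback so sm (P (Suc n))) (h n)"
    and h0: "\<And>x p. \<lbrakk>x \<in> Obj C; p \<in> carrier (fobj (P 0) x)\<rbrakk>
      \<Longrightarrow> c 0 x p = fmap (P 0) x (so x) (\<tau> x) p \<oplus>\<^bsub>fobj (P 0) (so x)\<^esub> d 0 (so x) (h 0 x p)"
    and hS: "\<And>n x p. \<lbrakk>x \<in> Obj C; p \<in> carrier (fobj (P (Suc n)) x)\<rbrakk>
      \<Longrightarrow> c (Suc n) x p = fmap (P (Suc n)) x (so x) (\<tau> x) p \<oplus>\<^bsub>fobj (P (Suc n)) (so x)\<^esub>
        (d (Suc n) (so x) (h (Suc n) x p) \<oplus>\<^bsub>fobj (P (Suc n)) (so x)\<^esub> h n x (d n x p))"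
    using chain_lift_homotopy[OF c unit_chain_lift[OF P \<phi>]] unfolding pullback_simps by blast
  have "\<exists>H. \<forall>n. H n \<in> module_hom R (colim C R (P n)) (colim C R (P (Suc n))) \<and>
    (\<forall>x\<in>Obj C. \<forall>p\<in>carrier (fobj (P n) x). H n (colim_in C R (P n) x p) = colim_in C R (P (Suc n)) (so x) (h n x p))"
    using S.colim_along[OF R P.P_functor P.P_functor h] by (intro choice allI) blast
  then obtain H where H: "\<And>n. H n \<in> module_hom R (colim C R (P n)) (colim C R (P (Suc n)))"
    and H_in: "\<And>n x p. \<lbrakk>x \<in> Obj C; p \<in> carrier (fobj (P n) x)\<rbrakk>
      \<Longrightarrow> H n (colim_in C R (P n) x p) = colim_in C R (P (Suc n)) (so x) (h n x p)"
    by blast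
  note D = colim_map_colim[OF R P.P_functor P.P_functor P.d_nat]
  note in_add = module_homD(2)[OF colim_in_hom[OF R P.P_functor]]
  have DH_in: "colim_map C R (P n) (d n) (H n (colim_in C R (P n) x p)) = colim_in C R (P n) (so x) (d n (so x) (h n x p))"
    and DH_closed: "d n (so x) (h n x p) \<in> carrier (fobj (P n) (so x))"
    if "x \<in> Obj C" "p \<in> carrier (fobj (P n) x)" for n x p
    using nat_trans_closed[OF h that] nat_trans_closed[OF P.d_nat S.fo_Obj[OF that(1)]]
    by (simp_all add: H_in that D(2) S.fo_Obj)
  have \<tau>_closed: "fmap (P n) x (so x) (\<tau> x) p \<in> carrier (fobj (P n) (so x))"
    and \<tau>_in: "colim_in C R (P n) (so x) (fmap (P n) x (so x) (\<tau> x) p) = colim_in C R (P n) x p"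
    if "x \<in> Obj C" "p \<in> carrier (fobj (P n) x)" for n x p
    using nat_trans_closed[OF unit_nat_trans[OF P.P_functor] that]
      colim_in_fmap[OF R P.P_functor that(1) S.fo_Obj[OF that(1)] \<tau>_Hom[OF that(1)] that(2)] by simp_all
  note DH_hom = module_hom_comp[OF H D(1)]
  have bd: "colim_map C R (P n) (d n) (H n z) \<in> X.B n"
    using module_homD(1)[OF H X.cycles_carrier[OF z]] by (simp add: boundaries_def)
  show ?thesis
  proof (cases n)
    case 0
    have "K z = z \<oplus>\<^bsub>colim C R (P n)\<^esub> colim_map C R (P n) (d n) (H n z)"
    proof (rule colim_hom_eqI[OF R P.P_functor X.X_module K
          module_hom_add[OF X.X_module module_hom_id DH_hom] _ X.cycles_carrier[OF z]])
      fix x p assume xp: "x \<in> Obj C" "p \<in> carrier (fobj (P n) x)"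
      show "K (colim_in C R (P n) x p) = colim_in C R (P n) x p \<oplus>\<^bsub>colim C R (P n)\<^esub>
          colim_map C R (P n) (d n) (H n (colim_in C R (P n) x p))"
        unfolding K_in[OF xp] DH_in[OF xp]
        using h0 xp unfolding 0
        by (simp add: in_add S.fo_Obj \<tau>_closed \<tau>_in DH_closed)
    qed
    with bd show ?thesis by blast
  next
    case (Suc m)
    interpret N: module R "colim C R (P (Suc m))" by (rule X.X_module)
    note HD_hom = module_hom_comp[OF D(1) H]
    have "K z = z \<oplus>\<^bsub>colim C R (P (Suc m))\<^esub>
      (colim_map C R (P (Suc m)) (d (Suc m)) (H (Suc m) z) \<oplus>\<^bsub>colim C R (P (Suc m))\<^esub> H m (colim_map C R (P m) (d m) z))"
    proof (rule colim_hom_eqI[OF R P.P_functor X.X_module K[unfolded Suc]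
          module_hom_add[OF X.X_module module_hom_id module_hom_add[OF X.X_module DH_hom HD_hom]]
          _ X.cycles_carrier[OF z[unfolded Suc]]])
      fix x p assume xp: "x \<in> Obj C" "p \<in> carrier (fobj (P (Suc m)) x)"
      have dp: "d m x p \<in> carrier (fobj (P m) x)" by (rule nat_trans_closed[OF P.d_nat xp])
      interpret M: module R "fobj (P (Suc m)) (so x)"
        using P.P_functor S.fo_Obj[OF xp(1)] by (rule module_functor.fobj_module)
      have hdp: "h m x (d m x p) \<in> carrier (fobj (P (Suc m)) (so x))"
        using nat_trans_closed[OF h xp(1) dp] by simp
      show "K (colim_in C R (P (Suc m)) x p) = colim_in C R (P (Suc m)) x p \<oplus>\<^bsub>colim C R (P (Suc m))\<^esub>
          (colim_map C R (P (Suc m)) (d (Suc m)) (H (Suc m) (colim_in C R (P (Suc m)) x p)) \<oplus>\<^bsub>colim C R (P (Suc m))\<^esub>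
            H m (colim_map C R (P m) (d m) (colim_in C R (P (Suc m)) x p)))"
        unfolding K_in[unfolded Suc, OF xp] DH_in[OF xp] D(2)[OF xp] H_in[OF xp(1) dp] hS[OF xp]
        by (simp add: in_add S.fo_Obj xp \<tau>_closed \<tau>_in DH_closed hdp)
    qed
    moreover have "H m (colim_map C R (P m) (d m) z) = \<zero>\<^bsub>colim C R (P (Suc m))\<^esub>"
      using z module_hom_zero[OF X.X_module X.X_module H] by (simp add: Suc X.cycles_Suc)
    moreover have "colim_map C R (P (Suc m)) (d (Suc m)) (H (Suc m) z) \<in> carrier (colim C R (P (Suc m)))"
      using bd X.boundaries_cycles X.cycles_carrier unfolding Suc by blast
    ultimately have "K z = z \<oplus>\<^bsub>colim C R (P n)\<^esub> colim_map C R (P n) (d n) (H n z)"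
      by (simp add: Suc)
    with bd show ?thesis by blast
  qed
qed

end

section \<open>Invariance of functor homology\<close>

lemma functor_homology_resolution:
  fixes F :: "('o, 'm, 'r, 'v) mod_functor"
  assumes C: "small_category C" and R: "cring R" and F: "module_functor C R F"
  obtains P d \<epsilon> where "projective_resolution C R F P d \<epsilon>"
    "\<And>n. functor_homology C R F n = homology (\<lambda>i. colim C R (P i)) (\<lambda>i. colim_map C R (P i) (d i)) n"
proof -
  define Q where "Q = (SOME (P, d). \<exists>\<epsilon>. projective_resolution C R F P d \<epsilon>)"
  have "case Q of (P, d) \<Rightarrow> \<exists>\<epsilon>. projective_resolution C R F P d \<epsilon>"
    unfolding Q_def by (rule someI_ex) (use projective_resolution_exists[OF C R F] in auto)
  then obtain \<epsilon> where "projective_resolution C R F (fst Q) (snd Q) \<epsilon>" by (auto simp: split_beta)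
  then show ?thesis
    by (rule that) (simp add: functor_homology_def Q_def split_beta)
qed

lemma chain_lift_comp_pullback:
  assumes i: "cat_functor C D fo fm"
    and a: "chain_lift C R P d \<epsilon> (\<lambda>n. pullback fo fm (Q n)) (\<lambda>n x. e n (fo x)) (\<lambda>x. \<epsilon>' (fo x)) \<phi> a"
    and b: "chain_lift D R Q e \<epsilon>' P' d' \<epsilon>'' \<psi> b"
  shows "chain_lift C R P d \<epsilon> (\<lambda>n. pullback fo fm (P' n)) (\<lambda>n x. d' n (fo x)) (\<lambda>x. \<epsilon>'' (fo x))
    (\<lambda>x v. \<psi> (fo x) (\<phi> x v)) (\<lambda>n x p. b n (fo x) (a n x p))"
proof -
  interpret i: cat_functor C D fo fm by fact
  note a = chain_liftD[OF a] and b = chain_liftD[OF b]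
  have ac: "a n x p \<in> carrier (fobj (Q n) (fo x))" if "x \<in> Obj C" "p \<in> carrier (fobj (P n) x)" for n x p
    using nat_trans_closed[OF a(1) that] by simp
  show ?thesis
    by (rule chain_liftI)
      (simp_all add: nat_trans_comp[OF a(1) i.pullback_nat_trans[OF b(1)]] a(2,3) b(2,3) ac i.fo_Obj)
qed

text \<open>
  Lift \<open>\<phi> : G \<rightarrow> i\<^sup>*F\<close> and \<open>\<psi> : F \<rightarrow> j\<^sup>*G\<close> to chain maps between projective resolutions.  Their
  composites cover \<open>G(\<sigma>)\<close> and \<open>F(\<tau>)\<close>, so by \<open>chain_lift_colim_cycles\<close>, applied to \<open>\<sigma>\<close> and to \<open>\<tau>\<close>,
  the induced maps of colimits are inverse to each other up to homotopy.  The maps \<open>\<phi>\<close> and \<open>\<psi>\<close>, in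
  place of an equation \<open>G = i\<^sup>*F\<close>, let \<open>G\<close> and \<open>F\<close> have values in different types.
\<close>

theorem functor_homology_isomorphic:
  fixes G :: "('o, 'm, 'r, 'v) mod_functor" and F :: "('p, 'n, 'r, 'w) mod_functor"
  assumes R: "cring R" and G: "module_functor C R G" and F: "module_functor D R F"
    and i: "cat_functor C D io im" and j: "cat_functor D C jo jm"
    and \<sigma>: "pointed_endofunctor C (\<lambda>x. jo (io x)) (\<lambda>x y f. jm (io x) (io y) (im x y f)) \<sigma>"
    and \<tau>: "pointed_endofunctor D (\<lambda>y. io (jo y)) (\<lambda>x y f. im (jo x) (jo y) (jm x y f)) \<tau>"
    and \<phi>: "nat_trans C R G (pullback io im F) \<phi>" and \<psi>: "nat_trans D R F (pullback jo jm G) \<psi>"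
    and \<psi>\<phi>: "\<And>x a. \<lbrakk>x \<in> Obj C; a \<in> carrier (fobj G x)\<rbrakk> \<Longrightarrow> \<psi> (io x) (\<phi> x a) = fmap G x (jo (io x)) (\<sigma> x) a"
    and \<phi>\<psi>: "\<And>y b. \<lbrakk>y \<in> Obj D; b \<in> carrier (fobj F y)\<rbrakk> \<Longrightarrow> \<phi> (jo y) (\<psi> y b) = fmap F y (io (jo y)) (\<tau> y) b"
  shows "module_isomorphic R (functor_homology C R G n) (functor_homology D R F n)"
proof -
  interpret i: cat_functor C D io im by fact
  interpret j: cat_functor D C jo jm by fact
  interpret \<sigma>: pointed_endofunctor C "\<lambda>x. jo (io x)" "\<lambda>x y f. jm (io x) (io y) (im x y f)" \<sigma> by fact
  interpret \<tau>: pointed_endofunctor D "\<lambda>y. io (jo y)" "\<lambda>x y f. im (jo x) (jo y) (jm x y f)" \<tau> by fact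
  have C: "small_category C" and D: "small_category D"
    by (rule \<sigma>.small_category_axioms \<tau>.small_category_axioms)+
  obtain P d \<epsilon> where P: "projective_resolution C R G P d \<epsilon>"
    and HP: "\<And>n. functor_homology C R G n = homology (\<lambda>i. colim C R (P i)) (\<lambda>i. colim_map C R (P i) (d i)) n"
    by (rule functor_homology_resolution[OF C R G]) blast
  obtain Q e \<epsilon>' where Q: "projective_resolution D R F Q e \<epsilon>'"
    and HQ: "\<And>n. functor_homology D R F n = homology (\<lambda>i. colim D R (Q i)) (\<lambda>i. colim_map D R (Q i) (e i)) n"
    by (rule functor_homology_resolution[OF D R F]) blast
  note rP = projective_resolution_resolution[OF G P] and rQ = projective_resolution_resolution[OF F Q]
  have projP: "projective C R (P n)" and projQ: "projective D R (Q n)" for n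
    using P Q by (simp_all add: projective_resolution_def)
  interpret P: resolution C R G P d \<epsilon> by (rule rP)
  interpret Q: resolution D R F Q e \<epsilon>' by (rule rQ)
  interpret PQ: comparison C R G P d \<epsilon> "pullback io im F" "\<lambda>n. pullback io im (Q n)" "\<lambda>n x. e n (io x)" "\<lambda>x. \<epsilon>' (io x)"
    by (intro comparison.intro comparison_axioms.intro rP i.pullback_resolution[OF rQ] C R projP)
  interpret QP: comparison D R F Q e \<epsilon>' "pullback jo jm G" "\<lambda>n. pullback jo jm (P n)" "\<lambda>n x. d n (jo x)" "\<lambda>x. \<epsilon> (jo x)"
    by (intro comparison.intro comparison_axioms.intro rQ j.pullback_resolution[OF rP] D R projQ)
  obtain a where a: "chain_lift C R P d \<epsilon> (\<lambda>n. pullback io im (Q n)) (\<lambda>n x. e n (io x)) (\<lambda>x. \<epsilon>' (io x)) \<phi> a"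
    by (rule PQ.chain_lift_exists[OF \<phi>])
  obtain b where b: "chain_lift D R Q e \<epsilon>' (\<lambda>n. pullback jo jm (P n)) (\<lambda>n x. d n (jo x)) (\<lambda>x. \<epsilon> (jo x)) \<psi> b"
    by (rule QP.chain_lift_exists[OF \<psi>])
  have "\<exists>A. \<forall>n. A n \<in> module_hom R (colim C R (P n)) (colim D R (Q n)) \<and>
    (\<forall>x\<in>Obj C. \<forall>p\<in>carrier (fobj (P n) x). A n (colim_in C R (P n) x p) = colim_in D R (Q n) (io x) (a n x p))"
    using i.colim_along[OF R P.P_functor Q.P_functor chain_liftD(1)[OF a]] by (intro choice allI) blast
  then obtain A where A: "\<And>n. A n \<in> module_hom R (colim C R (P n)) (colim D R (Q n))"
    and A_in: "\<And>n x p. \<lbrakk>x \<in> Obj C; p \<in> carrier (fobj (P n) x)\<rbrakk>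
      \<Longrightarrow> A n (colim_in C R (P n) x p) = colim_in D R (Q n) (io x) (a n x p)" by blast
  have "\<exists>B. \<forall>n. B n \<in> module_hom R (colim D R (Q n)) (colim C R (P n)) \<and>
    (\<forall>y\<in>Obj D. \<forall>q\<in>carrier (fobj (Q n) y). B n (colim_in D R (Q n) y q) = colim_in C R (P n) (jo y) (b n y q))"
    using j.colim_along[OF R Q.P_functor P.P_functor chain_liftD(1)[OF b]] by (intro choice allI) blast
  then obtain B where B: "\<And>n. B n \<in> module_hom R (colim D R (Q n)) (colim C R (P n))"
    and B_in: "\<And>n y q. \<lbrakk>y \<in> Obj D; q \<in> carrier (fobj (Q n) y)\<rbrakk>
      \<Longrightarrow> B n (colim_in D R (Q n) y q) = colim_in C R (P n) (jo y) (b n y q)" by blast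
  note dP = colim_map_colim[OF R P.P_functor P.P_functor P.d_nat]
    and dQ = colim_map_colim[OF R Q.P_functor Q.P_functor Q.d_nat]
  have a_closed: "a n x p \<in> carrier (fobj (Q n) (io x))" if "x \<in> Obj C" "p \<in> carrier (fobj (P n) x)" for n x p
    using nat_trans_closed[OF chain_liftD(1)[OF a] that] by simp
  have b_closed: "b n y q \<in> carrier (fobj (P n) (jo y))" if "y \<in> Obj D" "q \<in> carrier (fobj (Q n) y)" for n y q
    using nat_trans_closed[OF chain_liftD(1)[OF b] that] by simp
  show ?thesis
    unfolding HP HQ
  proof (rule homology_isomorphic[OF colim_chain_complex[OF R rP] colim_chain_complex[OF R rQ] A B])
    fix n z assume z: "z \<in> carrier (colim C R (P (Suc n)))"
    show "A n (colim_map C R (P n) (d n) z) = colim_map D R (Q n) (e n) (A (Suc n) z)"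
      by (rule colim_hom_eqI[OF R P.P_functor colim_module[OF R Q.P_functor] module_hom_comp[OF dP(1) A]
            module_hom_comp[OF A dQ(1)] _ z])
        (simp add: dP(2) dQ(2) A_in nat_trans_closed[OF P.d_nat] a_closed i.fo_Obj chain_liftD(3)[OF a])
  next
    fix n z assume z: "z \<in> carrier (colim D R (Q (Suc n)))"
    show "B n (colim_map D R (Q n) (e n) z) = colim_map C R (P n) (d n) (B (Suc n) z)"
      by (rule colim_hom_eqI[OF R Q.P_functor colim_module[OF R P.P_functor] module_hom_comp[OF dQ(1) B]
            module_hom_comp[OF B dP(1)] _ z])
        (simp add: dP(2) dQ(2) B_in nat_trans_closed[OF Q.d_nat] b_closed j.fo_Obj chain_liftD(3)[OF b])
  next
    fix n z assume z: "z \<in> cycles (\<lambda>n. colim C R (P n)) (\<lambda>n. colim_map C R (P n) (d n)) n"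
    show "\<exists>c\<in>boundaries (\<lambda>n. colim C R (P n)) (\<lambda>n. colim_map C R (P n) (d n)) n.
        B n (A n z) = z \<oplus>\<^bsub>colim C R (P n)\<^esub> c"
      by (rule \<sigma>.chain_lift_colim_cycles[OF R rP projP \<psi>\<phi>
            chain_lift_comp_pullback[OF i a b, unfolded pullback_pullback] module_hom_comp[OF A B] _ z])
        (simp_all add: A_in B_in a_closed i.fo_Obj)
  next
    fix n z assume z: "z \<in> cycles (\<lambda>n. colim D R (Q n)) (\<lambda>n. colim_map D R (Q n) (e n)) n"
    show "\<exists>c\<in>boundaries (\<lambda>n. colim D R (Q n)) (\<lambda>n. colim_map D R (Q n) (e n)) n.
        A n (B n z) = z \<oplus>\<^bsub>colim D R (Q n)\<^esub> c"
      by (rule \<tau>.chain_lift_colim_cycles[OF R rQ projQ \<phi>\<psi>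
            chain_lift_comp_pullback[OF j b a, unfolded pullback_pullback] module_hom_comp[OF B A] _ z])
        (simp_all add: A_in B_in b_closed j.fo_Obj)
  qed
qed

section \<open>Adjoining a point to a finite set\<close>

text \<open>
  The new point is added at the end: \<open>{0, \<dots>, s - 1}\<close> becomes \<open>[s] = {0, \<dots>, s}\<close>.  Hence the object part
  of the functor \<open>\<Delta>S\<^sub>+ \<rightarrow> \<Delta>S\<close> that adds a point is the cardinality, and the cardinality of a set is
  also the new point of its enlargement.
\<close>

definition cardinality :: "nat option \<Rightarrow> nat"
  where "cardinality = case_option 0 Suc"

text \<open>
  For \<open>\<iota>\<^sub>n\<close> this is the empty map with empty fibres, in the default values that morphisms of \<open>\<Delta>S\<close>
  have outside their domain.  Thus all morphisms of \<open>\<Delta>S\<^sub>+\<close> are described in the same way, by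
  \<open>map_and_fibres_Hom\<close>.
\<close>

definition map_and_fibres ::
  "((nat \<Rightarrow> nat) \<times> (nat \<Rightarrow> nat list)) option \<Rightarrow> (nat \<Rightarrow> nat) \<times> (nat \<Rightarrow> nat list)"
  where "map_and_fibres = case_option (\<lambda>_. undefined, \<lambda>_. []) id"

text \<open>
  The new point goes to the new point, and its fibre contains nothing else.
\<close>

definition add_point ::
  "nat option \<Rightarrow> nat option \<Rightarrow> ((nat \<Rightarrow> nat) \<times> (nat \<Rightarrow> nat list)) option \<Rightarrow>
    (nat \<Rightarrow> nat) \<times> (nat \<Rightarrow> nat list)"
  where "add_point x y \<alpha> = (let (f, L) = map_and_fibres \<alpha>; s = cardinality x; t = cardinality y
    in (f(s := t), L(t := [s])))"

lemma cardinality_simps [simp]: "cardinality None = 0" "cardinality (Some n) = Suc n"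
  by (simp_all add: cardinality_def)

lemma Hom_DeltaS_plus_cases:
  assumes "\<alpha> \<in> Hom DeltaS_plus x y"
  obtains "x = None" "\<alpha> = None"
  | n m \<alpha>' where "x = Some n" "y = Some m" "\<alpha> = Some \<alpha>'" "\<alpha>' \<in> DeltaS_Hom n m"
  using assms by (auto simp: DeltaS_plus_def split: option.splits)

lemma map_and_fibres_Hom:
  assumes "\<alpha> \<in> Hom DeltaS_plus x y" and "map_and_fibres \<alpha> = (f, L)"
  shows "f \<in> {..<cardinality x} \<rightarrow>\<^sub>E {..<cardinality y}"
    "j < cardinality y \<Longrightarrow> distinct (L j) \<and> set (L j) = {i. i < cardinality x \<and> f i = j}"
    "\<not> j < cardinality y \<Longrightarrow> L j = []"
  using assms
  by (auto elim!: Hom_DeltaS_plus_cases simp: map_and_fibres_def DeltaS_Hom_iff less_Suc_eq_le PiE_iff extensional_def)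

lemma add_point_Hom:
  assumes "\<alpha> \<in> Hom DeltaS_plus x y"
  shows "add_point x y \<alpha> \<in> DeltaS_Hom (cardinality x) (cardinality y)"
proof -
  obtain f L where fL: "map_and_fibres \<alpha> = (f, L)" by fastforce
  note h = map_and_fibres_Hom[OF assms fL]
  have f: "f i < cardinality y" if "i < cardinality x" for i using h(1) that by auto
  have fne: "f i \<noteq> cardinality y" if "i < cardinality x" for i using f[OF that] by simp
  have f0: "f i = undefined" if "\<not> i < cardinality x" for i using h(1) that by (auto simp: PiE_iff extensional_def)
  have "f(cardinality x := cardinality y) \<in> {0..cardinality x} \<rightarrow>\<^sub>E {0..cardinality y}"
    using f f0 by (auto simp: PiE_iff extensional_def le_less)
  moreover have "distinct ((L(cardinality y := [cardinality x])) j) \<and>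
      set ((L(cardinality y := [cardinality x])) j) = {i \<in> {0..cardinality x}. (f(cardinality x := cardinality y)) i = j}"
    if "j \<in> {0..cardinality y}" for j
    using that h(2)[of j] fne by (cases "j = cardinality y") (auto simp: le_less)
  moreover have "(L(cardinality y := [cardinality x])) j = []" if "j \<notin> {0..cardinality y}" for j
    using that h(3)[of j] by auto
  ultimately show ?thesis unfolding add_point_def fL Let_def split_conv DeltaS_Hom_iff by blast
qed

lemma add_point_Comp:
  assumes \<alpha>: "\<alpha> \<in> Hom DeltaS_plus x y" and \<beta>: "\<beta> \<in> Hom DeltaS_plus y z"
  shows "add_point x z (Comp DeltaS_plus x y z \<beta> \<alpha>) =
    Comp DeltaS (cardinality x) (cardinality y) (cardinality z) (add_point y z \<beta>) (add_point x y \<alpha>)"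
proof -
  obtain f L where fL: "map_and_fibres \<alpha> = (f, L)" by fastforce
  obtain g K where gK: "map_and_fibres \<beta> = (g, K)" by fastforce
  note f = map_and_fibres_Hom[OF \<alpha> fL] and g = map_and_fibres_Hom[OF \<beta> gK]
  have comp: "map_and_fibres (Comp DeltaS_plus x y z \<beta> \<alpha>) =
      (\<lambda>i\<in>{..<cardinality x}. g (f i), \<lambda>i. concat (map L (K i)))"
    using \<alpha>
  proof (cases rule: Hom_DeltaS_plus_cases)
    case 1
    then show ?thesis using fL by (auto simp: map_and_fibres_def DeltaS_plus_def)
  next
    case (2 n m \<alpha>')
    with \<beta> obtain l \<beta>' where "z = Some l" "\<beta> = Some \<beta>'" by (auto elim: Hom_DeltaS_plus_cases)
    with 2 fL gK show ?thesis
      by (auto simp: map_and_fibres_def DeltaS_plus_def atLeast0AtMost lessThan_Suc_atMost)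
  qed
  have f': "f i \<noteq> cardinality y" if "i < cardinality x" for i using PiE_mem[OF f(1), of i] that by simp
  have K': "cardinality y \<notin> set (K i)" for i
    using g(2)[of i] g(3)[of i] by (cases "i < cardinality z") auto
  then have *: "map (L(cardinality y := [cardinality x])) (K i) = map L (K i)" for i by auto
  show ?thesis
    unfolding add_point_def comp fL gK Let_def split_conv DeltaS_simps
    using f' by (auto simp: fun_eq_iff * le_less)
qed

lemma add_point_functor: "cat_functor DeltaS_plus DeltaS cardinality add_point"
proof
  fix x
  show "add_point x x (Ident DeltaS_plus x) = Ident DeltaS (cardinality x)"
    by (cases x) (auto simp: add_point_def map_and_fibres_def DeltaS_plus_def fun_eq_iff)
qed (simp_all add: add_point_Hom add_point_Comp)

lemma inclusion_functor: "cat_functor DeltaS DeltaS_plus Some (\<lambda>n m. Some)"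
  by standard (simp_all add: DeltaS_plus_def)

text \<open>
  The identity of \<open>[n]\<close> and the inclusion \<open>[n] \<rightarrow> [n+1]\<close> are the same pair of a map and a family of
  lists, since the list over \<open>n+1\<close> is the default \<open>[]\<close> in both.  So \<open>Ident\<close> also denotes the
  inclusion.  The two equations together are its naturality.
\<close>

lemma add_point_Some_nat:
  assumes "\<alpha> \<in> DeltaS_Hom n m"
  shows "Comp DeltaS n (Suc n) (Suc m) (add_point (Some n) (Some m) (Some \<alpha>)) (Ident DeltaS n) = \<alpha>"
    and "Comp DeltaS n m (Suc m) (Ident DeltaS m) \<alpha> = \<alpha>"
proof -
  obtain f L where \<alpha>: "\<alpha> = (f, L)" by fastforce
  have f: "f \<in> {0..n} \<rightarrow>\<^sub>E {0..m}" using assms by (simp add: \<alpha> DeltaS_Hom_iff)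
  have L: "set (L j) \<subseteq> {0..n}" "L (Suc m) = []" for j
    using assms by (cases "j \<le> m"; auto simp: \<alpha> DeltaS_Hom_iff)+
  have "concat (map (\<lambda>j. if j \<in> {0..n} then [j] else []) xs) = xs" if "set xs \<subseteq> {0..n}" for xs
    using that by (induction xs) auto
  from this[OF L(1)] L(2) f
  show "Comp DeltaS n (Suc n) (Suc m) (add_point (Some n) (Some m) (Some \<alpha>)) (Ident DeltaS n) = \<alpha>"
    by (auto simp: \<alpha> add_point_def map_and_fibres_def fun_eq_iff PiE_iff extensional_def)
  have "Comp DeltaS n m (Suc m) (Ident DeltaS m) \<alpha> = Comp DeltaS n m m (Ident DeltaS m) \<alpha>"
    by (simp add: \<alpha>)
  also have "\<dots> = \<alpha>"
    using small_category.Comp_Ident_left[OF small_category_DeltaS, of n m \<alpha>] assms by simp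
  finally show "Comp DeltaS n m (Suc m) (Ident DeltaS m) \<alpha> = \<alpha>" .
qed

lemma inclusion_Hom: "Ident DeltaS n \<in> DeltaS_Hom n (Suc n)"
  by (auto simp: DeltaS_Hom_iff)

lemma pointed_DeltaS:
  "pointed_endofunctor DeltaS (\<lambda>n. cardinality (Some n)) (\<lambda>n m \<alpha>. add_point (Some n) (Some m) (Some \<alpha>)) (Ident DeltaS)"
proof (intro pointed_endofunctor.intro pointed_endofunctor_axioms.intro small_category_DeltaS
    cat_functor_comp[OF inclusion_functor add_point_functor])
qed (use inclusion_Hom add_point_Some_nat in simp_all)

lemma pointed_DeltaS_plus:
  "pointed_endofunctor DeltaS_plus (\<lambda>x. Some (cardinality x)) (\<lambda>x y \<alpha>. Some (add_point x y \<alpha>)) (Ident DeltaS_plus)"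
proof (intro pointed_endofunctor.intro pointed_endofunctor_axioms.intro small_category_DeltaS_plus
    cat_functor_comp[OF add_point_functor inclusion_functor])
  fix x
  show "Ident DeltaS_plus x \<in> Hom DeltaS_plus x (Some (cardinality x))"
    using inclusion_Hom by (cases x) (auto simp: DeltaS_plus_def)
next
  fix x y \<alpha> assume "\<alpha> \<in> Hom DeltaS_plus x y"
  then show "Comp DeltaS_plus x (Some (cardinality x)) (Some (cardinality y)) (Some (add_point x y \<alpha>)) (Ident DeltaS_plus x) =
      Comp DeltaS_plus x y (Some (cardinality y)) (Ident DeltaS_plus y) \<alpha>"
  proof (cases rule: Hom_DeltaS_plus_cases)
    case 1
    then show ?thesis by (simp add: DeltaS_plus_def)
  next
    case (2 n m \<alpha>')
    then show ?thesis using add_point_Some_nat[of \<alpha>' n m] by (simp add: DeltaS_plus_def del: DeltaS_simps(3,4))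
  qed
qed

section \<open>The two bar constructions\<close>

context
  fixes R :: "('r, 'x) ring_scheme" and A :: "('r, 'a) module"
  assumes RA: "assoc_algebra R A"
begin

lemma Bsym_plus_simps:
  "fobj (Bsym_plus R A) (Some n) = transport_module Inr (fobj (Bsym R A) n)"
  "fmap (Bsym_plus R A) (Some n) (Some m) (Some \<alpha>) (Inr v) = Inr (fmap (Bsym R A) n m \<alpha> v)"
  by (simp_all add: Bsym_plus_def)

lemma Bsym_into_Bsym_plus:
  "nat_trans DeltaS R (Bsym R A) (pullback Some (\<lambda>n m. Some) (Bsym_plus R A)) (\<lambda>n. Inr)"
  by (rule nat_transI) (simp_all add: Bsym_plus_simps transport_hom)

lemma Bsym_plus_onto_Bsym:
  "nat_trans DeltaS R (pullback Some (\<lambda>n m. Some) (Bsym_plus R A)) (Bsym R A) (\<lambda>n. projr)"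
proof (rule nat_transI)
  have inr: "inj_on Inr S" for S by simp
  show "projr \<in> module_hom R (fobj (pullback Some (\<lambda>n m. Some) (Bsym_plus R A)) n) (fobj (Bsym R A) n)" for n
    by (rule module_homI)
      (auto simp: Bsym_plus_simps transport_module_simps transport_module_ops[OF inr])
qed (auto simp: Bsym_plus_simps transport_module_simps)

end

text \<open>
  The maps \<open>\<phi>\<close> and \<open>\<psi>\<close> of the invariance theorem are the inclusion \<open>Inr\<close> of the tensor powers, and
  the effect of adding a point followed by the inverse of \<open>Inr\<close>; every value of the latter is a
  tensor, also at \<open>[-1]\<close>, where \<open>r\<close> is sent to \<open>r\<close> times the unit of \<open>A\<close>.
\<close>

theorem theorem31:
  fixes k :: "'r ring" and A :: "('r, 'a) module"
  assumes "cring k" and "assoc_algebra k A"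
  shows "\<forall>n. module_isomorphic k (HS k A n) (functor_homology DeltaS_plus k (Bsym_plus k A) n)"
proof
  fix n
  interpret \<tau>: pointed_endofunctor DeltaS_plus "\<lambda>x. Some (cardinality x)" "\<lambda>x y \<alpha>. Some (add_point x y \<alpha>)" "Ident DeltaS_plus"
    by (rule pointed_DeltaS_plus)
  note B = Bsym_functor[OF assms(2)] and B_plus = Bsym_plus_functor[OF assms(2)]
  let ?u = "\<lambda>x. fmap (Bsym_plus k A) x (Some (cardinality x)) (Ident DeltaS_plus x)"
  note u = \<tau>.unit_nat_trans[OF B_plus]
  have retract: "nat_trans DeltaS_plus k (Bsym_plus k A) (pullback cardinality add_point (Bsym k A)) (\<lambda>x b. projr (?u x b))"
    using nat_trans_comp[OF u cat_functor.pullback_nat_trans[OF add_point_functor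
          Bsym_plus_onto_Bsym[OF assms(2)], unfolded pullback_pullback]] .
  show "module_isomorphic k (HS k A n) (functor_homology DeltaS_plus k (Bsym_plus k A) n)"
    unfolding HS_def
  proof (rule functor_homology_isomorphic[OF assms(1) B B_plus inclusion_functor add_point_functor pointed_DeltaS
        pointed_DeltaS_plus Bsym_into_Bsym_plus[OF assms(2)] retract])
    show "projr (?u (Some m) (Inr a)) = fmap (Bsym k A) m (cardinality (Some m)) (Ident DeltaS m) a" for m a
      by (simp add: DeltaS_plus_def Bsym_plus_simps[OF assms(2)] del: DeltaS_simps)
    show "Inr (projr (?u x b)) = ?u x b" if "x \<in> Obj DeltaS_plus" "b \<in> carrier (fobj (Bsym_plus k A) x)" for x b
      using nat_trans_closed[OF u that] by (auto simp: Bsym_plus_simps[OF assms(2)] transport_module_simps)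
  qed
qed

end
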